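(* Let $0<\rho_0<\rho_1<1$, $\varphi_i=\log[\rho_i/(1-\rho_i)]$, and $\varepsilon\in(0,\varepsilon_0)$ with $\varepsilon_0=1/(\varphi_1-\varphi_0)$. The functional $\hat\Lambda:L^1([0,1])\to\mathbb R$, with $L^1([0,1])$ endowed with the strong (norm) topology, is convex and continuous, in particular locally Lipschitz. Moreover, for each $\rho\in L^1([0,1])$ we have $D^\pm_{\mathrm F}\hat\Lambda(\rho)\subset\mathcal W$. Finally, $\hat\Lambda$ is a Fréchet viscosity solution of $\hat{\mathbb H}(\rho,DU)=0$ in $\hat M$, namely for any $\rho\in\hat M$ $$\hat{\mathbb H}(\rho,w)\le0\quad\forall w\in D^+_{\mathrm F}\hat\Lambda(\rho),\qquad\hat{\mathbb H}(\rho,w)\ge0\quad\forall w\in D^-_{\mathrm F}\hat\Lambda(\rho).$$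
   Context: $\sigma(a)=a(1-a)$; $\langle\cdot,\cdot\rangle$ denotes integration over $[0,1]$ of the product. $\hat M=\{\rho\in L^1([0,1]):0\le\rho\le1\}$. $W^{2,1}([0,1])$ is the Sobolev space of functions whose second weak derivative is in $L^1([0,1])$, and $\mathcal W=\{w\in W^{2,1}([0,1]):w(0)=\varphi_0,\ w(1)=\varphi_1\}$. The Hamiltonian $\hat{\mathbb H}:\hat M\times\mathcal W\to\mathbb R$ is $$\hat{\mathbb H}(\rho,w)=-\varepsilon\langle w_x,\sigma(\rho)w_x\rangle-\varepsilon\langle\rho,w_{xx}\rangle+\langle\sigma(\rho),w_x\rangle-\rho_1[1-\varepsilon w_x(1)]+\rho_0[1-\varepsilon w_x(0)].$$ $\mathcal F$ is the set of functions $\varphi(x)=\varphi_0+\mu([0,x])$, $x\in[0,1]$, with $\mu=d\varphi$ a positive Borel measure on $[0,1]$ of total mass $\varphi_1-\varphi_0$. $s(a)=a\log a+(1-a)\log(1-a)$ for $a\in[0,1]$ (with $0\log0=0$), $+\infty$ otherwise. $\Lambda:L^1([0,1])\to(-\infty,+\infty]$ is $\Lambda(\varphi)=\int_0^1[s(\varepsilon\varphi_x)+\varphi-\log(1+e^\varphi)]dx$ if $\varphi\in\mathcal F$ and $d\varphi$ is absolutely continuous with density $\varphi_x$ satisfying $0\le\varepsilon\varphi_x\le1$ a.e., and $\Lambda(\varphi)=+\infty$ otherwise. For $\rho\in L^1([0,1])$, $$\hat\Lambda(\rho)=\sup\{\langle\rho,\varphi\rangle-\Lambda(\varphi):\varphi\in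 L^1([0,1]),\ \Lambda(\varphi)<\infty\}$$ (functions $\varphi$ with $\Lambda(\varphi)<\infty$ are bounded). For a Banach space $B$, $g:B\to\mathbb R$, $x\in B$: $D^+_{\mathrm F}g(x)$ (resp. $D^-_{\mathrm F}g(x)$) is the set of $\ell\in B^*$ with $\limsup_{y\to x}\frac{g(y)-g(x)-\langle\ell,y-x\rangle}{|y-x|_B}\le0$ (resp. $\liminf_{y\to x}\frac{g(y)-g(x)-\langle\ell,y-x\rangle}{|y-x|_B}\ge0$). Here $B=L^1([0,1])$, $B^*=L^\infty([0,1])$. *)

theory Defs
  imports "HOL-Analysis.Analysis"
begin

section \<open>The space \<open>L\<^sup>1([0,1])\<close>\<close>

abbreviation unit_leb :: "real measure" where
  "unit_leb \<equiv> restrict_space lborel {0..1}"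

quotient_type L1 = "real \<Rightarrow> real" / partial:
  "\<lambda>f g. integrable unit_leb f \<and> integrable unit_leb g \<and> (AE x in unit_leb. f x = g x)"
  morphisms rep_L1 abs_L1
proof (rule part_equivpI)
  show "\<exists>f. integrable unit_leb f \<and> integrable unit_leb f \<and> (AE x in unit_leb. f x = (f x :: real))"
    by (rule exI[of _ "\<lambda>_. 0"]) simp
  show "symp (\<lambda>f g. integrable unit_leb f \<and> integrable unit_leb g \<and> (AE x in unit_leb. f x = (g x :: real)))"
    by (auto simp: symp_def)
  show "transp (\<lambda>f g. integrable unit_leb f \<and> integrable unit_leb g \<and> (AE x in unit_leb. f x = (g x :: real)))"
    by (auto simp: transp_def)
qed

instantiation L1 :: real_normed_vector
begin

lift_definition zero_L1 :: L1 is "\<lambda>_. 0" by simp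

lift_definition plus_L1 :: "L1 \<Rightarrow> L1 \<Rightarrow> L1" is "\<lambda>f g x. f x + g x"
  by (auto elim: eventually_elim2)

lift_definition minus_L1 :: "L1 \<Rightarrow> L1 \<Rightarrow> L1" is "\<lambda>f g x. f x - g x"
  by (auto elim: eventually_elim2)

lift_definition uminus_L1 :: "L1 \<Rightarrow> L1" is "\<lambda>f x. - f x"
  by auto

lift_definition scaleR_L1 :: "real \<Rightarrow> L1 \<Rightarrow> L1" is "\<lambda>c f x. c * f x"
  by auto

lift_definition norm_L1 :: "L1 \<Rightarrow> real" is "\<lambda>f. LINT x|unit_leb. \<bar>f x\<bar>"
  by (auto intro!: integral_cong_AE)

definition sgn_L1 :: "L1 \<Rightarrow> L1" where "sgn_L1 u = inverse (norm u) *\<^sub>R u"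

definition dist_L1 :: "L1 \<Rightarrow> L1 \<Rightarrow> real" where "dist_L1 u v = norm (u - v)"

definition uniformity_L1 :: "(L1 \<times> L1) filter" where
  "uniformity_L1 = (INF e\<in>{0<..}. principal {(u, v). dist u v < e})"

definition open_L1 :: "L1 set \<Rightarrow> bool" where
  "open_L1 U = (\<forall>u\<in>U. \<forall>\<^sub>F (u', v) in uniformity. u' = u \<longrightarrow> v \<in> U)"

instance
proof
  fix u v w :: L1 and a b :: real
  show "u + v + w = u + (v + w)"
    by transfer (auto simp: algebra_simps)
  show "u + v = v + u"
    by transfer (auto simp: algebra_simps)
  show "0 + u = u"
    by transfer simp
  show "- u + u = 0"
    by transfer simp
  show "u - v = u + - v"
    by transfer simp
  show "a *\<^sub>R (u + v) = a *\<^sub>R u + a *\<^sub>R v"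
    by transfer (auto simp: algebra_simps)
  show "(a + b) *\<^sub>R u = a *\<^sub>R u + b *\<^sub>R u"
    by transfer (auto simp: algebra_simps)
  show "a *\<^sub>R b *\<^sub>R u = (a * b) *\<^sub>R u"
    by transfer (auto simp: algebra_simps)
  show "1 *\<^sub>R u = u"
    by transfer simp
  show "dist u v = norm (u - v)"
    by (rule dist_L1_def)
  show "sgn u = inverse (norm u) *\<^sub>R u"
    by (rule sgn_L1_def)
  show "uniformity = (INF e\<in>{0<..}. principal {(u, v :: L1). dist u v < e})"
    by (rule uniformity_L1_def)
  show "open U = (\<forall>u\<in>U. \<forall>\<^sub>F (u', v) in uniformity. u' = u \<longrightarrow> v \<in> U)" for U :: "L1 set"
    by (rule open_L1_def)
  show "(norm u = 0) = (u = 0)"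
    by transfer (simp add: integral_nonneg_eq_0_iff_AE)
  show "norm (u + v) \<le> norm u + norm v"
  proof transfer
    fix f g :: "real \<Rightarrow> real"
    assume "integrable unit_leb f \<and> integrable unit_leb f \<and> (AE x in unit_leb. f x = f x)"
      and "integrable unit_leb g \<and> integrable unit_leb g \<and> (AE x in unit_leb. g x = g x)"
    then have *: "integrable unit_leb f" "integrable unit_leb g" by auto
    then have "(LINT x|unit_leb. \<bar>f x + g x\<bar>) \<le> (LINT x|unit_leb. \<bar>f x\<bar> + \<bar>g x\<bar>)"
      by (intro integral_mono) auto
    also have "\<dots> = (LINT x|unit_leb. \<bar>f x\<bar>) + (LINT x|unit_leb. \<bar>g x\<bar>)"
      using * by simp
    finally show "(LINT x|unit_leb. \<bar>f x + g x\<bar>) \<le> (LINT x|unit_leb. \<bar>f x\<bar>) + (LINT x|unit_leb. \<bar>g x\<bar>)" .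
  qed
  show "norm (a *\<^sub>R u) = \<bar>a\<bar> * norm u"
    by transfer (simp add: abs_mult)
qed

end

text \<open>
  \<^term>\<open>rep_L1 u\<close> is an arbitrary representative of the class \<open>u\<close>; it is used below only inside
  integrals and almost-everywhere statements.
\<close>

definition pairing :: "L1 \<Rightarrow> L1 \<Rightarrow> real" where
  "pairing u v = (LINT x|unit_leb. rep_L1 u x * rep_L1 v x)"

text \<open>
  The embedding of \<open>L\<^sup>\<infinity>([0,1])\<close> into the dual of \<open>L\<^sup>1([0,1])\<close>. It is meaningful only for
  essentially bounded \<open>w\<close> (otherwise the map is not bounded linear); it is used only for
  \<open>w\<close> in the set \<open>W_bc\<close> below, whose elements have continuous representatives.
\<close>

definition dual_L1 :: "L1 \<Rightarrow> (L1 \<Rightarrow>\<^sub>L real)" where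
  "dual_L1 w = Blinfun (\<lambda>\<rho>. pairing \<rho> w)"


section \<open>Frechet super- and subdifferentials\<close>

definition superdiff_F :: "('a :: real_normed_vector \<Rightarrow> real) \<Rightarrow> 'a \<Rightarrow> ('a \<Rightarrow>\<^sub>L real) set" where
  "superdiff_F g x =
     {l. Limsup (at x) (\<lambda>y. ereal ((g y - g x - blinfun_apply l (y - x)) / norm (y - x))) \<le> 0}"

definition subdiff_F :: "('a :: real_normed_vector \<Rightarrow> real) \<Rightarrow> 'a \<Rightarrow> ('a \<Rightarrow>\<^sub>L real) set" where
  "subdiff_F g x =
     {l. Liminf (at x) (\<lambda>y. ereal ((g y - g x - blinfun_apply l (y - x)) / norm (y - x))) \<ge> 0}"


section \<open>Sobolev spaces on the unit interval\<close>

text \<open>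
  Test functions are of class \<open>C\<^sup>1\<close> with compact support in the open interval \<open>(0,1)\<close>, a usual
  choice for first-order weak derivatives; smooth test functions give the same notion.
\<close>

definition test_functions :: "(real \<Rightarrow> real) set" where
  "test_functions = {\<psi>. \<psi> C1_differentiable_on UNIV \<and> closure {x. \<psi> x \<noteq> 0} \<subseteq> {0<..<1}}"

definition has_weak_deriv :: "L1 \<Rightarrow> L1 \<Rightarrow> bool" where
  "has_weak_deriv u v \<longleftrightarrow> (\<forall>\<psi>\<in>test_functions.
     (LINT x|unit_leb. rep_L1 u x * deriv \<psi> x) = - (LINT x|unit_leb. rep_L1 v x * \<psi> x))"

text \<open>The weak derivative is unique if it exists.\<close>

definition weak_deriv :: "L1 \<Rightarrow> L1" where
  "weak_deriv u = (THE v. has_weak_deriv u v)"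

text \<open>The second weak derivative is the weak derivative of the weak derivative, all being in \<open>L\<^sup>1\<close>.\<close>

definition W21 :: "L1 set" where
  "W21 = {w. \<exists>v z. has_weak_deriv w v \<and> has_weak_deriv v z}"

text \<open>
  Pointwise values of a class having a continuous representative on \<open>[0,1]\<close>, that is, values of
  that representative, which is unique on \<open>[0,1]\<close>. In particular this applies to \<open>w\<close> and
  \<open>weak_deriv w\<close> for \<open>w\<close> in \<open>W21\<close>.
\<close>

definition cont_rep :: "L1 \<Rightarrow> real \<Rightarrow> real" where
  "cont_rep u = (SOME f. continuous_on {0..1} f \<and> (AE x in unit_leb. rep_L1 u x = f x))"

definition W_bc :: "real \<Rightarrow> real \<Rightarrow> L1 set" where
  "W_bc \<phi>0 \<phi>1 = {w \<in> W21. cont_rep w 0 = \<phi>0 \<and> cont_rep w 1 = \<phi>1}"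


section \<open>The Hamiltonian\<close>

definition \<sigma> :: "real \<Rightarrow> real" where
  "\<sigma> a = a * (1 - a)"

definition M_hat :: "L1 set" where
  "M_hat = {\<rho>. AE x in unit_leb. 0 \<le> rep_L1 \<rho> x \<and> rep_L1 \<rho> x \<le> 1}"

definition H_hat :: "real \<Rightarrow> real \<Rightarrow> real \<Rightarrow> L1 \<Rightarrow> L1 \<Rightarrow> real" where
  "H_hat \<epsilon> \<rho>0 \<rho>1 \<rho> w =
     (let wx = weak_deriv w; wxx = weak_deriv wx in
      - \<epsilon> * (LINT x|unit_leb. rep_L1 wx x * (\<sigma> (rep_L1 \<rho> x) * rep_L1 wx x))
      - \<epsilon> * pairing \<rho> wxx
      + (LINT x|unit_leb. \<sigma> (rep_L1 \<rho> x) * rep_L1 wx x)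
      - \<rho>1 * (1 - \<epsilon> * cont_rep wx 1)
      + \<rho>0 * (1 - \<epsilon> * cont_rep wx 0))"


section \<open>The functionals\<close>

text \<open>
  \<open>is_dphi \<phi>0 \<phi>1 \<phi> \<mu>\<close>: the class \<open>\<phi>\<close> contains the function
  \<open>x \<mapsto> \<phi>0 + \<mu>([0,x])\<close>, where \<open>\<mu>\<close> is a Borel measure on \<open>[0,1]\<close> of total mass \<open>\<phi>1 - \<phi>0\<close>.
  Atoms of \<open>\<mu>\<close> at the end points are allowed. Given \<open>\<phi>\<close>, the measure is unique.
\<close>

definition is_dphi :: "real \<Rightarrow> real \<Rightarrow> L1 \<Rightarrow> real measure \<Rightarrow> bool" where
  "is_dphi \<phi>0 \<phi>1 \<phi> \<mu> \<longleftrightarrow>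
     sets \<mu> = sets (restrict_space borel {0..1}) \<and>
     emeasure \<mu> {0..1} = ennreal (\<phi>1 - \<phi>0) \<and>
     (AE x in unit_leb. rep_L1 \<phi> x = \<phi>0 + measure \<mu> {0..x})"

definition F_set :: "real \<Rightarrow> real \<Rightarrow> L1 set" where
  "F_set \<phi>0 \<phi>1 = {\<phi>. \<exists>\<mu>. is_dphi \<phi>0 \<phi>1 \<phi> \<mu>}"

definition dphi :: "real \<Rightarrow> real \<Rightarrow> L1 \<Rightarrow> real measure" where
  "dphi \<phi>0 \<phi>1 \<phi> = (THE \<mu>. is_dphi \<phi>0 \<phi>1 \<phi> \<mu>)"

definition phi_x :: "real \<Rightarrow> real \<Rightarrow> L1 \<Rightarrow> real \<Rightarrow> real" where
  "phi_x \<phi>0 \<phi>1 \<phi> x = enn2real (RN_deriv unit_leb (dphi \<phi>0 \<phi>1 \<phi>) x)"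

text \<open>
  The function \<open>s\<close> is \<open>+\<infinity>\<close> outside \<open>[0,1]\<close>; below it is evaluated only at points of \<open>[0,1]\<close> (up to null
  sets), so the real-valued expression is used. Note \<open>ln 0 = 0\<close>, so \<open>0 log 0 = 0\<close>.
\<close>

definition s_fun :: "real \<Rightarrow> real" where
  "s_fun a = a * ln a + (1 - a) * ln (1 - a)"

definition Lambda :: "real \<Rightarrow> real \<Rightarrow> real \<Rightarrow> L1 \<Rightarrow> ereal" where
  "Lambda \<epsilon> \<phi>0 \<phi>1 \<phi> =
     (if \<phi> \<in> F_set \<phi>0 \<phi>1 \<and>
         absolutely_continuous unit_leb (dphi \<phi>0 \<phi>1 \<phi>) \<and>
         (AE x in unit_leb. 0 \<le> \<epsilon> * phi_x \<phi>0 \<phi>1 \<phi> x \<and> \<epsilon> * phi_x \<phi>0 \<phi>1 \<phi> x \<le> 1)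
      then ereal (LINT x|unit_leb.
             s_fun (\<epsilon> * phi_x \<phi>0 \<phi>1 \<phi> x) + rep_L1 \<phi> x - ln (1 + exp (rep_L1 \<phi> x)))
      else \<infinity>)"

definition Lambda_hat :: "real \<Rightarrow> real \<Rightarrow> real \<Rightarrow> L1 \<Rightarrow> ereal" where
  "Lambda_hat \<epsilon> \<phi>0 \<phi>1 \<rho> =
     Sup {ereal (pairing \<rho> \<phi>) - Lambda \<epsilon> \<phi>0 \<phi>1 \<phi> | \<phi>. Lambda \<epsilon> \<phi>0 \<phi>1 \<phi> < \<infinity>}"

end

theory Submission
  imports Defs "HOL-Probability.Probability" "HOL-Complex_Analysis.Great_Picard"
begin

text \<open>
  Write \<open>\<phi> f = \<phi>0 + \<integral>\<^sub>0 f\<close> for the profile with density \<open>f\<close>; then the Legendre transform of \<open>\<Lambda>\<close> at \<open>\<rho>\<close> is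
  the supremum of \<open>J \<rho> f = \<langle>\<rho>, \<phi> f\<rangle> - \<Lambda> (\<phi> f)\<close> over densities with \<open>0 \<le> \<epsilon> f \<le> 1\<close> and the right mass.
  Linearising the convex part \<open>ln (1 + exp \<phi>) - \<phi>\<close> of \<open>J\<close> at \<open>f\<close> leaves a strictly concave problem with an
  explicit, equicontinuous solution at which \<open>J\<close> is no smaller. By Arzela-Ascoli maximisers therefore exist,
  and they satisfy the Euler-Lagrange equation \<open>f' = f (1 - \<epsilon> f) / \<epsilon> (1 / (1 + exp \<phi>) - \<rho>)\<close>, whence
  \<open>\<phi> f\<close> lies in \<open>W\<^sup>2\<^sup>,\<^sup>1\<close> and the Hamiltonian vanishes there by integration by parts.
  Each \<open>\<phi> f\<close> of a maximiser is a subgradient, so it is the only possible supergradient.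
  A subgradient is, conversely, a limit of convex combinations of maximisers, which remain in a compact
  convex set of densities with second order regularity; since the Hamiltonian is concave in its second
  argument, it is nonnegative at them.
\<close>

section \<open>Primitives on the unit interval\<close>

text \<open>The obstacle is that \<open>J \<rho>\<close> adds a convex term to a strictly concave
  one: maximisers need not be unique and the transform need not be differentiable. A subgradient may
  then be a mixture of profiles that satisfies no Euler-Lagrange equation itself, and only an
  inequality for the Hamiltonian survives. At a maximiser the Hamiltonian vanishes because its
  integrand is the derivative of \<open>lg (\<phi> f) * (1 - e * f)\<close>, with \<open>lg\<close>
  the logistic function, and \<open>lg\<close> maps the boundary data to \<open>\<rho>0\<close> and
  \<open>\<rho>1\<close>, so the boundary terms cancel exactly. The bound on
  \<open>\<epsilon>\<close> puts the constant density of the right mass strictly below the ceiling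
  \<open>1 / \<epsilon>\<close>; this is what brackets the multiplier of the linearised problem. As
  \<open>\<rho>\<close> is only integrable, no Lipschitz bounds on densities are available;
  equicontinuity is measured by increments of the primitive of one dominating function. A separation
  argument for subgradients is replaced by minimising a squared defect over finitely many
  directions, followed by compactness.\<close>

lemma space_unit_leb [simp]: "space unit_leb = {0..1}"
  by (simp add: space_restrict_space)

lemma sets_unit_leb: "sets unit_leb = sets (restrict_space borel {0..1})"
  by (simp add: sets_restrict_space)

lemma emeasure_unit_leb: "emeasure unit_leb {0..1} = 1"
  by (subst emeasure_restrict_space) auto

interpretation ul: prob_space unit_leb
  by (rule prob_spaceI) (simp add: emeasure_unit_leb)

interpretation ulp: pair_sigma_finite unit_leb unit_leb ..

lemma integral_unit_leb_eq:
  fixes f :: "real \<Rightarrow> real"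
  shows "(LINT x|unit_leb. f x) = (LINT x:{0..1}|lborel. f x)"
  by (simp add: integral_restrict_space set_lebesgue_integral_def)

lemma integrable_unit_leb_bounded:
  fixes f :: "real \<Rightarrow> real"
  assumes "f \<in> borel_measurable unit_leb" "\<And>x. x \<in> {0..1} \<Longrightarrow> \<bar>f x\<bar> \<le> B"
  shows "integrable unit_leb f"
  by (rule ul.integrable_const_bound[of _ B]) (use assms in \<open>auto intro!: AE_I2\<close>)

lemma measurable_unit_leb_continuous:
  fixes f :: "real \<Rightarrow> real"
  assumes "continuous_on {0..1} f"
  shows "f \<in> borel_measurable unit_leb"
proof -
  have "f \<in> borel_measurable (restrict_space borel {0..1})"
    by (rule borel_measurable_continuous_on_restrict[OF assms])
  thus ?thesis by (simp cong: measurable_cong_sets add: sets_unit_leb)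
qed

lemma continuous_bounded_unit:
  fixes f :: "real \<Rightarrow> real"
  assumes "continuous_on {0..1} f"
  obtains B where "0 \<le> B" "\<And>x. x \<in> {0..1} \<Longrightarrow> \<bar>f x\<bar> \<le> B"
proof -
  have "bounded (f ` {0..1})"
    by (intro compact_imp_bounded compact_continuous_image assms compact_Icc)
  then obtain B where "\<forall>x\<in>f ` {0..1}. norm x \<le> B" unfolding bounded_iff by blast
  hence "\<bar>f x\<bar> \<le> max B 0" if "x \<in> {0..1}" for x using that by (simp add: le_max_iff_disj)
  thus ?thesis using that[of "max B 0"] by simp
qed

lemma integrable_unit_leb_continuous:
  fixes f :: "real \<Rightarrow> real"
  assumes "continuous_on {0..1} f"
  shows "integrable unit_leb f"
  using continuous_bounded_unit[OF assms] integrable_unit_leb_bounded[OF measurable_unit_leb_continuous[OF assms]]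
  by metis

lemma integrable_mult_bounded:
  fixes u f :: "real \<Rightarrow> real"
  assumes u: "integrable unit_leb u" and f: "f \<in> borel_measurable unit_leb"
    and B: "AE x in unit_leb. \<bar>f x\<bar> \<le> B"
  shows "integrable unit_leb (\<lambda>x. u x * f x)" "integrable unit_leb (\<lambda>x. f x * u x)"
proof -
  show "integrable unit_leb (\<lambda>x. u x * f x)"
  proof (rule Bochner_Integration.integrable_bound[of _ "\<lambda>x. B * u x"])
    show "AE x in unit_leb. norm (u x * f x) \<le> norm (B * u x)"
      using B
    proof eventually_elim
      case (elim x)
      have "\<bar>u x\<bar> * \<bar>f x\<bar> \<le> \<bar>u x\<bar> * \<bar>B\<bar>" by (intro mult_left_mono) (use elim in auto)
      thus ?case by (simp add: abs_mult mult.commute)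
    qed
  qed (use u f in \<open>auto\<close>)
  thus "integrable unit_leb (\<lambda>x. f x * u x)" by (simp add: mult.commute)
qed

lemma integrable_mult_continuous:
  fixes u f :: "real \<Rightarrow> real"
  assumes u: "integrable unit_leb u" and f: "continuous_on {0..1} f"
  shows "integrable unit_leb (\<lambda>x. u x * f x)" "integrable unit_leb (\<lambda>x. f x * u x)"
proof -
  obtain B where B: "\<And>x. x \<in> {0..1} \<Longrightarrow> \<bar>f x\<bar> \<le> B" using continuous_bounded_unit[OF f] by metis
  note * = integrable_mult_bounded[OF u measurable_unit_leb_continuous[OF f], of B]
  show "integrable unit_leb (\<lambda>x. u x * f x)" "integrable unit_leb (\<lambda>x. f x * u x)"
    by (intro *; use B in \<open>auto intro!: AE_I2\<close>)+
qed

lemma AE_unit_leb_neq: "AE t in unit_leb. t \<noteq> (x::real)"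
proof -
  have "AE t in lborel. t \<noteq> x" by (rule AE_lborel_singleton)
  thus ?thesis by (subst AE_restrict_space_iff) auto
qed

lemma AE_unit_leb_dense:
  assumes "AE x in unit_leb. P x" "a < b" "0 \<le> a" "b \<le> 1"
  obtains x where "a < x" "x < b" "P x"
proof -
  have ae: "AE x in lborel. x \<in> {0..1} \<longrightarrow> P x"
    using assms(1) by (subst (asm) AE_restrict_space_iff) auto
  have "\<exists>x. a < x \<and> x < b \<and> P x"
  proof (rule ccontr)
    assume "\<not> ?thesis"
    hence "AE x in lborel. x \<notin> {a<..<b}" using ae assms(3,4) by (auto elim!: eventually_mono)
    hence "emeasure lborel {a<..<b} = 0"
      by (subst (asm) AE_iff_measurable[of "{a<..<b}"]) auto
    thus False using assms(2) by simp
  qed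
  thus ?thesis using that by blast
qed

lemma continuous_AE_eq_unit:
  fixes f g :: "real \<Rightarrow> real"
  assumes f: "continuous_on {0..1} f" and g: "continuous_on {0..1} g"
    and ae: "AE x in unit_leb. f x = g x" and x: "x \<in> {0..1}"
  shows "f x = g x"
proof (rule ccontr)
  assume ne: "f x \<noteq> g x"
  define h where "h = (\<lambda>x. f x - g x)"
  have h: "continuous_on {0..1} h" unfolding h_def by (intro continuous_intros f g)
  have "\<bar>h x\<bar> > 0" using ne by (simp add: h_def)
  then obtain d where d: "d > 0" "\<And>y. y \<in> {0..1} \<Longrightarrow> dist y x < d \<Longrightarrow> dist (h y) (h x) < \<bar>h x\<bar>"
    using h x unfolding continuous_on_iff by blast
  \<comment> \<open>The interval lies on one side of \<open>x\<close>, since \<open>x\<close> may be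
    an end point of the unit interval.\<close>
  obtain a b where ab: "a < b" "0 \<le> a" "b \<le> 1" "\<And>y. a < y \<Longrightarrow> y < b \<Longrightarrow> dist y x < d"
  proof (cases "x < 1")
    case True
    show thesis using that[of x "min 1 (x + d)"] True d(1) x by (auto simp: dist_real_def)
  next
    case False
    show thesis using that[of "max 0 (x - d)" x] False d(1) x by (auto simp: dist_real_def)
  qed
  obtain y where y: "a < y" "y < b" "f y = g y" using AE_unit_leb_dense[OF ae ab(1-3)] by blast
  have "dist (h y) (h x) < \<bar>h x\<bar>" using d(2)[of y] ab(2-4) y by auto
  thus False using y(3) by (simp add: h_def dist_real_def)
qed

text \<open>Integrating an indicator over the whole unit interval makes \<open>prim u\<close> total
  on the reals, constant outside \<open>[0,1]\<close>, and lets limits in \<open>x\<close> be taken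
  by dominated convergence.\<close>

definition prim :: "(real \<Rightarrow> real) \<Rightarrow> real \<Rightarrow> real" where
  "prim u x = (LINT t|unit_leb. indicator {..x} t * u t)"

lemma indicator_measurable_unit [measurable]:
  "A \<in> sets borel \<Longrightarrow> (indicator A :: real \<Rightarrow> real) \<in> borel_measurable unit_leb"
  by (rule measurable_restrict_space1) simp

lemma integrable_indicator_mult:
  fixes u :: "real \<Rightarrow> real"
  assumes "integrable unit_leb u" "A \<in> sets borel"
  shows "integrable unit_leb (\<lambda>t. indicator A t * u t)"
  by (rule integrable_mult_bounded(2)[where B=1, OF assms(1) indicator_measurable_unit[OF assms(2)]])
    (auto simp: indicator_def)

lemma prim_0 [simp]: "prim u 0 = 0"
  unfolding prim_def
proof (rule integral_eq_zero_AE)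
  show "AE x in unit_leb. indicator {..0} x * u x = 0"
    using AE_unit_leb_neq[of 0] AE_space by eventually_elim (auto simp: indicator_def)
qed

lemma prim_1: "x \<ge> 1 \<Longrightarrow> prim u x = (LINT t|unit_leb. u t)"
  unfolding prim_def by (rule Bochner_Integration.integral_cong) auto

lemma prim_cong_AE:
  assumes "integrable unit_leb u" "integrable unit_leb v" "AE t in unit_leb. u t = v t"
  shows "prim u x = prim v x"
  unfolding prim_def
  by (rule integral_cong_AE) (use assms in \<open>auto elim: eventually_mono\<close>)

lemma prim_cong:
  assumes "\<And>t. t \<in> {0..1} \<Longrightarrow> u t = v t"
  shows "prim u x = prim v x"
  unfolding prim_def by (rule Bochner_Integration.integral_cong) (use assms in auto)

lemma prim_add:
  assumes "integrable unit_leb u" "integrable unit_leb v"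
  shows "prim (\<lambda>t. u t + v t) x = prim u x + prim v x"
  unfolding prim_def distrib_left
  by (intro Bochner_Integration.integral_add integrable_indicator_mult assms) auto

lemma prim_diff:
  assumes "integrable unit_leb u" "integrable unit_leb v"
  shows "prim (\<lambda>t. u t - v t) x = prim u x - prim v x"
  unfolding prim_def right_diff_distrib
  by (intro Bochner_Integration.integral_diff integrable_indicator_mult assms) auto

lemma prim_cmult: "prim (\<lambda>t. c * u t) x = c * prim u x"
  unfolding prim_def by (simp add: mult.left_commute)

lemma prim_increment:
  assumes "integrable unit_leb u" "a \<le> b"
  shows "prim u b - prim u a = (LINT t|unit_leb. indicator {a<..b} t * u t)"
proof -
  have "prim u b - prim u a = (LINT t|unit_leb. indicator {..b} t * u t - indicator {..a} t * u t)"
    unfolding prim_def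
    by (rule Bochner_Integration.integral_diff[symmetric]) (auto intro: integrable_indicator_mult assms)
  also have "\<dots> = (LINT t|unit_leb. indicator {a<..b} t * u t)"
    by (rule Bochner_Integration.integral_cong) (use assms(2) in \<open>auto simp: indicator_def\<close>)
  finally show ?thesis .
qed

lemma integral_AE_mono:
  fixes u v :: "real \<Rightarrow> real"
  assumes "integrable unit_leb u" "integrable unit_leb v" "AE t in unit_leb. u t \<le> v t"
  shows "(LINT t|unit_leb. u t) \<le> (LINT t|unit_leb. v t)"
  by (rule integral_mono_AE) (use assms in auto)

lemma prim_increment_le:
  assumes "integrable unit_leb u" "integrable unit_leb v" "AE t in unit_leb. \<bar>u t\<bar> \<le> v t" "a \<le> b"
  shows "\<bar>prim u b - prim u a\<bar> \<le> prim v b - prim v a"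
proof -
  have "\<bar>LINT t|unit_leb. indicator {a<..b} t * u t\<bar> \<le> (LINT t|unit_leb. \<bar>indicator {a<..b} t * u t\<bar>)"
    by (rule integral_abs_bound)
  also have "\<dots> \<le> (LINT t|unit_leb. indicator {a<..b} t * v t)"
    by (rule integral_AE_mono)
      (use assms in \<open>auto intro!: integrable_indicator_mult integrable_abs simp: abs_mult mult_left_mono elim!: eventually_mono\<close>)
  finally show ?thesis using assms by (simp add: prim_increment)
qed

lemma prim_increment_abs:
  assumes "integrable unit_leb u" "a \<le> b"
  shows "\<bar>prim u b - prim u a\<bar> \<le> prim (\<lambda>t. \<bar>u t\<bar>) b - prim (\<lambda>t. \<bar>u t\<bar>) a"
  by (rule prim_increment_le) (use assms in auto)

lemma prim_mono_nonneg:
  assumes "integrable unit_leb u" "AE t in unit_leb. 0 \<le> u t" "a \<le> b"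
  shows "prim u a \<le> prim u b"
proof -
  have "\<bar>prim (\<lambda>t. 0 * u t) b - prim (\<lambda>t. 0 * u t) a\<bar> \<le> prim u b - prim u a"
    by (rule prim_increment_le) (use assms in auto)
  thus ?thesis by simp
qed

lemma prim_abs_le:
  assumes "integrable unit_leb u"
  shows "\<bar>prim u x\<bar> \<le> (LINT t|unit_leb. \<bar>u t\<bar>)"
proof -
  have "\<bar>LINT t|unit_leb. indicator {..x} t * u t\<bar> \<le> (LINT t|unit_leb. \<bar>indicator {..x} t * u t\<bar>)"
    by (rule integral_abs_bound)
  also have "\<dots> \<le> (LINT t|unit_leb. \<bar>u t\<bar>)"
    by (rule integral_AE_mono)
      (use assms in \<open>auto intro!: integrable_indicator_mult integrable_abs AE_I2 mult_left_le_one_le simp: abs_mult\<close>)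
  finally show ?thesis by (simp add: prim_def)
qed

text \<open>As \<open>x\<close> moves, the indicators converge at every \<open>t\<close> except
  \<open>t = x\<close>, a null set, and \<open>\<bar>u\<bar>\<close> dominates.\<close>

lemma prim_continuous:
  assumes "integrable unit_leb u"
  shows "continuous_on S (prim u)"
proof -
  have "isCont (prim u) x" for x
    unfolding continuous_at_sequentially comp_def
  proof (intro allI impI)
    fix y :: "nat \<Rightarrow> real" assume y: "y \<longlonglongrightarrow> x"
    show "(\<lambda>n. prim u (y n)) \<longlonglongrightarrow> prim u x"
      unfolding prim_def
    proof (rule integral_dominated_convergence[where w="\<lambda>t. \<bar>u t\<bar>"])
      show "AE t in unit_leb. (\<lambda>n. indicator {..y n} t * u t) \<longlonglongrightarrow> indicator {..x} t * u t"
        using AE_unit_leb_neq[of x]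
      proof eventually_elim
        case (elim t)
        have "eventually (\<lambda>n. indicator {..y n} t = (indicator {..x} t :: real)) sequentially"
        proof (cases "t < x")
          case True
          from order_tendstoD(1)[OF y this] show ?thesis
            by eventually_elim (use True in \<open>auto simp: indicator_def\<close>)
        next
          case False
          with elim have "x < t" by simp
          from order_tendstoD(2)[OF y this] show ?thesis
            by eventually_elim (use \<open>x < t\<close> in \<open>auto simp: indicator_def\<close>)
        qed
        hence "(\<lambda>n. indicator {..y n} t :: real) \<longlonglongrightarrow> indicator {..x} t" by (rule tendsto_eventually)
        thus ?case by (intro tendsto_intros)
      qed
      show "AE t in unit_leb. norm (indicator {..y n} t * u t) \<le> \<bar>u t\<bar>" for n
        by (auto simp: indicator_def)
    qed (use assms in auto)
  qed
  thus ?thesis by (intro continuous_at_imp_continuous_on) auto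
qed

lemma prim_eq_integral:
  assumes u: "continuous_on {0..1} u" and x: "x \<in> {0..1}"
  shows "prim u x = integral {0..x} u"
proof -
  have sub: "{0..x} \<subseteq> {0..1}" using x by auto
  have "prim u x = (LINT t:{0..x}|lborel. u t)"
    unfolding prim_def integral_unit_leb_eq set_lebesgue_integral_def
    by (rule Bochner_Integration.integral_cong) (use x in \<open>auto simp: indicator_def\<close>)
  also have "\<dots> = integral {0..x} u"
    by (rule set_borel_integral_eq_integral(2))
      (rule borel_integrable_atLeastAtMost', rule continuous_on_subset[OF u sub])
  finally show ?thesis .
qed

lemma prim_has_derivative:
  assumes u: "continuous_on {0..1} u" and x: "x \<in> {0..1}"
  shows "(prim u has_real_derivative u x) (at x within {0..1})"
  using integral_has_real_derivative[OF u x] unfolding has_field_derivative_def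
  by (rule has_derivative_transform[OF x prim_eq_integral[OF u], rotated])

lemma prim_FTC:
  assumes R: "\<And>x. x \<in> {0..1} \<Longrightarrow> (R has_real_derivative R' x) (at x within {0..1})"
    and R': "continuous_on {0..1} R'" and x: "x \<in> {0..1}"
  shows "prim R' x = R x - R 0"
proof -
  have "(R' has_integral R x - R 0) {0..x}"
  proof (rule fundamental_theorem_of_calculus)
    show "(R has_vector_derivative R' y) (at y within {0..x})" if "y \<in> {0..x}" for y
    proof -
      have "(R has_real_derivative R' y) (at y within {0..x})"
        by (rule has_field_derivative_subset[OF R]) (use that x in auto)
      thus ?thesis by (simp add: has_real_derivative_iff_has_vector_derivative)
    qed
  qed (use x in auto)
  thus ?thesis using prim_eq_integral[OF R' x] by (simp add: integral_unique)
qed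

text \<open>Fubini on the triangle \<open>t \<le> x\<close>. Both functions are merely integrable,
  so no pointwise product rule is at hand.\<close>

lemma prim_by_parts:
  assumes u: "integrable unit_leb u" and v: "integrable unit_leb v"
  shows "(LINT x|unit_leb. u x * prim v x) = prim u 1 * prim v 1 - (LINT x|unit_leb. prim u x * v x)"
proof -
  define F where "F = (\<lambda>(x, t). u x * v t * (indicator {t..} x :: real))"
  have uv: "integrable (unit_leb \<Otimes>\<^sub>M unit_leb) (\<lambda>p. u (fst p) * v (snd p))"
    by (rule ulp.Fubini_integrable) (use u v in \<open>auto simp: abs_mult\<close>)
  have F: "integrable (unit_leb \<Otimes>\<^sub>M unit_leb) F"
  proof (rule Bochner_Integration.integrable_bound[OF uv])
    have "{p :: real \<times> real. snd p \<le> fst p} \<in> sets (borel \<Otimes>\<^sub>M borel)"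
      unfolding borel_prod by (intro borel_closed closed_Collect_le continuous_intros)
    have m: "(\<lambda>p. p) \<in> (unit_leb \<Otimes>\<^sub>M unit_leb) \<rightarrow>\<^sub>M (borel \<Otimes>\<^sub>M borel)"
      by (intro measurable_pair) (auto intro!: measurable_compose[OF measurable_fst] measurable_compose[OF measurable_snd] measurable_restrict_space1 simp: comp_def)
    have "(\<lambda>p. indicator {p :: real \<times> real. snd p \<le> fst p} p :: real) \<in> borel_measurable (unit_leb \<Otimes>\<^sub>M unit_leb)"
      by (rule measurable_compose[OF m]) (use \<open>_ \<in> sets (borel \<Otimes>\<^sub>M borel)\<close> in simp)
    moreover have "F = (\<lambda>p. u (fst p) * v (snd p) * indicator {p :: real \<times> real. snd p \<le> fst p} p)"
      by (auto simp: F_def indicator_def fun_eq_iff)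
    ultimately show "F \<in> borel_measurable (unit_leb \<Otimes>\<^sub>M unit_leb)"
      using uv by auto
  qed (auto simp: F_def indicator_def)
  have "(LINT x|unit_leb. u x * prim v x) = (LINT x|unit_leb. LINT t|unit_leb. F (x, t))"
  proof (rule Bochner_Integration.integral_cong)
    fix x
    have "u x * prim v x = (LINT t|unit_leb. u x * (indicator {..x} t * v t))"
      unfolding prim_def by simp
    also have "\<dots> = (LINT t|unit_leb. F (x, t))"
      by (rule Bochner_Integration.integral_cong) (auto simp: F_def indicator_def)
    finally show "u x * prim v x = (LINT t|unit_leb. F (x, t))" .
  qed simp
  also have "\<dots> = (LINT t|unit_leb. LINT x|unit_leb. F (x, t))"
    using ulp.Fubini_integral[of "\<lambda>t x. F (x, t)"] ulp.integrable_product_swap[OF F]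
    by (simp add: case_prod_unfold)
  also have "\<dots> = (LINT t|unit_leb. (prim u 1 - prim u t) * v t)"
  proof (rule Bochner_Integration.integral_cong)
    fix t assume "t \<in> space unit_leb"
    hence t: "t \<le> 1" by simp
    have "(LINT x|unit_leb. F (x, t)) = (LINT x|unit_leb. v t * (indicator {t<..1} x * u x))"
    proof (rule integral_cong_AE)
      show "AE x in unit_leb. F (x, t) = v t * (indicator {t<..1} x * u x)"
        using AE_unit_leb_neq[of t] AE_space by eventually_elim (auto simp: F_def indicator_def)
    qed (use u in \<open>auto simp: F_def\<close>)
    thus "(LINT x|unit_leb. F (x, t)) = (prim u 1 - prim u t) * v t"
      using prim_increment[OF u t] by simp
  qed simp
  also have "\<dots> = (LINT t|unit_leb. prim u 1 * v t - prim u t * v t)"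
    by (simp add: left_diff_distrib)
  also have "\<dots> = (LINT t|unit_leb. prim u 1 * v t) - (LINT t|unit_leb. prim u t * v t)"
    by (rule Bochner_Integration.integral_diff)
      (auto intro!: v integrable_mult_continuous prim_continuous u)
  also have "(LINT t|unit_leb. prim u 1 * v t) = prim u 1 * prim v 1"
    by (simp add: prim_1[of 1 v])
  finally show ?thesis .
qed

text \<open>Telescoping along a uniform grid of mesh below \<open>d\<close>: the bounds add up
  because the right-hand side is itself an increment.\<close>

lemma local_increment_bound_unit:
  fixes D E :: "real \<Rightarrow> real"
  assumes d: "d > 0" and x: "x \<in> {0..1}"
    and loc: "\<And>a b. 0 \<le> a \<Longrightarrow> a \<le> b \<Longrightarrow> b \<le> 1 \<Longrightarrow> b - a < d \<Longrightarrow> \<bar>D b - D a\<bar> \<le> E b - E a"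
  shows "\<bar>D x - D 0\<bar> \<le> E x - E 0"
proof -
  obtain n :: nat where n: "n > 0" "1 / real n < d"
    using d by (metis real_arch_inverse inverse_eq_divide gr0I)
  have "\<bar>D (x * real k / real n) - D 0\<bar> \<le> E (x * real k / real n) - E 0" if "k \<le> n" for k
    using that
  proof (induction k)
    case (Suc k)
    have "x * real k / real n \<le> x * real (Suc k) / real n"
      using x n by (intro divide_right_mono mult_left_mono) auto
    moreover have "x * real (Suc k) / real n \<le> 1 * real n / real n"
      using x n Suc.prems by (intro divide_right_mono mult_mono) auto
    moreover have "x * real (Suc k) / real n - x * real k / real n = x / real n"
      by (simp add: algebra_simps add_divide_distrib)
    moreover have "x / real n \<le> 1 / real n" using x n by (intro divide_right_mono) auto
    ultimately have "\<bar>D (x * real (Suc k) / real n) - D (x * real k / real n)\<bar> \<le> E (x * real (Suc k) / real n) - E (x * real k / real n)"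
      using x n by (intro loc) auto
    with Suc show ?case by linarith
  qed simp
  from this[of n] show ?thesis using n by simp
qed

text \<open>\<open>P\<close> is only absolutely continuous, so increments are compared instead of
  pointwise derivatives. The defect \<open>D\<close> of the formula has increments quadratic in
  those of the variation \<open>E\<close>; summed over a fine grid they become arbitrarily
  small.\<close>

lemma prim_chain_rule:
  assumes p: "integrable unit_leb p" and P: "\<And>x. P x = c + prim p x"
    and G: "\<And>y. (G has_real_derivative G' y) (at y)"
    and K: "\<And>a b. \<bar>G' a - G' b\<bar> \<le> K * \<bar>a - b\<bar>" and x: "x \<in> {0..1}"
  shows "G (P x) = G (P 0) + prim (\<lambda>t. G' (P t) * p t) x"
proof -
  define E where "E = prim (\<lambda>t. \<bar>p t\<bar>)"
  define D where "D = (\<lambda>x. G (P x) - prim (\<lambda>t. G' (P t) * p t) x)"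
  have K0: "0 \<le> K" using K[of 0 1] by simp
  have G'c: "continuous_on UNIV G'"
    unfolding continuous_on_iff dist_real_def
  proof (intro ballI allI impI)
    fix a e :: real assume "e > 0"
    show "\<exists>d>0. \<forall>x'\<in>UNIV. \<bar>x' - a\<bar> < d \<longrightarrow> \<bar>G' x' - G' a\<bar> < e"
    proof (intro exI[of _ "e / (K + 1)"] conjI ballI impI)
      fix y assume "\<bar>y - a\<bar> < e / (K + 1)"
      hence "(K + 1) * \<bar>y - a\<bar> < e" using K0 by (simp add: field_simps)
      moreover have "K * \<bar>y - a\<bar> \<le> (K + 1) * \<bar>y - a\<bar>" by (simp add: distrib_right)
      ultimately show "\<bar>G' y - G' a\<bar> < e" using K[of y a] by linarith
    qed (use \<open>e > 0\<close> K0 in auto)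
  qed
  have Pc: "continuous_on {0..1} P" unfolding P by (intro continuous_intros prim_continuous p)
  have G'P: "continuous_on {0..1} (\<lambda>t. G' (P t))"
    by (rule continuous_on_compose2[OF G'c Pc]) auto
  have int: "integrable unit_leb (\<lambda>t. G' (P t) * p t)"
    by (rule integrable_mult_continuous[OF p G'P])
  have Eint: "integrable unit_leb (\<lambda>t. \<bar>p t\<bar>)" using p by simp
  have PE: "\<bar>P b - P a\<bar> \<le> E b - E a" if "a \<le> b" for a b
    using prim_increment_abs[OF p that] unfolding P E_def by simp
  \<comment> \<open>By the mean value theorem the increment of \<open>G\<close> along
    \<open>P\<close> is \<open>G' \<xi> * (P b - P a)\<close>, so the error is the integral of
    \<open>(G' \<xi> - G' (P t)) * p t\<close>. Both \<open>\<xi>\<close> and \<open>P t\<close> are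
    within \<open>E b - E a\<close> of \<open>P a\<close>, which gives the factor 2.\<close>
  have main: "\<bar>D b - D a\<bar> \<le> 2 * K * (E b - E a) * (E b - E a)" if ab: "0 \<le> a" "a \<le> b" "b \<le> 1" for a b
  proof -
    have Emono: "E s \<le> E t" if "s \<le> t" for s t
      unfolding E_def by (rule prim_mono_nonneg) (use Eint that in auto)
    obtain \<xi> where xi: "\<bar>\<xi> - P a\<bar> \<le> \<bar>P b - P a\<bar>" "G (P b) - G (P a) = G' \<xi> * (P b - P a)"
    proof -
      consider "P a < P b" | "P a = P b" | "P b < P a" by linarith
      thus thesis
      proof cases
        case 1
        from MVT2[OF 1, of G G'] G obtain z where "P a < z" "z < P b" "G (P b) - G (P a) = (P b - P a) * G' z" by blast
        thus ?thesis using that[of z] by (auto simp: mult.commute)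
      next
        case 2 thus ?thesis using that[of "P a"] by simp
      next
        case 3
        from MVT2[OF 3, of G G'] G obtain z where "P b < z" "z < P a" "G (P a) - G (P b) = (P a - P b) * G' z" by blast
        thus ?thesis using that[of z] by (auto simp: algebra_simps)
      qed
    qed
    define w where "w = (\<lambda>t. G' \<xi> * p t - G' (P t) * p t)"
    have wint: "integrable unit_leb w" unfolding w_def by (intro Bochner_Integration.integrable_diff int integrable_mult_right p)
    have "D b - D a = prim w b - prim w a"
      using xi(2) unfolding D_def w_def
      by (subst (1 2) prim_diff) (use int p P in \<open>auto simp: prim_cmult algebra_simps\<close>)
    also have "\<bar>\<dots>\<bar> = \<bar>LINT t|unit_leb. indicator {a<..b} t * w t\<bar>"
      by (simp add: prim_increment[OF wint ab(2)])
    also have "\<dots> \<le> (LINT t|unit_leb. \<bar>indicator {a<..b} t * w t\<bar>)" by (rule integral_abs_bound)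
    also have "\<dots> \<le> (LINT t|unit_leb. 2 * K * (E b - E a) * (indicator {a<..b} t * \<bar>p t\<bar>))"
    proof (rule integral_AE_mono)
      show "AE t in unit_leb. \<bar>indicator {a<..b} t * w t\<bar> \<le> 2 * K * (E b - E a) * (indicator {a<..b} t * \<bar>p t\<bar>)"
      proof (rule AE_I2)
        fix t
        show "\<bar>indicator {a<..b} t * w t\<bar> \<le> 2 * K * (E b - E a) * (indicator {a<..b} t * \<bar>p t\<bar>)"
        proof (cases "t \<in> {a<..b}")
          case True
          have "\<bar>P t - P a\<bar> \<le> E b - E a" using PE[of a t] Emono[of t b] True by auto
          moreover have "\<bar>\<xi> - P a\<bar> \<le> E b - E a" using xi(1) PE[of a b] ab by auto
          moreover have "\<bar>\<xi> - P t\<bar> \<le> \<bar>\<xi> - P a\<bar> + \<bar>P t - P a\<bar>" by linarith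
          ultimately have "\<bar>\<xi> - P t\<bar> \<le> 2 * (E b - E a)"
            using add_mono by fastforce
          hence "K * \<bar>\<xi> - P t\<bar> \<le> K * (2 * (E b - E a))" by (intro mult_left_mono K0)
          with K[of \<xi> "P t"] have "\<bar>G' \<xi> - G' (P t)\<bar> \<le> 2 * K * (E b - E a)" by linarith
          hence "\<bar>G' \<xi> - G' (P t)\<bar> * \<bar>p t\<bar> \<le> 2 * K * (E b - E a) * \<bar>p t\<bar>" by (intro mult_right_mono) auto
          moreover have "\<bar>w t\<bar> = \<bar>G' \<xi> - G' (P t)\<bar> * \<bar>p t\<bar>"
            unfolding w_def left_diff_distrib[symmetric] abs_mult by simp
          ultimately show ?thesis using True by simp
        qed simp
      qed
    qed (auto intro!: integrable_indicator_mult integrable_abs wint p)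
    also have "\<dots> = 2 * K * (E b - E a) * (E b - E a)"
      using prim_increment[OF Eint ab(2)] by (simp add: E_def)
    finally show ?thesis .
  qed
  have "\<bar>D x - D 0\<bar> \<le> e" if "e > 0" for e
  proof -
    \<comment> \<open>Chosen so that \<open>2 * K * e' * E x \<le> e\<close>; the added ones keep
      the denominator positive.\<close>
    define e' where "e' = e / (2 * K * (E x + 1) + 1)"
    have Ex: "0 \<le> E x" using prim_mono_nonneg[OF Eint, of 0 x] x by (simp add: E_def)
    have pos: "2 * K * (E x + 1) + 1 > 0" using K0 Ex by (intro add_nonneg_pos mult_nonneg_nonneg) auto
    have e': "e' > 0" unfolding e'_def using pos that by (intro divide_pos_pos)
    have "uniformly_continuous_on {0..1} E"
      unfolding E_def by (intro compact_uniformly_continuous prim_continuous Eint compact_Icc)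
    then obtain d where d: "d > 0" "\<And>a b. a \<in> {0..1} \<Longrightarrow> b \<in> {0..1} \<Longrightarrow> dist b a < d \<Longrightarrow> dist (E b) (E a) < e'"
      using e' unfolding uniformly_continuous_on_def by meson
    have "\<bar>D x - D 0\<bar> \<le> 2 * K * e' * E x - 2 * K * e' * E 0"
    proof (rule local_increment_bound_unit[OF d(1) x])
      fix a b :: real assume ab: "0 \<le> a" "a \<le> b" "b \<le> 1" "b - a < d"
      have "E b - E a \<le> e'" using d(2)[of a b] ab by (auto simp: dist_real_def)
      moreover have "0 \<le> E b - E a" using PE[of a b] ab by linarith
      ultimately have "2 * K * (E b - E a) * (E b - E a) \<le> 2 * K * e' * (E b - E a)"
        using K0 by (intro mult_right_mono mult_left_mono) auto
      with main[OF ab(1-3)] show "\<bar>D b - D a\<bar> \<le> 2 * K * e' * E b - 2 * K * e' * E a"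
        by (simp add: right_diff_distrib)
    qed
    also have "\<dots> = e' * (2 * K * E x)" by (simp add: E_def)
    also have "\<dots> \<le> e' * (2 * K * (E x + 1) + 1)"
      using K0 e' by (intro mult_left_mono) (auto simp: algebra_simps)
    also have "\<dots> = e" using pos by (simp add: e'_def)
    finally show ?thesis .
  qed
  hence "\<bar>D x - D 0\<bar> \<le> 0" by (rule field_le_epsilon) simp
  thus ?thesis by (simp add: D_def)
qed

text \<open>The integrals of \<open>u\<close> over half-lines vanish, half-lines form an
  intersection-stable generator of the Borel sets, and the Borel sets over which \<open>u\<close>
  integrates to zero are closed under complement and countable disjoint union.\<close>

lemma AE_zero_if_prim_zero:
  assumes u: "integrable unit_leb u" and z: "\<And>x. x \<in> {0..1} \<Longrightarrow> prim u x = 0"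
  shows "AE t in unit_leb. u t = 0"
proof -
  have z': "prim u x = 0" for x
  proof (cases "x < 0")
    case True
    thus ?thesis unfolding prim_def by (intro integral_eq_zero_AE AE_I2) auto
  next
    case False
    thus ?thesis using z[of x] z[of 1] prim_1[of x u] prim_1[of 1 u] by (cases "x \<le> 1") auto
  qed
  have all: "(LINT t|unit_leb. indicator A t * u t) = 0" if "A \<in> sets borel" for A :: "real set"
  proof -
    have "Int_stable (range (atMost :: real \<Rightarrow> _))" by (auto simp: Int_stable_def)
    moreover have "range (atMost :: real \<Rightarrow> _) \<subseteq> Pow UNIV" by simp
    moreover have "A \<in> sigma_sets UNIV (range atMost)"
      using that by (simp add: borel_eq_atMost)
    ultimately show ?thesis
    proof (induction rule: sigma_sets_induct_disjoint)
      case (basic A)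
      thus ?case using z' by (auto simp: prim_def)
    next
      case (compl A)
      hence A: "A \<in> sets borel" by (simp add: borel_eq_atMost)
      have "(LINT t|unit_leb. indicator (UNIV - A) t * u t) = (LINT t|unit_leb. u t - indicator A t * u t)"
        by (rule Bochner_Integration.integral_cong) (auto simp: indicator_def)
      also have "\<dots> = (LINT t|unit_leb. u t) - (LINT t|unit_leb. indicator A t * u t)"
        by (intro Bochner_Integration.integral_diff u integrable_indicator_mult A)
      finally show ?case using compl z'[of 1] by (simp add: prim_1)
    next
      case (union A)
      hence A: "A i \<in> sets borel" for i by (auto simp: borel_eq_atMost)
      have "set_lebesgue_integral unit_leb (\<Union>i. {0..1} \<inter> A i) u = (\<Sum>i. set_lebesgue_integral unit_leb ({0..1} \<inter> A i) u)"
      proof (rule lebesgue_integral_countable_add)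
        show "{0..1} \<inter> A i \<in> sets unit_leb" for i using A by (auto simp: sets_restrict_space)
        show "set_integrable unit_leb (\<Union>i. {0..1} \<inter> A i) u"
          unfolding set_integrable_def real_scaleR_def by (intro integrable_indicator_mult u) (use A in auto)
      qed (use union in \<open>auto simp: disjoint_family_on_def\<close>)
      moreover have "set_lebesgue_integral unit_leb ({0..1} \<inter> B) u = (LINT t|unit_leb. indicator B t * u t)" for B
        unfolding set_lebesgue_integral_def by (rule Bochner_Integration.integral_cong) (auto simp: indicator_def)
      ultimately show ?case using union by (simp flip: Int_UN_distrib)
    qed simp
  qed
  show ?thesis
    by (rule ul.density_zero[OF u]) (use all in \<open>auto simp: set_lebesgue_integral_def sets_restrict_space\<close>)
qed

section \<open>Weak derivatives and the dual of \<open>L\<^sup>1\<close>\<close>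

lemma rep_L1_integrable: "integrable unit_leb (rep_L1 u)"
  using Quotient3_rep_reflp[OF Quotient3_L1, of u] by simp

lemma rep_L1_measurable: "rep_L1 u \<in> borel_measurable unit_leb"
  using rep_L1_integrable by (rule borel_measurable_integrable)

lemma rep_abs_L1: "integrable unit_leb f \<Longrightarrow> AE x in unit_leb. rep_L1 (abs_L1 f) x = f x"
  using Quotient3_rep_abs[OF Quotient3_L1, of f] by simp

lemma L1_eqI: "AE x in unit_leb. rep_L1 u x = rep_L1 v x \<Longrightarrow> u = v"
  using Quotient3_rel_rep[OF Quotient3_L1, of u v] rep_L1_integrable by blast

lemma L1_eq_absI:
  assumes "integrable unit_leb f" "AE x in unit_leb. rep_L1 u x = f x"
  shows "u = abs_L1 f"
  by (rule L1_eqI) (use rep_abs_L1[OF assms(1)] assms(2) in eventually_elim, simp)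

lemma rep_L1_plus: "AE x in unit_leb. rep_L1 (u + v) x = rep_L1 u x + rep_L1 v x"
  unfolding plus_L1_def map_fun_def comp_def id_def
  by (rule rep_abs_L1) (intro Bochner_Integration.integrable_add rep_L1_integrable)

lemma rep_L1_scaleR: "AE x in unit_leb. rep_L1 (c *\<^sub>R u) x = c * rep_L1 u x"
  unfolding scaleR_L1_def map_fun_def comp_def id_def
  by (rule rep_abs_L1) (intro integrable_mult_right rep_L1_integrable)

lemma norm_L1_eq: "norm u = (LINT x|unit_leb. \<bar>rep_L1 u x\<bar>)"
  unfolding norm_L1_def map_fun_def comp_def id_def by simp

lemma pairing_abs_L1:
  assumes "integrable unit_leb w"
  shows "pairing u (abs_L1 w) = (LINT x|unit_leb. rep_L1 u x * w x)"
  unfolding pairing_def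
proof (rule integral_cong_AE)
  show "AE x in unit_leb. rep_L1 u x * rep_L1 (abs_L1 w) x = rep_L1 u x * w x"
    using rep_abs_L1[OF assms] by eventually_elim simp
qed (use assms rep_L1_measurable in auto)

lemma bounded_linear_pairing:
  assumes B: "AE x in unit_leb. \<bar>rep_L1 w x\<bar> \<le> B"
  shows "bounded_linear (\<lambda>\<rho>. pairing \<rho> w)"
proof (rule bounded_linear_intro[where K=B])
  note int = integrable_mult_bounded(1)[OF rep_L1_integrable rep_L1_measurable B]
  note [measurable] = rep_L1_measurable
  fix u v :: L1 and c :: real
  have "pairing (u + v) w = (LINT x|unit_leb. rep_L1 u x * rep_L1 w x + rep_L1 v x * rep_L1 w x)"
    unfolding pairing_def
  proof (rule integral_cong_AE)
    show "AE x in unit_leb. rep_L1 (u + v) x * rep_L1 w x = rep_L1 u x * rep_L1 w x + rep_L1 v x * rep_L1 w x"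
      using rep_L1_plus[of u v] by eventually_elim (simp add: algebra_simps)
  qed auto
  also have "\<dots> = pairing u w + pairing v w"
    unfolding pairing_def by (intro Bochner_Integration.integral_add int)
  finally show "pairing (u + v) w = pairing u w + pairing v w" .
  have "pairing (c *\<^sub>R u) w = (LINT x|unit_leb. c * (rep_L1 u x * rep_L1 w x))"
    unfolding pairing_def
  proof (rule integral_cong_AE)
    show "AE x in unit_leb. rep_L1 (c *\<^sub>R u) x * rep_L1 w x = c * (rep_L1 u x * rep_L1 w x)"
      using rep_L1_scaleR[of c u] by eventually_elim (simp add: algebra_simps)
  qed auto
  thus "pairing (c *\<^sub>R u) w = c *\<^sub>R pairing u w" by (simp add: pairing_def)
  have "norm (pairing u w) \<le> (LINT x|unit_leb. \<bar>rep_L1 u x * rep_L1 w x\<bar>)"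
    unfolding pairing_def using integral_abs_bound by simp
  also have "\<dots> \<le> (LINT x|unit_leb. \<bar>rep_L1 u x\<bar> * B)"
  proof (rule integral_AE_mono)
    show "AE x in unit_leb. \<bar>rep_L1 u x * rep_L1 w x\<bar> \<le> \<bar>rep_L1 u x\<bar> * B"
      using B by eventually_elim (simp add: abs_mult mult_left_mono)
  qed (use int rep_L1_integrable in auto)
  finally show "norm (pairing u w) \<le> norm u * B" by (simp add: norm_L1_eq)
qed

lemma dual_L1_apply:
  assumes B: "AE x in unit_leb. \<bar>rep_L1 w x\<bar> \<le> B"
  shows "blinfun_apply (dual_L1 w) \<rho> = pairing \<rho> w"
  unfolding dual_L1_def by (simp add: bounded_linear_Blinfun_apply[OF bounded_linear_pairing[OF B]])

text \<open>The difference \<open>d\<close> of the two classes is bounded, hence may itself serve as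
  the test element; this makes the integral of \<open>d\<^sup>2\<close> zero.\<close>

lemma pairing_eq_imp_eq:
  assumes B: "AE x in unit_leb. \<bar>rep_L1 w x\<bar> \<le> B" "AE x in unit_leb. \<bar>rep_L1 w' x\<bar> \<le> B'"
    and eq: "\<And>\<rho>. pairing \<rho> w = pairing \<rho> w'"
  shows "w = w'"
proof (rule L1_eqI)
  note [measurable] = rep_L1_measurable
  define d where "d = (\<lambda>x. rep_L1 w x - rep_L1 w' x)"
  have dint: "integrable unit_leb d" unfolding d_def by (intro Bochner_Integration.integrable_diff rep_L1_integrable)
  have dB: "AE x in unit_leb. \<bar>d x\<bar> \<le> B + B'" using B by eventually_elim (auto simp: d_def)
  have dd: "integrable unit_leb (\<lambda>x. d x * d x)"
    by (rule integrable_mult_bounded[OF dint _ dB]) (use dint in auto)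
  have i: "integrable unit_leb (\<lambda>x. d x * rep_L1 w x)" "integrable unit_leb (\<lambda>x. d x * rep_L1 w' x)"
    by (rule integrable_mult_bounded(1)[OF dint rep_L1_measurable], rule B)+
  have p: "pairing (abs_L1 d) v = (LINT x|unit_leb. d x * rep_L1 v x)" for v
    unfolding pairing_def
  proof (rule integral_cong_AE)
    show "AE x in unit_leb. rep_L1 (abs_L1 d) x * rep_L1 v x = d x * rep_L1 v x"
      using rep_abs_L1[OF dint] by eventually_elim simp
  qed (use dint in auto)
  have "(LINT x|unit_leb. d x * d x) = (LINT x|unit_leb. d x * rep_L1 w x - d x * rep_L1 w' x)"
    by (rule Bochner_Integration.integral_cong) (auto simp: d_def algebra_simps)
  also have "\<dots> = 0" using eq[of "abs_L1 d"] p i by simp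
  finally have "AE x in unit_leb. d x * d x = 0"
    using dd by (subst (asm) integral_nonneg_eq_0_iff_AE) auto
  thus "AE x in unit_leb. rep_L1 w x = rep_L1 w' x" by eventually_elim (simp add: d_def)
qed

section \<open>Test functions and the fundamental lemma of the calculus of variations\<close>

lemma DERIV_max_square: "((\<lambda>y::real. (max 0 y)\<^sup>2) has_real_derivative 2 * max 0 y) (at y)"
proof -
  consider "y < 0" | "y = 0" | "y > 0" by linarith
  thus ?thesis
  proof cases
    case 1
    have "((\<lambda>y::real. 0) has_real_derivative 0) (at y)" by simp
    thus ?thesis
      using 1 by (subst DERIV_cong_ev[OF refl _ refl, where g="\<lambda>_. 0"])
        (auto intro!: eventually_mono[OF eventually_nhds_in_open[of "{..<0}" y]])
  next
    case 2
    have "(\<lambda>h::real. ((max 0 (0 + h))\<^sup>2 - (max 0 0)\<^sup>2) / h) \<midarrow>0\<rightarrow> 0"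
    proof (rule Lim_null_comparison)
      show "\<forall>\<^sub>F h in at 0. norm (((max 0 (0 + h))\<^sup>2 - (max 0 0)\<^sup>2) / h) \<le> \<bar>h::real\<bar>"
        by (auto intro!: always_eventually simp: max_def power2_eq_square)
      show "(\<lambda>h::real. \<bar>h\<bar>) \<midarrow>0\<rightarrow> 0" by (rule tendsto_rabs_zero) simp
    qed
    thus ?thesis using 2 by (simp add: DERIV_def)
  next
    case 3
    have "((\<lambda>y::real. y\<^sup>2) has_real_derivative 2 * y) (at y)"
      by (auto intro!: derivative_eq_intros)
    thus ?thesis
      using 3 by (subst DERIV_cong_ev[OF refl _ refl, where g="\<lambda>y. y\<^sup>2"])
        (auto intro!: eventually_mono[OF eventually_nhds_in_open[of "{0<..}" y]])
  qed
qed

text \<open>With \<open>h\<close> the squared positive part of \<open>(x - a) * (b - x)\<close>,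
  this is \<open>n * h / (1 + n * h)\<close>. Squaring removes the kink of the positive part, so the
  function is of class \<open>C1\<close>, and for growing \<open>n\<close> it tends to 1 exactly
  where \<open>h > 0\<close>.\<close>

definition bump :: "real \<Rightarrow> real \<Rightarrow> nat \<Rightarrow> real \<Rightarrow> real" where
  "bump a b n x = real n * (max 0 ((x - a) * (b - x)))\<^sup>2 / (1 + real n * (max 0 ((x - a) * (b - x)))\<^sup>2)"

lemma bump_zero:
  assumes "a < b" "x \<notin> {a<..<b}"
  shows "bump a b n x = 0"
proof -
  have "(x - a) * (b - x) \<le> 0"
  proof (cases "x \<le> a")
    case True thus ?thesis using assms by (intro mult_nonpos_nonneg) auto
  next
    case False thus ?thesis using assms by (intro mult_nonneg_nonpos) auto
  qed
  hence "max 0 ((x - a) * (b - x)) = 0" by simp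
  thus ?thesis unfolding bump_def by simp
qed

lemma bump_in_test_functions:
  assumes "0 < a" "a < b" "b < 1"
  shows "bump a b n \<in> test_functions"
proof -
  define h where "h = (\<lambda>x::real. (max 0 ((x - a) * (b - x)))\<^sup>2)"
  define h' where "h' = (\<lambda>x. 2 * max 0 ((x - a) * (b - x)) * (a + b - 2 * x))"
  have h: "(h has_real_derivative h' x) (at x)" for x
  proof -
    have "((\<lambda>x. (x - a) * (b - x)) has_real_derivative (a + b - 2 * x)) (at x)"
      by (auto intro!: derivative_eq_intros simp: algebra_simps)
    from DERIV_chain2[OF DERIV_max_square this] show ?thesis by (simp add: h_def h'_def)
  qed
  have pos: "1 + real n * h x > 0" for x unfolding h_def by (intro add_pos_nonneg) auto
  have eq: "bump a b n = (\<lambda>x. real n * h x / (1 + real n * h x))"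
    by (auto simp: bump_def h_def fun_eq_iff)
  have d: "(bump a b n has_real_derivative (real n * h' x) / (1 + real n * h x)\<^sup>2) (at x)" for x
    unfolding eq
    by (rule derivative_eq_intros h refl)+
      (use pos[of x] in \<open>auto simp: power2_eq_square field_simps\<close>)
  have "bump a b n C1_differentiable_on UNIV"
    unfolding C1_differentiable_on_def
  proof (intro exI[of _ "\<lambda>x. (real n * h' x) / (1 + real n * h x)\<^sup>2"] conjI ballI)
    show "(bump a b n has_vector_derivative real n * h' x / (1 + real n * h x)\<^sup>2) (at x)" for x
      using d by (simp add: has_real_derivative_iff_has_vector_derivative)
    show "continuous_on UNIV (\<lambda>x. real n * h' x / (1 + real n * h x)\<^sup>2)"
      unfolding h_def h'_def
      by (intro continuous_intros) (use pos in \<open>auto simp: h_def less_imp_neq[symmetric]\<close>)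
  qed
  moreover have "{x. bump a b n x \<noteq> 0} \<subseteq> {a..b}"
    using bump_zero[OF assms(2)] by (auto simp del: greaterThanLessThan_iff) (metis greaterThanLessThan_iff less_eq_real_def not_le)+
  hence "closure {x. bump a b n x \<noteq> 0} \<subseteq> {a..b}" by (rule closure_minimal) simp
  ultimately show ?thesis using assms unfolding test_functions_def by force
qed

lemma bump_range: "0 \<le> bump a b n x" "bump a b n x \<le> 1"
proof -
  have "1 + real n * (max 0 ((x - a) * (b - x)))\<^sup>2 > 0" by (intro add_pos_nonneg) auto
  thus "0 \<le> bump a b n x" "bump a b n x \<le> 1" by (auto simp: bump_def)
qed

lemma bump_tendsto:
  assumes "a < b"
  shows "(\<lambda>n. bump a b n x) \<longlonglongrightarrow> indicator {a<..<b} x"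
proof (cases "x \<in> {a<..<b}")
  case True
  define h where "h = (max 0 ((x - a) * (b - x)))\<^sup>2"
  have "h > 0" using True by (auto simp: h_def)
  hence "(\<lambda>n. real n * h / (1 + real n * h)) \<longlonglongrightarrow> 1" by real_asymp
  thus ?thesis using True by (simp add: bump_def h_def)
next
  case False
  hence "bump a b n x = 0" for n by (rule bump_zero[OF assms])
  thus ?thesis using False by simp
qed

lemma test_functionD:
  assumes "\<psi> \<in> test_functions"
  shows "(\<psi> has_real_derivative deriv \<psi> x) (at x)" "continuous_on UNIV (deriv \<psi>)" "continuous_on S \<psi>"
    "x \<notin> {0<..<1} \<Longrightarrow> \<psi> x = 0"
proof -
  obtain D where D: "\<And>x. (\<psi> has_vector_derivative D x) (at x)" "continuous_on UNIV D"
    using assms unfolding test_functions_def C1_differentiable_on_def by blast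
  have d: "(\<psi> has_real_derivative D x) (at x)" for x
    using D(1) by (simp add: has_real_derivative_iff_has_vector_derivative)
  have eq: "deriv \<psi> = D" by (intro ext DERIV_imp_deriv d)
  show "(\<psi> has_real_derivative deriv \<psi> x) (at x)" "continuous_on UNIV (deriv \<psi>)"
    using d D(2) eq by auto
  show "continuous_on S \<psi>"
    by (intro continuous_at_imp_continuous_on ballI DERIV_isCont[OF d])
  show "\<psi> x = 0" if "x \<notin> {0<..<1}"
  proof (rule ccontr)
    assume "\<psi> x \<noteq> 0"
    hence "x \<in> closure {x. \<psi> x \<noteq> 0}" using closure_subset[of "{x. \<psi> x \<noteq> 0}"] by auto
    thus False using assms that unfolding test_functions_def by blast
  qed
qed

text \<open>The functions \<open>bump a b n\<close> tend boundedly to the indicator of the open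
  interval, so the primitive of \<open>v\<close> takes equal values at \<open>a\<close> and
  \<open>b\<close>. It is thus constant on the open unit interval, by continuity on the closed one,
  and it vanishes at 0.\<close>

lemma fundamental_lemma:
  assumes v: "integrable unit_leb v"
    and z: "\<And>\<psi>. \<psi> \<in> test_functions \<Longrightarrow> (LINT x|unit_leb. v x * \<psi> x) = 0"
  shows "AE x in unit_leb. v x = 0"
proof (rule AE_zero_if_prim_zero[OF v])
  have eq: "prim v a = prim v b" if ab: "0 < a" "a < b" "b < 1" for a b
  proof -
    have "(\<lambda>n. LINT x|unit_leb. v x * bump a b n x) \<longlonglongrightarrow> (LINT x|unit_leb. v x * indicator {a<..<b} x)"
    proof (rule integral_dominated_convergence[where w="\<lambda>t. \<bar>v t\<bar>"])
      show "AE x in unit_leb. (\<lambda>n. v x * bump a b n x) \<longlonglongrightarrow> v x * indicator {a<..<b} x"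
        by (intro AE_I2 tendsto_intros bump_tendsto ab)
      show "AE x in unit_leb. norm (v x * bump a b n x) \<le> \<bar>v x\<bar>" for n
        using bump_range by (intro AE_I2) (simp add: abs_mult mult_left_le)
      show "(\<lambda>x. v x * bump a b n x) \<in> borel_measurable unit_leb" for n
        by (rule borel_measurable_times[OF borel_measurable_integrable[OF v]
              measurable_unit_leb_continuous[OF test_functionD(3)[OF bump_in_test_functions[OF ab]]]])
    qed (use v in auto)
    moreover have "(\<lambda>n. LINT x|unit_leb. v x * bump a b n x) = (\<lambda>n. 0)"
      using z[OF bump_in_test_functions] ab by auto
    ultimately have "(LINT x|unit_leb. v x * indicator {a<..<b} x) = 0"
      using LIMSEQ_unique[OF _ tendsto_const] by metis
    moreover have "(LINT x|unit_leb. v x * indicator {a<..<b} x) = (LINT x|unit_leb. indicator {a<..b} x * v x)"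
    proof (rule integral_cong_AE)
      show "AE x in unit_leb. v x * indicator {a<..<b} x = indicator {a<..b} x * v x"
        using AE_unit_leb_neq[of b] by eventually_elim (auto simp: indicator_def)
    qed (use v in auto)
    ultimately show ?thesis using prim_increment[OF v, of a b] ab by simp
  qed
  fix x :: real assume "x \<in> {0..1}"
  have cl: "closure {0<..<1::real} = {0..1}" by (rule closure_greaterThanLessThan) simp
  have half: "prim v y = prim v (1/2)" if "y \<in> {0..1}" for y
  proof (rule continuous_constant_on_closure[of "{0<..<1}" "prim v" "prim v (1/2)" y])
    show "continuous_on (closure {0<..<1}) (prim v)" by (rule prim_continuous[OF v])
    show "prim v x = prim v (1/2)" if "x \<in> {0<..<1}" for x
    proof -
      consider "x < 1/2" | "x = 1/2" | "1/2 < x" by linarith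
      thus ?thesis
      proof cases
        case 1 thus ?thesis using that by (intro eq) auto
      next
        case 2 show ?thesis unfolding 2 ..
      next
        case 3 thus ?thesis using that by (intro eq[symmetric]) auto
      qed
    qed
    show "y \<in> closure {0<..<1}" using that cl by simp
  qed
  show "prim v x = 0" unfolding half[OF \<open>x \<in> {0..1}\<close>] using half[of 0] by simp
qed

lemma compact_subset_unit:
  assumes "closure S \<subseteq> {0<..<1::real}"
  obtains a b where "0 < a" "b < 1" "S \<subseteq> {a..b}"
proof (cases "S = {}")
  case True thus ?thesis using that[of "1/2" "1/2"] by simp
next
  case False
  have c: "compact (closure S)"
    using assms bounded_subset[of "{0<..<1}" "closure S"] by (simp add: compact_eq_bounded_closed)
  have ne: "closure S \<noteq> {}" using False by simp
  obtain a where a: "a \<in> closure S" "\<And>x. x \<in> closure S \<Longrightarrow> a \<le> x" using compact_attains_inf[OF c ne] by blast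
  obtain b where b: "b \<in> closure S" "\<And>x. x \<in> closure S \<Longrightarrow> x \<le> b" using compact_attains_sup[OF c ne] by blast
  show ?thesis using that[of a b] a b assms closure_subset[of S] by (auto simp: subset_iff)
qed

text \<open>Zero mean is what makes the primitive vanish again to the right of the support.\<close>

lemma prim_in_test_functions:
  assumes th: "continuous_on UNIV \<theta>" and supp: "\<And>x. x \<notin> {a..b} \<Longrightarrow> \<theta> x = 0"
    and ab: "0 < a" "a \<le> b" "b < 1" and int0: "(LINT x|unit_leb. \<theta> x) = 0"
  shows "prim \<theta> \<in> test_functions" "deriv (prim \<theta>) = \<theta>"
proof -
  have thc: "continuous_on {0..1} \<theta>" using th continuous_on_subset by blast
  have thi: "integrable unit_leb \<theta>" by (rule integrable_unit_leb_continuous[OF thc])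
  have lo: "prim \<theta> x = 0" if "x < a" for x
    unfolding prim_def by (rule integral_eq_zero_AE) (use supp that in \<open>auto simp: indicator_def\<close>)
  have hi: "prim \<theta> x = 0" if "b < x" for x
  proof -
    have "prim \<theta> x = (LINT x|unit_leb. \<theta> x)" unfolding prim_def
      by (rule Bochner_Integration.integral_cong) (use supp that in \<open>auto simp: indicator_def\<close>)
    thus ?thesis using int0 by simp
  qed
  have d: "(prim \<theta> has_real_derivative \<theta> x) (at x)" for x
  proof -
    consider "x < a" | "x \<in> {a..b}" | "b < x" by fastforce
    thus ?thesis
    proof cases
      case 1
      have "(prim \<theta> has_real_derivative 0) (at x)"
        using 1 lo by (subst DERIV_cong_ev[OF refl _ refl, where g="\<lambda>_. 0"])
          (auto intro!: eventually_mono[OF eventually_nhds_in_open[of "{..<a}" x]])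
      thus ?thesis using 1 supp[of x] by simp
    next
      case 2
      have "(prim \<theta> has_real_derivative \<theta> x) (at x within {0..1})"
        by (rule prim_has_derivative[OF thc]) (use 2 ab in auto)
      moreover have "at x within {0..1} = at x" using 2 ab by (intro at_within_interior) auto
      ultimately show ?thesis by simp
    next
      case 3
      have "(prim \<theta> has_real_derivative 0) (at x)"
        using 3 hi by (subst DERIV_cong_ev[OF refl _ refl, where g="\<lambda>_. 0"])
          (auto intro!: eventually_mono[OF eventually_nhds_in_open[of "{b<..}" x]])
      thus ?thesis using 3 supp[of x] by simp
    qed
  qed
  show "deriv (prim \<theta>) = \<theta>" by (intro ext DERIV_imp_deriv d)
  have "prim \<theta> C1_differentiable_on UNIV"
    unfolding C1_differentiable_on_def
    using d th by (auto simp: has_real_derivative_iff_has_vector_derivative)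
  moreover have "{x. prim \<theta> x \<noteq> 0} \<subseteq> {a..b}" using lo hi by (force simp: not_le[symmetric])
  hence "closure {x. prim \<theta> x \<noteq> 0} \<subseteq> {a..b}" by (rule closure_minimal) simp
  ultimately show "prim \<theta> \<in> test_functions" using ab unfolding test_functions_def by force
qed

text \<open>An arbitrary test function, corrected by a multiple of the fixed \<open>\<eta>\<close>
  to have mean zero, is the derivative of a test function. Hence \<open>u\<close> minus the
  primitive of \<open>v\<close> is orthogonal to every test function of mean zero, which forces it
  to be constant.\<close>

lemma du_Bois_Reymond:
  assumes "has_weak_deriv u v"
  obtains c where "AE x in unit_leb. rep_L1 u x = c + prim (rep_L1 v) x"
proof -
  define W where "W = (\<lambda>x. rep_L1 u x - prim (rep_L1 v) x)"
  have Vi: "continuous_on {0..1} (prim (rep_L1 v))" by (rule prim_continuous[OF rep_L1_integrable])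
  have Wi: "integrable unit_leb W" unfolding W_def
    by (intro Bochner_Integration.integrable_diff rep_L1_integrable integrable_unit_leb_continuous Vi)
  define \<eta> where "\<eta> = bump (1/4) (3/4) 1"
  have eta: "\<eta> \<in> test_functions" unfolding \<eta>_def by (rule bump_in_test_functions) auto
  have eta_supp: "\<eta> x = 0" if "x \<notin> {1/4..3/4}" for x
    unfolding \<eta>_def by (rule bump_zero) (use that in auto)
  have eta_c: "continuous_on S \<eta>" for S by (rule test_functionD(3)[OF eta])
  have I: "(LINT x|unit_leb. \<eta> x) \<noteq> 0"
  proof
    assume "(LINT x|unit_leb. \<eta> x) = 0"
    hence "AE x in unit_leb. \<eta> x = 0"
      by (subst (asm) integral_nonneg_eq_0_iff_AE)
        (use integrable_unit_leb_continuous[OF eta_c] in \<open>auto simp: bump_range \<eta>_def\<close>)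
    from continuous_AE_eq_unit[OF eta_c continuous_on_const this, of "1/2"]
    have "\<eta> (1/2) = 0" by simp
    thus False by (simp add: \<eta>_def bump_def power2_eq_square)
  qed
  \<comment> \<open>The only candidate for the constant, read off by testing \<open>W\<close>
    against \<open>\<eta>\<close>.\<close>
  define c where "c = (LINT x|unit_leb. W x * \<eta> x) / (LINT x|unit_leb. \<eta> x)"
  have "AE x in unit_leb. W x - c = 0"
  proof (rule fundamental_lemma)
    show "integrable unit_leb (\<lambda>x. W x - c)" using Wi by simp
    fix \<xi> assume chi: "\<xi> \<in> test_functions"
    have chi_c: "continuous_on S \<xi>" for S by (rule test_functionD(3)[OF chi])
    obtain a b where ab: "0 < a" "b < 1" "{x. \<xi> x \<noteq> 0} \<subseteq> {a..b}"
      using compact_subset_unit chi unfolding test_functions_def by blast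
    \<comment> \<open>The multiple of \<open>\<eta>\<close> whose subtraction leaves mean
      zero.\<close>
    define k where "k = (LINT x|unit_leb. \<xi> x) / (LINT x|unit_leb. \<eta> x)"
    define \<theta> where "\<theta> = (\<lambda>x. \<xi> x - k * \<eta> x)"
    have ic: "integrable unit_leb \<xi>" "integrable unit_leb \<eta>"
      by (intro integrable_unit_leb_continuous chi_c eta_c)+
    have th_c: "continuous_on S \<theta>" for S unfolding \<theta>_def by (intro continuous_intros chi_c eta_c)
    have th_i: "integrable unit_leb \<theta>" by (intro integrable_unit_leb_continuous th_c)
    have int0: "(LINT x|unit_leb. \<theta> x) = 0"
      unfolding \<theta>_def using ic I by (simp add: k_def)
    have supp: "\<theta> x = 0" if "x \<notin> {min a (1/4)..max b (3/4)}" for x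
    proof -
      have "\<xi> x = 0" using that ab(3) by (auto simp: min_le_iff_disj le_max_iff_disj)
      moreover have "\<eta> x = 0" using that by (intro eta_supp) (auto simp: min_le_iff_disj le_max_iff_disj)
      ultimately show ?thesis by (simp add: \<theta>_def)
    qed
    note pt = prim_in_test_functions[where a="min a (1/4)" and b="max b (3/4)", OF th_c supp _ _ _ int0]
    have pt1: "prim \<theta> \<in> test_functions" by (rule pt) (use ab in auto)
    have pt2: "deriv (prim \<theta>) = \<theta>" by (rule pt) (use ab in auto)
    have "(LINT x|unit_leb. rep_L1 u x * \<theta> x) = - (LINT x|unit_leb. rep_L1 v x * prim \<theta> x)"
      using assms pt1 pt2 unfolding has_weak_deriv_def by metis
    also have "\<dots> = (LINT x|unit_leb. prim (rep_L1 v) x * \<theta> x)"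
      using prim_by_parts[OF rep_L1_integrable th_i] int0 by (simp add: prim_1)
    finally have "(LINT x|unit_leb. W x * \<theta> x) = 0"
      unfolding W_def left_diff_distrib
      by (subst Bochner_Integration.integral_diff)
        (auto intro: integrable_mult_continuous(1)[OF rep_L1_integrable th_c] integrable_mult_continuous(2)[OF th_i Vi])
    hence "(LINT x|unit_leb. W x * \<xi> x) = k * (LINT x|unit_leb. W x * \<eta> x)"
      unfolding \<theta>_def right_diff_distrib
      by (subst (asm) Bochner_Integration.integral_diff)
        (auto intro!: integrable_mult_continuous(1)[OF Wi] continuous_intros chi_c eta_c simp: mult.left_commute[of _ k])
    also have "\<dots> = c * (LINT x|unit_leb. \<xi> x)" by (simp add: k_def c_def)
    finally show "(LINT x|unit_leb. (W x - c) * \<xi> x) = 0"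
      unfolding left_diff_distrib
      by (subst Bochner_Integration.integral_diff) (auto intro: integrable_mult_continuous(1)[OF Wi chi_c] ic)
  qed
  hence "AE x in unit_leb. rep_L1 u x = c + prim (rep_L1 v) x"
    by eventually_elim (simp add: W_def)
  thus ?thesis by (rule that)
qed

lemma weak_deriv_eq:
  assumes "has_weak_deriv u v"
  shows "weak_deriv u = v"
  unfolding weak_deriv_def
proof (rule the_equality, rule assms)
  fix v' assume v': "has_weak_deriv u v'"
  have "AE x in unit_leb. rep_L1 v' x - rep_L1 v x = 0"
  proof (rule fundamental_lemma)
    show "integrable unit_leb (\<lambda>x. rep_L1 v' x - rep_L1 v x)"
      by (intro Bochner_Integration.integrable_diff rep_L1_integrable)
    fix \<psi> assume psi: "\<psi> \<in> test_functions"
    have "(LINT x|unit_leb. rep_L1 v' x * \<psi> x) = (LINT x|unit_leb. rep_L1 v x * \<psi> x)"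
      using assms v' psi unfolding has_weak_deriv_def by force
    thus "(LINT x|unit_leb. (rep_L1 v' x - rep_L1 v x) * \<psi> x) = 0"
      unfolding left_diff_distrib
      by (subst Bochner_Integration.integral_diff)
        (auto intro: integrable_mult_continuous(1)[OF rep_L1_integrable test_functionD(3)[OF psi]])
  qed
  thus "v' = v" by (intro L1_eqI) (auto elim: eventually_mono)
qed

text \<open>A test function is the primitive of its derivative and vanishes at both ends, so
  \<open>prim_by_parts\<close> leaves no boundary term.\<close>

lemma has_weak_deriv_prim:
  assumes z: "integrable unit_leb z" and F: "\<And>x. x \<in> {0..1} \<Longrightarrow> F x = c + prim z x"
  shows "has_weak_deriv (abs_L1 F) (abs_L1 z)"
  unfolding has_weak_deriv_def
proof
  note [measurable] = rep_L1_measurable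
  fix \<psi> assume psi: "\<psi> \<in> test_functions"
  note t = test_functionD[OF psi]
  have dc: "continuous_on {0..1} (deriv \<psi>)" using t(2) continuous_on_subset by blast
  have di: "integrable unit_leb (deriv \<psi>)" by (rule integrable_unit_leb_continuous[OF dc])
  have zc: "continuous_on {0..1} (prim z)" by (rule prim_continuous[OF z])
  have Fc: "continuous_on {0..1} F"
    by (rule continuous_on_eq[of _ "\<lambda>x. c + prim z x"]) (auto intro!: continuous_intros zc simp: F)
  have Fi: "integrable unit_leb F" by (rule integrable_unit_leb_continuous[OF Fc])
  have [measurable]: "deriv \<psi> \<in> borel_measurable unit_leb" "\<psi> \<in> borel_measurable unit_leb"
    by (rule measurable_unit_leb_continuous, fact)+
  have prim_d: "prim (deriv \<psi>) x = \<psi> x" if "x \<in> {0..1}" for x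
    using prim_FTC[of \<psi> "deriv \<psi>" x] t(1) dc that t(4)[of 0] by (auto intro: has_field_derivative_at_within)
  have "(LINT x|unit_leb. rep_L1 (abs_L1 F) x * deriv \<psi> x) = (LINT x|unit_leb. F x * deriv \<psi> x)"
    by (rule integral_cong_AE) (use rep_abs_L1[OF Fi] Fi in \<open>auto elim: eventually_mono\<close>)
  also have "\<dots> = (LINT x|unit_leb. c * deriv \<psi> x + prim z x * deriv \<psi> x)"
    by (rule Bochner_Integration.integral_cong) (auto simp: F algebra_simps)
  also have "\<dots> = (LINT x|unit_leb. c * deriv \<psi> x) + (LINT x|unit_leb. prim z x * deriv \<psi> x)"
    by (rule Bochner_Integration.integral_add) (auto intro!: integrable_mult_continuous di zc)
  also have "(LINT x|unit_leb. c * deriv \<psi> x) = 0"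
    using prim_d[of 1] t(4)[of 1] by (simp add: prim_1)
  also have "(LINT x|unit_leb. prim z x * deriv \<psi> x) = - (LINT x|unit_leb. z x * prim (deriv \<psi>) x)"
    using prim_by_parts[OF z di] prim_d[of 1] t(4)[of 1] by simp
  also have "(LINT x|unit_leb. z x * prim (deriv \<psi>) x) = (LINT x|unit_leb. z x * \<psi> x)"
    by (rule Bochner_Integration.integral_cong) (auto simp: prim_d)
  also have "\<dots> = (LINT x|unit_leb. rep_L1 (abs_L1 z) x * \<psi> x)"
    by (rule integral_cong_AE) (use rep_abs_L1[OF z] z in \<open>auto elim: eventually_mono\<close>)
  finally show "(LINT x|unit_leb. rep_L1 (abs_L1 F) x * deriv \<psi> x) = - (LINT x|unit_leb. rep_L1 (abs_L1 z) x * \<psi> x)"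
    by simp
qed

lemma cont_rep_abs_L1:
  assumes f: "continuous_on {0..1} f" and x: "x \<in> {0..1}"
  shows "cont_rep (abs_L1 f) x = f x"
proof -
  have ae: "AE x in unit_leb. rep_L1 (abs_L1 f) x = f x"
    by (rule rep_abs_L1[OF integrable_unit_leb_continuous[OF f]])
  have "continuous_on {0..1} (cont_rep (abs_L1 f)) \<and> (AE x in unit_leb. rep_L1 (abs_L1 f) x = cont_rep (abs_L1 f) x)"
    unfolding cont_rep_def by (rule someI[of _ f]) (use f ae in simp)
  hence "AE x in unit_leb. cont_rep (abs_L1 f) x = f x" "continuous_on {0..1} (cont_rep (abs_L1 f))"
    using ae by (auto elim: eventually_elim2)
  thus ?thesis using continuous_AE_eq_unit f x by blast
qed

lemma W21_bounded:
  assumes "w \<in> W21"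
  obtains B where "AE x in unit_leb. \<bar>rep_L1 w x\<bar> \<le> B"
proof -
  obtain v where "has_weak_deriv w v" using assms unfolding W21_def by blast
  then obtain c where c: "AE x in unit_leb. rep_L1 w x = c + prim (rep_L1 v) x" by (rule du_Bois_Reymond)
  have "AE x in unit_leb. \<bar>rep_L1 w x\<bar> \<le> \<bar>c\<bar> + (LINT t|unit_leb. \<bar>rep_L1 v t\<bar>)"
    using c
  proof eventually_elim
    case (elim x)
    thus ?case using prim_abs_le[OF rep_L1_integrable, of v x] by linarith
  qed
  thus ?thesis by (rule that)
qed

text \<open>This transfers statements about a constructed profile to any \<open>w\<close> in the
  boundary class that represents the same functional.\<close>

lemma dual_L1_inj_W21:
  assumes "w \<in> W21" "w' \<in> W21" "dual_L1 w = dual_L1 w'"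
  shows "w = w'"
proof -
  obtain B B' where B: "AE x in unit_leb. \<bar>rep_L1 w x\<bar> \<le> B" "AE x in unit_leb. \<bar>rep_L1 w' x\<bar> \<le> B'"
    using W21_bounded assms by metis
  show ?thesis
    by (rule pairing_eq_imp_eq[OF B]) (metis dual_L1_apply B assms(3))
qed

section \<open>The functional \<open>\<Lambda>\<close> in terms of densities\<close>

text \<open>The bounds are imposed at every point, not almost everywhere, so that pointwise limits
  and pointwise estimates need no null sets; a density given only almost everywhere is truncated
  first.\<close>

definition adm :: "real \<Rightarrow> real \<Rightarrow> (real \<Rightarrow> real) set" where
  "adm e m = {f \<in> borel_measurable unit_leb. (\<forall>x\<in>{0..1}. 0 \<le> f x \<and> e * f x \<le> 1) \<and>
     (LINT x|unit_leb. f x) = m}"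

definition \<Phi> :: "real \<Rightarrow> (real \<Rightarrow> real) \<Rightarrow> real \<Rightarrow> real" where
  "\<Phi> p f x = p + prim f x"

definition entropy :: "real \<Rightarrow> real \<Rightarrow> (real \<Rightarrow> real) \<Rightarrow> real" where
  "entropy e p f = (LINT x|unit_leb. s_fun (e * f x) + \<Phi> p f x - ln (1 + exp (\<Phi> p f x)))"

lemma admD:
  assumes "f \<in> adm e m" "0 < e"
  shows "f \<in> borel_measurable unit_leb" "x \<in> {0..1} \<Longrightarrow> 0 \<le> f x" "x \<in> {0..1} \<Longrightarrow> e * f x \<le> 1"
    "(LINT x|unit_leb. f x) = m" "x \<in> {0..1} \<Longrightarrow> f x \<le> 1 / e" "integrable unit_leb f"
proof -
  show *: "f \<in> borel_measurable unit_leb" "x \<in> {0..1} \<Longrightarrow> 0 \<le> f x" "x \<in> {0..1} \<Longrightarrow> e * f x \<le> 1"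
    "(LINT x|unit_leb. f x) = m" for x using assms by (auto simp: adm_def)
  show le: "f x \<le> 1 / e" if "x \<in> {0..1}" for x
    using *(3)[OF that] assms(2) by (simp add: field_simps)
  show "integrable unit_leb f"
    by (rule integrable_unit_leb_bounded[of _ "1 / e"]) (use * le in \<open>auto simp: abs_le_iff intro: order_trans[of _ 0]\<close>)
qed

lemma \<Phi>_continuous: "integrable unit_leb f \<Longrightarrow> continuous_on S (\<Phi> p f)"
  unfolding \<Phi>_def[abs_def] by (intro continuous_intros prim_continuous)

lemma \<Phi>_integrable: "integrable unit_leb f \<Longrightarrow> integrable unit_leb (\<Phi> p f)"
  by (rule integrable_unit_leb_continuous, rule \<Phi>_continuous)

lemma is_dphi_space:
  assumes "is_dphi p p1 \<phi> \<mu>"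
  shows "space \<mu> = {0..1}" "finite_measure \<mu>" "emeasure \<mu> {0..1} = ennreal (p1 - p)"
proof -
  have s: "sets \<mu> = sets (restrict_space borel {0..1})" and e: "emeasure \<mu> {0..1} = ennreal (p1 - p)"
    using assms by (auto simp: is_dphi_def)
  show sp: "space \<mu> = {0..1}" using sets_eq_imp_space_eq[OF s] by (simp add: space_restrict_space)
  show "emeasure \<mu> {0..1} = ennreal (p1 - p)" by (rule e)
  show "finite_measure \<mu>" by (rule finite_measureI) (simp add: sp e)
qed

text \<open>Distribution functions that agree almost everywhere agree, by right-continuity.\<close>

lemma is_dphi_unique:
  assumes mu: "is_dphi p p1 \<phi> \<mu>" and nu: "is_dphi p p1 \<phi> \<nu>"
  shows "\<mu> = \<nu>"
proof -
  have sm: "sets \<mu> = sets (restrict_space borel {0..1})" and sn: "sets \<nu> = sets (restrict_space borel {0..1})"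
    using mu nu by (auto simp: is_dphi_def)
  interpret m: finite_measure \<mu> by (rule is_dphi_space[OF mu])
  interpret n: finite_measure \<nu> by (rule is_dphi_space[OF nu])
  have ae: "AE x in unit_leb. measure \<mu> {0..x} = measure \<nu> {0..x}"
    using mu nu unfolding is_dphi_def by (auto elim: eventually_elim2)
  have em: "emeasure \<mu> {0..1} = emeasure \<nu> {0..1}"
    using is_dphi_space[OF mu] is_dphi_space[OF nu] by simp
  \<comment> \<open>Pushing the measures forward to the real line makes the uniqueness theorem for
    distribution functions applicable.\<close>
  define D where "D = (\<lambda>M :: real measure. distr M borel (\<lambda>x. x))"
  have idm: "(\<lambda>x. x) \<in> M \<rightarrow>\<^sub>M borel" if "sets M = sets (restrict_space borel {0..1})" for M :: "real measure"
  proof -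
    have "(\<lambda>x. x) \<in> restrict_space borel {0..1::real} \<rightarrow>\<^sub>M borel" by (rule measurable_restrict_space1) simp
    thus ?thesis using that by (simp cong: measurable_cong_sets)
  qed
  have c: "cdf (D M) x = measure M ({..x} \<inter> {0..1})" if "sets M = sets (restrict_space borel {0..1})" for M x
  proof -
    have "space M = {0..1}" using sets_eq_imp_space_eq[OF that] by (simp add: space_restrict_space)
    thus ?thesis unfolding cdf_def D_def by (subst measure_distr[OF idm[OF that]]) auto
  qed
  have fin: "finite_borel_measure (D \<mu>)" "finite_borel_measure (D \<nu>)"
    unfolding D_def finite_borel_measure_def finite_borel_measure_axioms_def
    using m.finite_measure_distr[OF idm[OF sm]] n.finite_measure_distr[OF idm[OF sn]] by auto
  \<comment> \<open>The two distribution functions agree at points \<open>y k\<close> decreasing to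
    \<open>x\<close>, so right-continuity gives agreement at \<open>x\<close>.\<close>
  have eq: "cdf (D \<mu>) x = cdf (D \<nu>) x" if x: "0 \<le> x" "x < 1" for x
  proof -
    have "\<exists>y. x < y \<and> y < x + (1 - x) / real (Suc k) \<and> measure \<mu> {0..y} = measure \<nu> {0..y}" for k
    proof -
      have "(1 - x) / real (Suc k) \<le> (1 - x) / 1" using x by (intro divide_left_mono) auto
      hence "x + (1 - x) / real (Suc k) \<le> 1" by simp
      moreover have "x < x + (1 - x) / real (Suc k)" using x by simp
      ultimately show ?thesis using AE_unit_leb_dense[OF ae, of x "x + (1 - x) / real (Suc k)"] x by metis
    qed
    then obtain y where y: "\<And>k. x < y k" "\<And>k. y k < x + (1 - x) / real (Suc k)"
      "\<And>k. measure \<mu> {0..y k} = measure \<nu> {0..y k}" by metis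
    have "y \<longlonglongrightarrow> x"
    proof (rule tendsto_sandwich)
      show "(\<lambda>k. x) \<longlonglongrightarrow> x" by simp
      show "(\<lambda>k. x + (1 - x) / real (Suc k)) \<longlonglongrightarrow> x" by real_asymp
    qed (use y(1,2)[THEN less_imp_le] in \<open>auto intro!: always_eventually\<close>)
    hence lim: "filterlim y (at_right x) sequentially"
      by (rule tendsto_imp_filterlim_at_right) (simp add: y(1))
    have "(\<lambda>k. cdf M (y k)) \<longlonglongrightarrow> cdf M x" if "finite_borel_measure M" for M
      using filterlim_compose[OF _ lim] finite_borel_measure.cdf_is_right_cont[OF that, of x]
      unfolding continuous_within by blast
    note lims = this[OF fin(1)] this[OF fin(2)]
    have "cdf (D \<mu>) (y k) = cdf (D \<nu>) (y k)" for k
    proof -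
      have "(1 - x) / real (Suc k) \<le> (1 - x) / 1" using x by (intro divide_left_mono) auto
      hence "{..y k} \<inter> {0..1} = {0..y k}" using y(2)[of k] by auto
      thus ?thesis unfolding c[OF sm] c[OF sn] by (simp only: y(3))
    qed
    thus ?thesis using LIMSEQ_unique[OF lims(1)] lims(2) by simp
  qed
  have "D \<mu> = D \<nu>"
  proof (rule cdf_unique'[OF fin], rule ext)
    fix x :: real
    consider "x < 0" | "0 \<le> x" "x < 1" | "1 \<le> x" by linarith
    thus "cdf (D \<mu>) x = cdf (D \<nu>) x"
    proof cases
      case 1
      hence "{..x} \<inter> {0..1} = {}" by auto
      thus ?thesis by (simp add: c[OF sm] c[OF sn])
    next
      case 2 thus ?thesis by (rule eq)
    next
      \<comment> \<open>Almost-everywhere agreement cannot see an atom at 1; here the prescribed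
        total mass decides.\<close>
      case 3
      hence "{..x} \<inter> {0..1} = {0..1}" by auto
      thus ?thesis using em by (simp add: c[OF sm] c[OF sn] measure_def)
    qed
  qed
  show ?thesis
  proof (rule measure_eqI)
    show "sets \<mu> = sets \<nu>" using sm sn by simp
    fix A assume A: "A \<in> sets \<mu>"
    hence Ab: "A \<in> sets borel" "A \<subseteq> {0..1}" unfolding sm by (auto simp: sets_restrict_space)
    have "emeasure (D M) A = emeasure M A" if "sets M = sets (restrict_space borel {0..1})" for M
    proof -
      have "space M = {0..1}" using sets_eq_imp_space_eq[OF that] by (simp add: space_restrict_space)
      thus ?thesis unfolding D_def using Ab by (subst emeasure_distr[OF idm[OF that]]) (auto simp: Int_absorb2)
    qed
    from this[OF sm] this[OF sn] show "emeasure \<mu> A = emeasure \<nu> A" using \<open>D \<mu> = D \<nu>\<close> by simp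
  qed
qed

lemma density_adm:
  assumes f: "f \<in> borel_measurable unit_leb" "integrable unit_leb f" "\<And>x. x \<in> {0..1} \<Longrightarrow> 0 \<le> f x"
  shows "emeasure (density unit_leb (\<lambda>x. ennreal (f x))) {0..1} = ennreal (LINT x|unit_leb. f x)"
    "0 \<le> x \<Longrightarrow> x \<le> 1 \<Longrightarrow> measure (density unit_leb (\<lambda>x. ennreal (f x))) {0..x} = prim f x"
proof -
  have em: "emeasure (density unit_leb (\<lambda>x. ennreal (f x))) {0..x} = ennreal (prim f x)" if x: "0 \<le> x" "x \<le> 1" for x
  proof -
    have "{0..x} \<in> sets unit_leb" unfolding sets_restrict_space
      by (rule image_eqI[of _ _ "{0..x}"]) (use x in auto)
    hence "emeasure (density unit_leb (\<lambda>x. ennreal (f x))) {0..x} = (\<integral>\<^sup>+ t. ennreal (f t) * indicator {0..x} t \<partial>unit_leb)"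
      using f(1) by (intro emeasure_density) auto
    also have "\<dots> = (\<integral>\<^sup>+ t. ennreal (indicator {..x} t * f t) \<partial>unit_leb)"
      by (rule nn_integral_cong) (auto simp: indicator_def)
    also have "\<dots> = ennreal (prim f x)" unfolding prim_def
      by (rule nn_integral_eq_integral) (use f in \<open>auto intro!: integrable_indicator_mult AE_I2\<close>)
    finally show ?thesis .
  qed
  show "emeasure (density unit_leb (\<lambda>x. ennreal (f x))) {0..1} = ennreal (LINT x|unit_leb. f x)"
    using em[of 1] by (simp add: prim_1)
  show "measure (density unit_leb (\<lambda>x. ennreal (f x))) {0..x} = prim f x" if "0 \<le> x" "x \<le> 1"
  proof -
    have "AE t in unit_leb. 0 \<le> f t" using f(3) by (intro AE_I2) auto
    from prim_mono_nonneg[OF f(2) this, of 0 x] that have "0 \<le> prim f x" by simp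
    thus ?thesis using em[OF that] by (simp add: measure_def)
  qed
qed

lemma phi_x_measurable [measurable]: "phi_x p p1 \<phi> \<in> borel_measurable unit_leb"
  unfolding phi_x_def[abs_def] by measurable

text \<open>Two uniqueness statements resolve the definitions: \<open>is_dphi_unique\<close>
  identifies \<open>dphi\<close> with the measure of density \<open>f\<close>, and uniqueness of
  Radon-Nikodym densities identifies \<open>phi_x\<close> with \<open>f\<close> almost
  everywhere.\<close>

lemma Lambda_adm:
  assumes e: "0 < e" and f: "f \<in> adm e (p1 - p)"
  shows "Lambda e p p1 (abs_L1 (\<Phi> p f)) = ereal (entropy e p f)"
proof -
  note F = admD[OF f e]
  note [measurable] = F(1)
  define \<phi> where "\<phi> = abs_L1 (\<Phi> p f)"
  have ae: "AE x in unit_leb. rep_L1 \<phi> x = \<Phi> p f x"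
    unfolding \<phi>_def by (rule rep_abs_L1[OF \<Phi>_integrable[OF F(6)]])
  define \<mu> where "\<mu> = density unit_leb (\<lambda>x. ennreal (f x))"
  have d: "is_dphi p p1 \<phi> \<mu>"
    unfolding is_dphi_def
  proof (intro conjI)
    show "sets \<mu> = sets (restrict_space borel {0..1})" by (simp add: \<mu>_def sets_unit_leb)
    show "emeasure \<mu> {0..1} = ennreal (p1 - p)"
      unfolding \<mu>_def using density_adm(1)[OF F(1,6,2)] F(4) by simp
    show "AE x in unit_leb. rep_L1 \<phi> x = p + Sigma_Algebra.measure \<mu> {0..x}"
      using ae AE_space
    proof eventually_elim
      case (elim x)
      thus ?case using density_adm(2)[OF F(1,6,2), of x] by (simp add: \<mu>_def \<Phi>_def)
    qed
  qed
  have dphi: "dphi p p1 \<phi> = \<mu>" unfolding dphi_def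
    by (rule the_equality[where P="is_dphi p p1 \<phi>", OF d is_dphi_unique[OF _ d]])
  have "AE x in unit_leb. ennreal (f x) = RN_deriv unit_leb \<mu> x"
    by (rule ul.RN_deriv_unique) (auto simp: \<mu>_def)
  hence rn: "AE x in unit_leb. phi_x p p1 \<phi> x = f x"
    using AE_space unfolding phi_x_def dphi
  proof eventually_elim
    case (elim x)
    thus ?case using F(2)[of x] by (metis enn2real_ennreal space_unit_leb)
  qed
  have \<Phi>m [measurable]: "\<Phi> p f \<in> borel_measurable unit_leb"
    by (intro measurable_unit_leb_continuous \<Phi>_continuous F)
  note [measurable] = rep_L1_measurable
  have "\<phi> \<in> F_set p p1" using d by (auto simp: F_set_def)
  moreover have "absolutely_continuous unit_leb (dphi p p1 \<phi>)"
    unfolding dphi \<mu>_def by (rule absolutely_continuousI_density) measurable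
  moreover have "AE x in unit_leb. 0 \<le> e * phi_x p p1 \<phi> x \<and> e * phi_x p p1 \<phi> x \<le> 1"
    using rn AE_space
  proof eventually_elim
    case (elim x)
    thus ?case using F(2,3)[of x] e by simp
  qed
  ultimately have "Lambda e p p1 \<phi> = ereal (LINT x|unit_leb.
             s_fun (e * phi_x p p1 \<phi> x) + rep_L1 \<phi> x - ln (1 + exp (rep_L1 \<phi> x)))"
    unfolding Lambda_def by simp
  also have "(LINT x|unit_leb. s_fun (e * phi_x p p1 \<phi> x) + rep_L1 \<phi> x - ln (1 + exp (rep_L1 \<phi> x))) = entropy e p f"
    unfolding entropy_def
  proof (rule integral_cong_AE)
    show "AE x in unit_leb. s_fun (e * phi_x p p1 \<phi> x) + rep_L1 \<phi> x - ln (1 + exp (rep_L1 \<phi> x)) =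
        s_fun (e * f x) + \<Phi> p f x - ln (1 + exp (\<Phi> p f x))"
      using rn ae by eventually_elim simp
  qed (unfold s_fun_def, measurable)
  finally show ?thesis by (simp add: \<phi>_def)
qed

lemma Lambda_finite:
  assumes e: "0 < e" and p: "p \<le> p1" and fin: "Lambda e p p1 \<phi> < \<infinity>"
  obtains f where "f \<in> adm e (p1 - p)" "\<phi> = abs_L1 (\<Phi> p f)"
proof -
  have F: "\<phi> \<in> F_set p p1" and ac: "absolutely_continuous unit_leb (dphi p p1 \<phi>)"
    and b: "AE x in unit_leb. 0 \<le> e * phi_x p p1 \<phi> x \<and> e * phi_x p p1 \<phi> x \<le> 1"
    using fin unfolding Lambda_def by (auto split: if_splits)
  define \<mu> where "\<mu> = dphi p p1 \<phi>"
  obtain \<nu> where nu: "is_dphi p p1 \<phi> \<nu>" using F by (auto simp: F_set_def)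
  have "dphi p p1 \<phi> = \<nu>" unfolding dphi_def
    by (rule the_equality[where P="is_dphi p p1 \<phi>", OF nu is_dphi_unique[OF _ nu]])
  hence d: "is_dphi p p1 \<phi> \<mu>" using nu by (simp add: \<mu>_def)
  interpret m: finite_measure \<mu> by (rule is_dphi_space[OF d])
  have sm: "sets \<mu> = sets unit_leb" using d by (simp add: is_dphi_def sets_unit_leb)
  have dens: "density unit_leb (RN_deriv unit_leb \<mu>) = \<mu>"
    by (rule ul.density_RN_deriv) (use ac sm in \<open>auto simp: \<mu>_def\<close>)
  have fin: "AE x in unit_leb. RN_deriv unit_leb \<mu> x \<noteq> \<infinity>"
    by (rule ul.RN_deriv_finite) (use ac sm m.sigma_finite_measure_axioms in \<open>auto simp: \<mu>_def\<close>)
  \<comment> \<open>Truncation turns the almost-everywhere bounds into the pointwise ones of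
    \<open>adm\<close> and changes the density only on a null set.\<close>
  define f where "f = (\<lambda>x. max 0 (min (1 / e) (phi_x p p1 \<phi> x)))"
  have fm [measurable]: "f \<in> borel_measurable unit_leb"
    unfolding f_def by measurable
  have f0: "0 \<le> f x" for x by (simp add: f_def)
  have f1: "e * f x \<le> 1" for x
  proof -
    have "f x \<le> 1 / e" using e by (simp add: f_def)
    thus ?thesis using e by (simp add: field_simps)
  qed
  have fi: "integrable unit_leb f"
    by (rule integrable_unit_leb_bounded[of _ "1 / e"]) (use e f0 in \<open>auto simp: f_def\<close>)
  have feq: "AE x in unit_leb. RN_deriv unit_leb \<mu> x = ennreal (f x)"
    using b fin
  proof eventually_elim
    case (elim x)
    have "phi_x p p1 \<phi> x = f x"
      using elim(1) e unfolding f_def by (simp add: max_def min_def zero_le_mult_iff field_simps)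
    thus ?case using elim(2) unfolding phi_x_def \<mu>_def[symmetric] by (metis ennreal_enn2real_if infinity_ennreal_def)
  qed
  have mu: "\<mu> = density unit_leb (\<lambda>x. ennreal (f x))"
    using dens density_cong[OF _ _ feq] by simp
  have "ennreal (LINT x|unit_leb. f x) = ennreal (p1 - p)"
    using density_adm(1)[OF fm fi f0] is_dphi_space(3)[OF d] mu by simp
  \<comment> \<open>As \<open>ennreal\<close> sends negative reals to 0, removing it relies on both
    sides being nonnegative.\<close>
  hence "(LINT x|unit_leb. f x) = p1 - p"
    using p by (subst (asm) ennreal_inj) (auto intro: Bochner_Integration.integral_nonneg f0)
  hence adm: "f \<in> adm e (p1 - p)" using f0 f1 by (simp add: adm_def)
  have "AE x in unit_leb. rep_L1 \<phi> x = p + Sigma_Algebra.measure \<mu> {0..x}" using d by (simp add: is_dphi_def)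
  hence "AE x in unit_leb. rep_L1 \<phi> x = \<Phi> p f x"
    using AE_space
  proof eventually_elim
    case (elim x)
    thus ?case using density_adm(2)[OF fm fi f0, of x] by (simp add: mu \<Phi>_def)
  qed
  hence "\<phi> = abs_L1 (\<Phi> p f)" by (rule L1_eq_absI[OF \<Phi>_integrable[OF fi]])
  with adm show ?thesis by (rule that)
qed

section \<open>Relative entropy and the logistic function\<close>

text \<open>The logistic function: the derivative of \<open>\<lambda>y. ln (1 + exp y)\<close> and
  the inverse of the logit that defines the boundary values of profiles.\<close>

definition lg :: "real \<Rightarrow> real" where
  "lg y = 1 / (1 + exp (- y))"

lemma lg_pos: "0 < lg y" and lg_less_1: "lg y < 1"
  by (auto simp: lg_def add_pos_pos divide_less_eq)

lemma ln_lg: "ln (lg y) = y - ln (1 + exp y)" "ln (1 - lg y) = - ln (1 + exp y)"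
proof -
  have pos: "1 + exp y > 0" by (intro add_pos_pos) auto
  have eq: "lg y = exp y / (1 + exp y)" unfolding lg_def by (simp add: exp_minus field_simps)
  show "ln (lg y) = y - ln (1 + exp y)" unfolding eq using pos by (simp add: ln_div)
  have "1 - lg y = 1 / (1 + exp y)" unfolding eq using pos by (simp add: field_simps)
  thus "ln (1 - lg y) = - ln (1 + exp y)" using pos by (simp add: ln_div)
qed

lemma lg_logit: "0 < a \<Longrightarrow> a < 1 \<Longrightarrow> lg (ln (a / (1 - a))) = a"
  unfolding lg_def by (simp add: exp_minus exp_ln field_simps)

lemma lg_derivative: "(lg has_real_derivative lg y * (1 - lg y)) (at y)"
proof -
  have "1 + exp (- y) > 0" by (intro add_pos_pos) auto
  thus ?thesis unfolding lg_def
    by (auto intro!: derivative_eq_intros simp: field_simps power2_eq_square)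
qed

lemma lg_mono: "x \<le> y \<Longrightarrow> lg x \<le> lg y"
  unfolding lg_def by (intro divide_left_mono mult_pos_pos add_pos_pos) auto

lemma lg_lipschitz: "\<bar>lg x - lg y\<bar> \<le> \<bar>x - y\<bar>"
proof -
  have "lg b - lg a \<le> b - a" if ab: "a < b" for a b
  proof -
    obtain z where z: "lg b - lg a = (b - a) * (lg z * (1 - lg z))"
      using MVT2[OF ab, of lg "\<lambda>z. lg z * (1 - lg z)"] lg_derivative by blast
    have "lg z * (1 - lg z) \<le> 1 * 1" using lg_pos[of z] lg_less_1[of z] by (intro mult_mono) auto
    hence "(b - a) * (lg z * (1 - lg z)) \<le> (b - a) * 1" using ab by (intro mult_left_mono) auto
    thus ?thesis using z by simp
  qed
  from this[of x y] this[of y x] lg_mono[of x y] lg_mono[of y x] show ?thesis by (cases x y rule: linorder_cases) auto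
qed

text \<open>The explicit factor 1 instantiates the constant \<open>K\<close> of
  \<open>prim_chain_rule\<close>.\<close>

lemma lg_derivative_lipschitz: "\<bar>lg x * (1 - lg x) - lg y * (1 - lg y)\<bar> \<le> 1 * \<bar>x - y\<bar>"
proof -
  have "lg x * (1 - lg x) - lg y * (1 - lg y) = (lg x - lg y) * (1 - (lg x + lg y))" by (simp add: algebra_simps)
  moreover have "\<bar>1 - (lg x + lg y)\<bar> \<le> 1" using lg_pos[of x] lg_less_1[of x] lg_pos[of y] lg_less_1[of y] by linarith
  ultimately have "\<bar>lg x * (1 - lg x) - lg y * (1 - lg y)\<bar> \<le> \<bar>lg x - lg y\<bar> * 1"
    by (simp only: abs_mult) (intro mult_left_mono, auto)
  thus ?thesis using lg_lipschitz[of x y] by simp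
qed

lemma lg_continuous: "continuous_on S lg"
  by (intro continuous_at_imp_continuous_on ballI DERIV_isCont[OF lg_derivative])

text \<open>This is \<open>ln t \<le> t - 1\<close> at \<open>t = b / a\<close>, strict unless
  \<open>t = 1\<close>; the case \<open>a = 0\<close> is separate and uses only
  \<open>0 < b\<close>.\<close>

lemma relative_entropy_term_ge:
  assumes "0 \<le> a" "0 < (b::real)"
  shows "a * (ln a - ln b) \<ge> a - b" "a \<noteq> b \<Longrightarrow> a * (ln a - ln b) > a - b"
proof -
  have strict: "a * (ln a - ln b) > a - b" if "a \<noteq> b"
  proof (cases "a = 0")
    case False
    hence a: "a > 0" using assms by simp
    have "ln (b / a) < b / a - 1"
      using ln_le_minus_one[of "b / a"] ln_eq_minus_one[of "b / a"] a assms that by fastforce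
    hence "a * ln (b / a) < a * (b / a - 1)" using a by (intro mult_strict_left_mono)
    thus ?thesis using a assms by (simp add: ln_div algebra_simps)
  qed (use assms in simp)
  thus "a \<noteq> b \<Longrightarrow> a * (ln a - ln b) > a - b" .
  show "a * (ln a - ln b) \<ge> a - b" using strict by (cases "a = b") auto
qed

text \<open>The deficit is the relative entropy of a Bernoulli law with parameter \<open>a\<close>
  with respect to the one with parameter \<open>lg y\<close>. Bounding its two terms by
  \<open>relative_entropy_term_ge\<close>, the linear lower bounds cancel.\<close>

lemma Fenchel_Young:
  assumes a: "0 \<le> a" "a \<le> 1"
  shows "y * a \<le> s_fun a + ln (1 + exp y)" "y * a = s_fun a + ln (1 + exp y) \<longleftrightarrow> a = lg y"
proof -
  define b where "b = lg y"
  have b: "0 < b" "0 < 1 - b" using lg_pos lg_less_1 by (auto simp: b_def)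
  have eq: "s_fun a + ln (1 + exp y) - y * a = a * (ln a - ln b) + (1 - a) * (ln (1 - a) - ln (1 - b))"
    unfolding b_def ln_lg s_fun_def by (simp add: algebra_simps)
  note r = relative_entropy_term_ge[OF a(1) b(1)] and r' = relative_entropy_term_ge[of "1 - a" "1 - b"]
  show "y * a \<le> s_fun a + ln (1 + exp y)" using eq r(1) r'(1) a b by simp
  show "y * a = s_fun a + ln (1 + exp y) \<longleftrightarrow> a = lg y"
    using eq r r' a b unfolding b_def[symmetric] by (cases "a = b") auto
qed

text \<open>Fenchel-Young with the weight \<open>lg a\<close>: the inequality at \<open>b\<close>
  minus the equality at \<open>a\<close>.\<close>

lemma log_exp_tangent: "ln (1 + exp b) \<ge> ln (1 + exp a) + lg a * (b - a)"
proof -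
  have l: "0 \<le> lg a" "lg a \<le> 1" using lg_pos[of a] lg_less_1[of a] by auto
  show ?thesis using Fenchel_Young(1)[OF l, of b] Fenchel_Young(2)[OF l, of a] by (simp add: algebra_simps)
qed

lemma s_fun_continuous: "continuous_on {0..1} s_fun"
proof -
  have xlnx: "continuous_on {0..} (\<lambda>x::real. x * ln x)"
  proof (intro continuous_on_eq_continuous_within[THEN iffD2] ballI)
    fix x :: real assume "x \<in> {0..}"
    show "continuous (at x within {0..}) (\<lambda>x. x * ln x)"
    proof (cases "x = 0")
      case True
      have "((\<lambda>x::real. x * ln x) \<longlongrightarrow> 0) (at_right 0)" by real_asymp
      hence "((\<lambda>x::real. x * ln x) \<longlongrightarrow> 0) (at 0 within {0..})"
        by (simp add: at_within_Ici_at_right)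
      thus ?thesis using True by (simp add: continuous_within)
    next
      case False
      thus ?thesis using \<open>x \<in> {0..}\<close> by (intro continuous_intros) auto
    qed
  qed
  show ?thesis
    unfolding s_fun_def[abs_def]
    by (intro continuous_intros continuous_on_subset[OF xlnx] continuous_on_compose2[OF xlnx, of _ "\<lambda>x. 1 - x"]) auto
qed

lemma s_fun_measurable [measurable]: "s_fun \<in> borel_measurable borel"
  unfolding s_fun_def[abs_def] by measurable

lemma lg_measurable [measurable]: "lg \<in> borel_measurable borel"
  unfolding lg_def[abs_def] by measurable

lemma exp_mono_bound: "\<bar>ln (1 + exp y)\<bar> \<le> \<bar>y\<bar> + 1" for y :: real
proof -
  have "1 + exp y \<le> 2 * exp \<bar>y\<bar>" by (smt (verit) exp_ge_zero exp_le_cancel_iff one_le_exp_iff)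
  also have "\<dots> \<le> exp 1 * exp \<bar>y\<bar>" using exp_ge_add_one_self[of 1] by (intro mult_right_mono) auto
  also have "\<dots> = exp (\<bar>y\<bar> + 1)" by (simp add: exp_add)
  finally have "ln (1 + exp y) \<le> ln (exp (\<bar>y\<bar> + 1))"
    by (subst ln_le_cancel_iff) (auto intro: add_pos_pos)
  hence "ln (1 + exp y) \<le> \<bar>y\<bar> + 1" by simp
  moreover have "ln (1 + exp y) \<ge> 0" by simp
  ultimately show ?thesis by simp
qed

section \<open>The variational problem over densities\<close>

locale profile_data =
  fixes e p m :: real
  assumes e_pos: "0 < e" and m_pos: "0 < m" and em_less_1: "e * m < 1"
begin

abbreviation "A \<equiv> adm e m"
abbreviation "\<phi> \<equiv> \<Phi> p"

text \<open>In this locale \<open>e\<close> stands for \<open>\<epsilon>\<close>, \<open>p\<close>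
  for the left boundary value \<open>\<phi>0\<close>, and \<open>m\<close> for the mass
  \<open>\<phi>1 - \<phi>0\<close>; \<open>e * m < 1\<close> is the assumption
  \<open>\<epsilon> < 1 / (\<phi>1 - \<phi>0)\<close>.\<close>

definition J :: "(real \<Rightarrow> real) \<Rightarrow> (real \<Rightarrow> real) \<Rightarrow> real" where
  "J \<rho> f = (LINT x|unit_leb. \<rho> x * \<phi> f x) - entropy e p f"

lemmas AD = admD[OF _ e_pos]

lemma prim_adm_range:
  assumes f: "f \<in> A"
  shows "0 \<le> prim f x" "prim f x \<le> m"
proof -
  have ae: "AE t in unit_leb. 0 \<le> f t" using AD(2)[OF f] by (intro AE_I2) auto
  have i: "integrable unit_leb f" by (rule AD[OF f])
  show "prim f x \<le> m"
    using prim_mono_nonneg[OF i ae, of x "max x 1"] AD(4)[OF f] prim_1[of "max x 1" f] by simp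
  have "prim f (min x 0) = 0"
  proof (cases "x < 0")
    case True
    thus ?thesis unfolding prim_def by (intro integral_eq_zero_AE AE_I2) auto
  qed (simp add: min_def)
  thus "0 \<le> prim f x" using prim_mono_nonneg[OF i ae, of "min x 0" x] by simp
qed

lemma \<phi>_bound: "f \<in> A \<Longrightarrow> \<bar>\<phi> f x\<bar> \<le> \<bar>p\<bar> + m"
  using prim_adm_range[of f x] unfolding \<Phi>_def by linarith

lemma \<phi>_cont: "f \<in> A \<Longrightarrow> continuous_on S (\<phi> f)"
  by (rule \<Phi>_continuous[OF AD(6)])

lemma \<phi>_meas: "f \<in> A \<Longrightarrow> \<phi> f \<in> borel_measurable unit_leb"
  by (rule measurable_unit_leb_continuous, rule \<phi>_cont)

lemma s_bound: obtains B where "0 \<le> B" "\<And>a. 0 \<le> a \<Longrightarrow> a \<le> 1 \<Longrightarrow> \<bar>s_fun a\<bar> \<le> B"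
proof (rule continuous_bounded_unit[OF s_fun_continuous])
  fix B assume "0 \<le> B" "\<And>x. x \<in> {0..1} \<Longrightarrow> \<bar>s_fun x\<bar> \<le> B"
  thus ?thesis by (intro that[of B]) auto
qed

lemma s_integrable: "f \<in> A \<Longrightarrow> integrable unit_leb (\<lambda>x. s_fun (e * f x))"
proof -
  assume f: "f \<in> A"
  note [measurable] = AD(1)[OF f]
  obtain B where B: "0 \<le> B" "\<And>a. 0 \<le> a \<Longrightarrow> a \<le> 1 \<Longrightarrow> \<bar>s_fun a\<bar> \<le> B" using s_bound by blast
  show ?thesis
  proof (rule integrable_unit_leb_bounded[where B=B])
    fix x :: real assume "x \<in> {0..1}"
    thus "\<bar>s_fun (e * f x)\<bar> \<le> B" using AD(2,3)[OF f] e_pos by (intro B) auto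
  qed measurable
qed

lemma lnexp_integrable: "f \<in> A \<Longrightarrow> integrable unit_leb (\<lambda>x. ln (1 + exp (\<phi> f x)))"
proof -
  assume f: "f \<in> A"
  have "1 + exp y \<noteq> 0" for y :: real using exp_gt_zero[of y] by linarith
  thus ?thesis using \<phi>_cont[OF f] by (intro integrable_unit_leb_continuous continuous_intros) auto
qed

lemma \<phi>_integrable: "f \<in> A \<Longrightarrow> integrable unit_leb (\<phi> f)"
  by (rule \<Phi>_integrable[OF AD(6)])

lemma entropy_split:
  "f \<in> A \<Longrightarrow> entropy e p f = (LINT x|unit_leb. s_fun (e * f x)) + (LINT x|unit_leb. \<phi> f x) - (LINT x|unit_leb. ln (1 + exp (\<phi> f x)))"
  unfolding entropy_def
  using s_integrable lnexp_integrable \<phi>_integrable by simp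

lemma \<rho>\<phi>_integrable: "integrable unit_leb \<rho> \<Longrightarrow> f \<in> A \<Longrightarrow> integrable unit_leb (\<lambda>x. \<rho> x * \<phi> f x)"
  by (rule integrable_mult_continuous(1)[OF _ \<phi>_cont])

text \<open>Pointwise convergence of densities suffices, because all of them lie between 0 and
  \<open>1 / e\<close> and dominated convergence preserves the mass.\<close>

lemma \<phi>_tendsto:
  assumes fn: "\<And>n. fn n \<in> A" and lim: "\<And>x. x \<in> {0..1} \<Longrightarrow> (\<lambda>n. fn n x) \<longlonglongrightarrow> f x"
  shows "f \<in> A" "(\<lambda>n. \<phi> (fn n) x) \<longlonglongrightarrow> \<phi> f x"
proof -
  note [measurable] = AD(1)[OF fn]
  have fm [measurable]: "f \<in> borel_measurable unit_leb"
    by (rule borel_measurable_LIMSEQ_real[where u=fn]) (use lim in auto)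
  have pr: "(\<lambda>n. prim (fn n) x) \<longlonglongrightarrow> prim f x" for x
    unfolding prim_def
  proof (rule integral_dominated_convergence[where w="\<lambda>_. 1 / e"])
    show "AE t in unit_leb. (\<lambda>n. indicator {..x} t * fn n t) \<longlonglongrightarrow> indicator {..x} t * f t"
      using lim by (intro AE_I2 tendsto_intros) auto
    show "AE t in unit_leb. norm (indicator {..x} t * fn n t) \<le> 1 / e" for n
      using AD(2,5)[OF fn, of _ n] e_pos by (intro AE_I2) (auto simp: indicator_def)
  qed auto
  show "(\<lambda>n. \<phi> (fn n) x) \<longlonglongrightarrow> \<phi> f x" unfolding \<Phi>_def by (intro tendsto_intros pr)
  have "prim (fn n) 1 = m" for n using AD(4)[OF fn, of n] by (simp add: prim_1)
  hence "prim f 1 = m" using pr[of 1] LIMSEQ_unique[of "\<lambda>n. m" m "prim f 1"] by simp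
  moreover have "0 \<le> f x \<and> e * f x \<le> 1" if x: "x \<in> {0..1}" for x
  proof
    show "0 \<le> f x" by (rule LIMSEQ_le_const[OF lim[OF x]]) (use AD(2)[OF fn x] in auto)
    show "e * f x \<le> 1" by (rule LIMSEQ_le_const2[OF tendsto_mult_left[OF lim[OF x]]]) (use AD(3)[OF fn x] in auto)
  qed
  ultimately show "f \<in> A" unfolding adm_def using fm by (auto simp: prim_1)
qed

lemma linear_tendsto:
  assumes fn: "\<And>n. fn n \<in> A" and lim: "\<And>x. x \<in> {0..1} \<Longrightarrow> (\<lambda>n. fn n x) \<longlonglongrightarrow> f x"
    and rho: "integrable unit_leb \<rho>"
  shows "(\<lambda>n. LINT x|unit_leb. \<rho> x * \<phi> (fn n) x) \<longlonglongrightarrow> (LINT x|unit_leb. \<rho> x * \<phi> f x)"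
proof (rule integral_dominated_convergence[where w="\<lambda>x. \<bar>\<rho> x\<bar> * (\<bar>p\<bar> + m)"])
  note P = \<phi>_tendsto[OF fn lim]
  note [measurable] = \<phi>_meas[OF P(1)] \<phi>_meas[OF fn] borel_measurable_integrable[OF rho]
  show "(\<lambda>x. \<rho> x * \<phi> f x) \<in> borel_measurable unit_leb" "(\<lambda>x. \<rho> x * \<phi> (fn n) x) \<in> borel_measurable unit_leb" for n
    by measurable
  show "integrable unit_leb (\<lambda>x. \<bar>\<rho> x\<bar> * (\<bar>p\<bar> + m))" using rho by simp
  show "AE x in unit_leb. (\<lambda>n. \<rho> x * \<phi> (fn n) x) \<longlonglongrightarrow> \<rho> x * \<phi> f x"
    by (intro AE_I2 tendsto_intros P)
  show "AE x in unit_leb. norm (\<rho> x * \<phi> (fn n) x) \<le> \<bar>\<rho> x\<bar> * (\<bar>p\<bar> + m)" for n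
    using \<phi>_bound[OF fn] by (intro AE_I2) (simp add: abs_mult mult_left_mono)
qed

lemma entropy_tendsto:
  assumes fn: "\<And>n. fn n \<in> A" and lim: "\<And>x. x \<in> {0..1} \<Longrightarrow> (\<lambda>n. fn n x) \<longlonglongrightarrow> f x"
  shows "(\<lambda>n. entropy e p (fn n)) \<longlonglongrightarrow> entropy e p f"
proof -
  note P = \<phi>_tendsto[OF fn lim]
  note [measurable] = \<phi>_meas[OF P(1)] \<phi>_meas[OF fn] AD(1)[OF P(1)] AD(1)[OF fn]
  obtain B where B: "0 \<le> B" "\<And>a. 0 \<le> a \<Longrightarrow> a \<le> 1 \<Longrightarrow> \<bar>s_fun a\<bar> \<le> B" using s_bound by blast
  show ?thesis unfolding entropy_def
  proof (rule integral_dominated_convergence[where w="\<lambda>x. B + 2 * (\<bar>p\<bar> + m) + 1"])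
    show "AE x in unit_leb. (\<lambda>n. s_fun (e * fn n x) + \<phi> (fn n) x - ln (1 + exp (\<phi> (fn n) x))) \<longlonglongrightarrow>
      s_fun (e * f x) + \<phi> f x - ln (1 + exp (\<phi> f x))"
    proof (intro AE_I2 tendsto_intros P)
      fix x assume "x \<in> space unit_leb"
      hence x: "x \<in> {0..1}" by simp
      show "(\<lambda>n. s_fun (e * fn n x)) \<longlonglongrightarrow> s_fun (e * f x)"
        by (rule continuous_on_tendsto_compose[OF s_fun_continuous tendsto_mult_left[OF lim[OF x]]])
          (use AD(2,3)[OF P(1) x] AD(2,3)[OF fn x] e_pos in \<open>auto intro!: always_eventually\<close>)
      show "1 + exp (\<phi> f x) \<noteq> 0" using exp_gt_zero[of "\<phi> f x"] by linarith
    qed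
    show "AE x in unit_leb. norm (s_fun (e * fn n x) + \<phi> (fn n) x - ln (1 + exp (\<phi> (fn n) x))) \<le> B + 2 * (\<bar>p\<bar> + m) + 1" for n
    proof (rule AE_I2)
      fix x assume "x \<in> space unit_leb"
      hence x: "x \<in> {0..1}" by simp
      have "\<bar>s_fun (e * fn n x)\<bar> \<le> B" using AD(2,3)[OF fn x] e_pos by (intro B) auto
      moreover have "\<bar>ln (1 + exp (\<phi> (fn n) x))\<bar> \<le> \<bar>p\<bar> + m + 1"
        using \<phi>_bound[OF fn, of n x] exp_mono_bound[of "\<phi> (fn n) x"] by simp
      moreover have "\<bar>a + b - c\<bar> \<le> \<bar>a\<bar> + \<bar>b\<bar> + \<bar>c\<bar>" for a b c :: real by linarith
      note this[of "s_fun (e * fn n x)" "\<phi> (fn n) x" "ln (1 + exp (\<phi> (fn n) x))"]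
      ultimately show "norm (s_fun (e * fn n x) + \<phi> (fn n) x - ln (1 + exp (\<phi> (fn n) x))) \<le> B + 2 * (\<bar>p\<bar> + m) + 1"
        using \<phi>_bound[OF fn, of n x] unfolding real_norm_def distrib_left by linarith
    qed
  qed auto
qed

lemma J_tendsto:
  assumes "\<And>n. fn n \<in> A" "\<And>x. x \<in> {0..1} \<Longrightarrow> (\<lambda>n. fn n x) \<longlonglongrightarrow> f x" "integrable unit_leb \<rho>"
  shows "(\<lambda>n. J \<rho> (fn n)) \<longlonglongrightarrow> J \<rho> f"
  unfolding J_def by (intro tendsto_diff linear_tendsto entropy_tendsto assms)

text \<open>
  \<open>T q \<lambda>\<close> is the explicit maximiser of the strictly concave functional
  \<open>f \<mapsto> \<langle>q, \<phi> f\<rangle> - \<integral> s (e f)\<close> under the constraint \<open>\<integral> f = m\<close>, of which \<open>\<lambda>\<close> is the multiplier.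
\<close>

definition T :: "(real \<Rightarrow> real) \<Rightarrow> real \<Rightarrow> real \<Rightarrow> real" where
  "T q l x = lg ((prim q 1 - prim q x + l) / e) / e"

lemma T_continuous:
  assumes "integrable unit_leb q"
  shows "continuous_on S (T q l)"
  unfolding T_def[abs_def]
  by (intro continuous_intros continuous_on_compose2[OF lg_continuous[of UNIV]] prim_continuous assms) (use e_pos in auto)

lemma T_range: "0 < T q l x" "e * T q l x < 1"
  unfolding T_def using lg_pos lg_less_1 e_pos by auto

lemma prob_unit [simp]: "measure unit_leb {0..1} = 1"
  using ul.prob_space by simp

text \<open>Intermediate value theorem for the mass as a function of the multiplier. If the
  multiplier exceeds or falls below its value for constant \<open>q = 0\<close> by the oscillation
  bound \<open>B\<close>, the density lies above or below the constant \<open>m\<close>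
  throughout.\<close>

lemma T_adm_exists:
  assumes q: "integrable unit_leb q"
  obtains l where "T q l \<in> A"
proof -
  define B where "B = 2 * (LINT t|unit_leb. \<bar>q t\<bar>)"
  \<comment> \<open>The logit of \<open>e * m\<close>: the constant density \<open>m\<close> equals
    \<open>lg L / e\<close>, and it is here that \<open>e * m < 1\<close> enters.\<close>
  define L where "L = ln (e * m / (1 - e * m))"
  have em: "0 < e * m" "e * m < 1" using e_pos m_pos em_less_1 by auto
  have lgL: "lg L = e * m" unfolding L_def by (rule lg_logit[OF em])
  define h where "h = (\<lambda>l. LINT x|unit_leb. T q l x)"
  have Ti: "integrable unit_leb (T q l)" for l by (intro integrable_unit_leb_continuous T_continuous q)
  have Qb: "\<bar>prim q 1 - prim q x\<bar> \<le> B" for x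
    using prim_abs_le[OF q, of 1] prim_abs_le[OF q, of x] unfolding B_def by linarith
  have mono: "(LINT x|unit_leb. c) \<le> (LINT x|unit_leb. T q l x)" if "\<And>x. c \<le> T q l x" for c l
    by (rule integral_AE_mono) (use that Ti in auto)
  have mono': "(LINT x|unit_leb. T q l x) \<le> (LINT x|unit_leb. c)" if "\<And>x. T q l x \<le> c" for c l
    by (rule integral_AE_mono) (use that Ti in auto)
  have le: "a / e \<le> b / e" if "a \<le> b" for a b using that e_pos by (simp add: divide_right_mono)
  have up: "m \<le> h (B + e * L)"
  proof -
    have "lg L / e \<le> T q (B + e * L) x" for x
      unfolding T_def using Qb[of x] e_pos by (intro le lg_mono) (auto simp: field_simps abs_le_iff)
    from mono[OF this] show ?thesis unfolding h_def lgL using e_pos by simp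
  qed
  have lo: "h (e * L - B) \<le> m"
  proof -
    have "T q (e * L - B) x \<le> lg L / e" for x
      unfolding T_def using Qb[of x] e_pos by (intro le lg_mono) (auto simp: field_simps abs_le_iff)
    from mono'[OF this] show ?thesis unfolding h_def lgL using e_pos by simp
  qed
  have B0: "0 \<le> B" unfolding B_def by simp
  \<comment> \<open>One factor \<open>1 / e\<close> comes from the argument of \<open>lg\<close> and
    one from the factor in front of it.\<close>
  have "(1 / e\<^sup>2)-lipschitz_on UNIV h"
  proof (rule lipschitz_onI)
    fix l l' :: real
    have "\<bar>h l - h l'\<bar> = \<bar>LINT x|unit_leb. T q l x - T q l' x\<bar>"
      unfolding h_def using Ti by simp
    also have "\<dots> \<le> (LINT x|unit_leb. \<bar>T q l x - T q l' x\<bar>)" by (rule integral_abs_bound)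
    also have "\<dots> \<le> (LINT x|unit_leb. 1 / e\<^sup>2 * \<bar>l - l'\<bar>)"
    proof (rule integral_AE_mono)
      show "AE x in unit_leb. \<bar>T q l x - T q l' x\<bar> \<le> 1 / e\<^sup>2 * \<bar>l - l'\<bar>"
      proof (rule AE_I2)
        fix x
        have "\<bar>T q l x - T q l' x\<bar> = \<bar>lg ((prim q 1 - prim q x + l) / e) - lg ((prim q 1 - prim q x + l') / e)\<bar> / e"
          unfolding T_def diff_divide_distrib[symmetric] using e_pos by simp
        also have "\<dots> \<le> \<bar>(prim q 1 - prim q x + l) / e - (prim q 1 - prim q x + l') / e\<bar> / e"
          by (intro le lg_lipschitz)
        also have "\<dots> = 1 / e\<^sup>2 * \<bar>l - l'\<bar>"
          unfolding diff_divide_distrib[symmetric] using e_pos by (simp add: power2_eq_square)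
        finally show "\<bar>T q l x - T q l' x\<bar> \<le> 1 / e\<^sup>2 * \<bar>l - l'\<bar>" .
      qed
    qed (use Ti in auto)
    finally show "dist (h l) (h l') \<le> 1 / e\<^sup>2 * dist l l'" by (simp add: dist_real_def)
  qed (use e_pos in auto)
  hence "continuous_on UNIV h" by (rule lipschitz_on_continuous_on)
  hence "\<exists>l. e * L - B \<le> l \<and> l \<le> B + e * L \<and> h l = m"
    by (intro IVT' up lo) (use B0 in \<open>auto intro: continuous_on_subset\<close>)
  then obtain l where "h l = m" by blast
  hence "T q l \<in> A" unfolding adm_def using T_range[of q l] Ti by (auto simp: h_def less_imp_le)
  thus ?thesis by (rule that)
qed

text \<open>The derivative in \<open>\<phi>\<close>, at \<open>\<phi> f\<close>, of the part
  \<open>\<rho> * \<phi> - \<phi> + ln (1 + exp \<phi>)\<close> of the integrand of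
  \<open>J\<close>, that is, the slope of its linearisation.\<close>

definition EL :: "(real \<Rightarrow> real) \<Rightarrow> (real \<Rightarrow> real) \<Rightarrow> real \<Rightarrow> real" where
  "EL \<rho> f x = \<rho> x - (1 - lg (\<phi> f x))"

lemma EL_integrable:
  assumes "integrable unit_leb \<rho>" "f \<in> A"
  shows "integrable unit_leb (EL \<rho> f)"
proof -
  have "integrable unit_leb (\<lambda>x. 1 - lg (\<phi> f x))"
    by (intro integrable_unit_leb_continuous continuous_intros continuous_on_compose2[OF lg_continuous[of UNIV]] \<phi>_cont assms) auto
  thus ?thesis unfolding EL_def[abs_def] using assms by simp
qed

lemma EL_bound: "\<bar>EL \<rho> f x\<bar> \<le> \<bar>\<rho> x\<bar> + 1"
  unfolding EL_def using lg_pos[of "\<phi> f x"] lg_less_1[of "\<phi> f x"] by linarith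

text \<open>
  The part \<open>\<phi> \<mapsto> ln (1 + exp \<phi>) - \<phi>\<close> of the functional is convex, hence lies above its
  linearisation at \<open>f\<close>; so maximising the linearised functional cannot decrease \<open>J\<close>.
\<close>

lemma J_improve:
  assumes rho: "integrable unit_leb \<rho>" and f: "f \<in> A" and T: "T (EL \<rho> f) l \<in> A"
  shows "J \<rho> f \<le> J \<rho> (T (EL \<rho> f) l)"
    and "J \<rho> f = J \<rho> (T (EL \<rho> f) l) \<Longrightarrow> AE x in unit_leb. f x = T (EL \<rho> f) l x"
proof -
  define q where "q = EL \<rho> f"
  define g where "g = T q l"
  define y where "y = (\<lambda>x. (prim q 1 - prim q x + l) / e)"
  \<comment> \<open>The Fenchel-Young deficit of \<open>e * f\<close> at slope \<open>y\<close>: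
    nonnegative, and zero exactly where \<open>f\<close> agrees with \<open>g\<close>.\<close>
  define gap where "gap = (\<lambda>x. s_fun (e * f x) + ln (1 + exp (y x)) - y x * (e * f x))"
  have g: "g \<in> A" using T by (simp add: g_def q_def)
  have qi: "integrable unit_leb q" unfolding q_def by (rule EL_integrable[OF rho f])
  have eg: "e * g x = lg (y x)" for x unfolding g_def T_def y_def using e_pos by simp
  have yc: "continuous_on {0..1} y" unfolding y_def by (intro continuous_intros prim_continuous qi) (use e_pos in auto)
  have fr: "0 \<le> e * f x" "e * f x \<le> 1" if "x \<in> {0..1}" for x using AD(2,3)[OF f that] e_pos by auto
  have gap0: "0 \<le> gap x" if "x \<in> {0..1}" for x
    unfolding gap_def using Fenchel_Young(1)[OF fr[OF that], of "y x"] by simp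
  have gapeq: "f x = g x" if "x \<in> {0..1}" "gap x = 0" for x
    using Fenchel_Young(2)[OF fr[OF that(1)], of "y x"] that(2) eg[of x] e_pos unfolding gap_def
    by (metis diff_eq_diff_eq diff_self mult_left_cancel order_less_irrefl)
  have gap_g: "gap x = s_fun (e * f x) - s_fun (e * g x) + e * y x * (g x - f x)" for x
  proof -
    have "0 \<le> lg (y x)" "lg (y x) \<le> 1" using lg_pos[of "y x"] lg_less_1[of "y x"] by auto
    from Fenchel_Young(2)[OF this, of "y x"] have "y x * (e * g x) = s_fun (e * g x) + ln (1 + exp (y x))"
      unfolding eg by simp
    thus ?thesis unfolding gap_def by (simp add: algebra_simps)
  qed
  have fi: "integrable unit_leb f" and gi: "integrable unit_leb g" by (rule AD(6), fact)+
  have di: "integrable unit_leb (\<lambda>x. g x - f x)" using fi gi by simp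
  have eyi: "integrable unit_leb (\<lambda>x. e * y x * (g x - f x))"
    by (rule integrable_mult_continuous(2)[OF di]) (intro continuous_intros yc)
  have gapi: "integrable unit_leb gap"
    unfolding gap_g[abs_def] by (intro Bochner_Integration.integrable_add Bochner_Integration.integrable_diff s_integrable f g eyi)
  have dphi: "\<phi> g x - \<phi> f x = prim (\<lambda>x. g x - f x) x" for x
    unfolding \<Phi>_def using prim_diff[OF gi fi] by simp
  have d1: "prim (\<lambda>x. g x - f x) 1 = 0" using AD(4)[OF f] AD(4)[OF g] fi gi by (simp add: prim_1)
  have pc: "continuous_on {0..1} (prim (\<lambda>x. g x - f x))" by (rule prim_continuous[OF di])
  \<comment> \<open>Integration by parts moves \<open>q\<close> from the difference of profiles to
    the difference of densities. Constants in \<open>e * y\<close>, among them the multiplier, drop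
    out since both densities have mass \<open>m\<close>.\<close>
  have lin: "(LINT x|unit_leb. q x * prim (\<lambda>x. g x - f x) x) = (LINT x|unit_leb. e * y x * (g x - f x))"
  proof -
    have "(LINT x|unit_leb. e * y x * (g x - f x)) = (LINT x|unit_leb. (prim q 1 + l) * (g x - f x) - prim q x * (g x - f x))"
    proof (rule Bochner_Integration.integral_cong)
      fix x
      have "e * y x = (prim q 1 + l) - prim q x" using e_pos by (simp add: y_def)
      thus "e * y x * (g x - f x) = (prim q 1 + l) * (g x - f x) - prim q x * (g x - f x)"
        by (simp only: left_diff_distrib)
    qed simp
    also have "\<dots> = (LINT x|unit_leb. (prim q 1 + l) * (g x - f x)) - (LINT x|unit_leb. prim q x * (g x - f x))"
      by (rule Bochner_Integration.integral_diff)
        (use di integrable_mult_continuous(2)[OF di prim_continuous[OF qi]] in auto)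
    also have "(LINT x|unit_leb. (prim q 1 + l) * (g x - f x)) = 0" using d1 by (simp add: prim_1)
    finally show ?thesis using prim_by_parts[OF qi di] d1 by simp
  qed
  have qpi: "integrable unit_leb (\<lambda>x. q x * prim (\<lambda>x. g x - f x) x)" by (rule integrable_mult_continuous(1)[OF qi pc])
  have split: "(LINT x|unit_leb. a x - b x - (c x - d x) + (u x - v x)) =
      (LINT x|unit_leb. a x) - (LINT x|unit_leb. b x) - ((LINT x|unit_leb. c x) - (LINT x|unit_leb. d x))
      + ((LINT x|unit_leb. u x) - (LINT x|unit_leb. v x))"
    if "integrable unit_leb a" "integrable unit_leb b" "integrable unit_leb c" "integrable unit_leb d"
      "integrable unit_leb u" "integrable unit_leb v" for a b c d u v :: "real \<Rightarrow> real"
    using that by simp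
  have spliti: "integrable unit_leb (\<lambda>x. a x - b x - (c x - d x) + (u x - v x))"
    if "integrable unit_leb a" "integrable unit_leb b" "integrable unit_leb c" "integrable unit_leb d"
      "integrable unit_leb u" "integrable unit_leb v" for a b c d u v :: "real \<Rightarrow> real"
    using that by simp
  note ints = \<rho>\<phi>_integrable[OF rho g] \<rho>\<phi>_integrable[OF rho f] \<phi>_integrable[OF g] \<phi>_integrable[OF f]
    lnexp_integrable[OF g] lnexp_integrable[OF f]
  have k1: "(LINT x|unit_leb. gap x) = (LINT x|unit_leb. s_fun (e * f x)) - (LINT x|unit_leb. s_fun (e * g x)) + (LINT x|unit_leb. e * y x * (g x - f x))"
    unfolding gap_g using s_integrable[OF f] s_integrable[OF g] eyi by simp
  \<comment> \<open>The tangent inequality for the convex part; \<open>q\<close> is its slope at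
    \<open>\<phi> f\<close> together with the linear contribution of \<open>\<rho>\<close>.\<close>
  have k2: "(LINT x|unit_leb. q x * prim (\<lambda>x. g x - f x) x) \<le> (LINT x|unit_leb. \<rho> x * \<phi> g x - \<rho> x * \<phi> f x - (\<phi> g x - \<phi> f x) + (ln (1 + exp (\<phi> g x)) - ln (1 + exp (\<phi> f x))))"
  proof (rule integral_AE_mono[OF qpi])
    show "AE x in unit_leb. q x * prim (\<lambda>x. g x - f x) x \<le>
       \<rho> x * \<phi> g x - \<rho> x * \<phi> f x - (\<phi> g x - \<phi> f x) + (ln (1 + exp (\<phi> g x)) - ln (1 + exp (\<phi> f x)))"
    proof (rule AE_I2)
      fix x
      show "q x * prim (\<lambda>x. g x - f x) x \<le>
       \<rho> x * \<phi> g x - \<rho> x * \<phi> f x - (\<phi> g x - \<phi> f x) + (ln (1 + exp (\<phi> g x)) - ln (1 + exp (\<phi> f x)))"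
        using log_exp_tangent[of "\<phi> f x" "\<phi> g x"] unfolding dphi[symmetric] q_def EL_def by (simp add: algebra_simps)
    qed
  qed (rule spliti[OF ints])
  have key: "(LINT x|unit_leb. gap x) \<le> J \<rho> g - J \<rho> f"
    using k1 k2 lin unfolding J_def entropy_split[OF f] entropy_split[OF g] split[OF ints] by linarith
  have gap_ae: "AE x in unit_leb. 0 \<le> gap x" by (rule AE_I2) (use gap0 in simp)
  have nn: "0 \<le> (LINT x|unit_leb. gap x)" by (rule integral_nonneg_AE[OF gap_ae])
  show "J \<rho> f \<le> J \<rho> (T (EL \<rho> f) l)" using key nn unfolding g_def q_def by simp
  assume "J \<rho> f = J \<rho> (T (EL \<rho> f) l)"
  hence "(LINT x|unit_leb. gap x) = 0" using key nn unfolding g_def q_def by simp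
  hence "AE x in unit_leb. gap x = 0"
    by (subst (asm) integral_nonneg_eq_0_iff_AE[OF gapi gap_ae])
  thus "AE x in unit_leb. f x = T (EL \<rho> f) l x"
    using AE_space by eventually_elim (use gapeq in \<open>auto simp: g_def q_def\<close>)
qed

end

section \<open>Maximisers\<close>

text \<open>The common modulus is the increment of one primitive, as nothing better than
  integrability of \<open>d\<close> is available. The general codomain allows triples of functions
  to be treated at once.\<close>

lemma Arzela_Ascoli_modulus:
  fixes F :: "nat \<Rightarrow> real \<Rightarrow> 'b::{real_normed_vector,heine_borel}"
  assumes d: "integrable unit_leb d" and M: "\<And>n x. x \<in> {0..1} \<Longrightarrow> norm (F n x) \<le> M"
    and md: "\<And>n x y. x \<in> {0..1} \<Longrightarrow> y \<in> {0..1} \<Longrightarrow> norm (F n x - F n y) \<le> C * \<bar>prim d x - prim d y\<bar>"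
  obtains g k where "strict_mono (k :: nat \<Rightarrow> nat)" "continuous_on {0..1} g"
    "\<And>x. x \<in> {0..1} \<Longrightarrow> (\<lambda>n. F (k n) x) \<longlonglongrightarrow> g x"
proof (rule Arzela_Ascoli[where S="{0..1::real}" and \<F>=F and M=M])
  fix x \<eta> :: real assume x: "x \<in> {0..1}" and eta: "0 < \<eta>"
  have "isCont (prim d) x"
    using prim_continuous[OF d, of UNIV] by (simp add: continuous_on_eq_continuous_at)
  hence "\<exists>s>0. \<forall>y. \<bar>y - x\<bar> < s \<longrightarrow> \<bar>prim d y - prim d x\<bar> < \<eta> / (\<bar>C\<bar> + 1)"
    using eta unfolding continuous_at_eps_delta dist_real_def by (auto simp: add_nonneg_pos)
  then obtain s where s: "s > 0" "\<And>y. \<bar>y - x\<bar> < s \<Longrightarrow> \<bar>prim d y - prim d x\<bar> < \<eta> / (\<bar>C\<bar> + 1)" by blast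
  show "\<exists>s>0. \<forall>n y. y \<in> {0..1} \<and> norm (x - y) < s \<longrightarrow> norm (F n x - F n y) < \<eta>"
  proof (intro exI[of _ s] conjI allI impI s(1))
    fix n y assume y: "y \<in> {0..1} \<and> norm (x - y) < s"
    have "\<bar>prim d x - prim d y\<bar> < \<eta> / (\<bar>C\<bar> + 1)"
      using s(2)[of y] y by (simp add: abs_minus_commute)
    hence "(\<bar>C\<bar> + 1) * \<bar>prim d x - prim d y\<bar> < \<eta>" by (simp add: field_simps)
    moreover have "C * \<bar>prim d x - prim d y\<bar> \<le> (\<bar>C\<bar> + 1) * \<bar>prim d x - prim d y\<bar>"
      by (intro mult_right_mono) auto
    ultimately show "norm (F n x - F n y) < \<eta>" using md[OF x, of y n] y by linarith
  qed
next
  fix g :: "real \<Rightarrow> 'b" and k :: "nat \<Rightarrow> nat"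
  assume g: "continuous_on {0..1} g" "strict_mono k"
    "\<And>e. 0 < e \<Longrightarrow> \<exists>N. \<forall>n x. n \<ge> N \<and> x \<in> {0..1} \<longrightarrow> norm (F (k n) x - g x) < e"
  show thesis
  proof (rule that[OF g(2,1)])
    fix x :: real assume "x \<in> {0..1}"
    thus "(\<lambda>n. F (k n) x) \<longlonglongrightarrow> g x"
      unfolding LIMSEQ_iff using g(3) by meson
  qed
qed (use M in auto)

lemma prim_increment_le':
  assumes "integrable unit_leb u" "integrable unit_leb v" "AE t in unit_leb. \<bar>u t\<bar> \<le> v t"
  shows "\<bar>prim u x - prim u y\<bar> \<le> \<bar>prim v x - prim v y\<bar>"
proof (cases "x \<le> y")
  case True thus ?thesis using prim_increment_le[OF assms True] by linarith
next
  case False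
  hence "y \<le> x" by simp
  thus ?thesis using prim_increment_le[OF assms \<open>y \<le> x\<close>] by linarith
qed

context profile_data
begin

lemma T_modulus:
  assumes q: "integrable unit_leb q" and d: "integrable unit_leb d" and le: "AE t in unit_leb. \<bar>q t\<bar> \<le> d t"
  shows "\<bar>T q l x - T q l y\<bar> \<le> 1 / e\<^sup>2 * \<bar>prim d x - prim d y\<bar>"
proof -
  have "\<bar>T q l x - T q l y\<bar> = \<bar>lg ((prim q 1 - prim q x + l) / e) - lg ((prim q 1 - prim q y + l) / e)\<bar> / e"
    unfolding T_def diff_divide_distrib[symmetric] using e_pos by simp
  also have "\<dots> \<le> \<bar>(prim q 1 - prim q x + l) / e - (prim q 1 - prim q y + l) / e\<bar> / e"
    using e_pos by (intro divide_right_mono lg_lipschitz) auto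
  also have "\<dots> = 1 / e\<^sup>2 * \<bar>prim q x - prim q y\<bar>"
    unfolding diff_divide_distrib[symmetric] using e_pos by (simp add: power2_eq_square abs_minus_commute)
  also have "\<dots> \<le> 1 / e\<^sup>2 * \<bar>prim d x - prim d y\<bar>"
    by (intro mult_left_mono prim_increment_le' q d le) auto
  finally show ?thesis .
qed

text \<open>Dominates \<open>EL \<rho> f\<close> for every \<open>f\<close> simultaneously, so that
  all maximisers for one \<open>\<rho>\<close> share a modulus of continuity.\<close>

definition dom :: "(real \<Rightarrow> real) \<Rightarrow> real \<Rightarrow> real" where
  "dom \<rho> x = \<bar>\<rho> x\<bar> + 1"

lemma dom_integrable: "integrable unit_leb \<rho> \<Longrightarrow> integrable unit_leb (dom \<rho>)"
  unfolding dom_def[abs_def] by simp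

text \<open>Regularises a maximising sequence: an arbitrary admissible density is exchanged for one
  in a compact class without decreasing \<open>J\<close>.\<close>

lemma J_improve_modulus:
  assumes rho: "integrable unit_leb \<rho>" and f: "f \<in> A"
  obtains g where "g \<in> A" "J \<rho> f \<le> J \<rho> g"
    "\<And>x y. \<bar>g x - g y\<bar> \<le> 1 / e\<^sup>2 * \<bar>prim (dom \<rho>) x - prim (dom \<rho>) y\<bar>"
proof -
  obtain l where l: "T (EL \<rho> f) l \<in> A" using T_adm_exists[OF EL_integrable[OF rho f]] by blast
  show ?thesis
  proof (rule that[OF l J_improve(1)[OF rho f l]])
    fix x y
    show "\<bar>T (EL \<rho> f) l x - T (EL \<rho> f) l y\<bar> \<le> 1 / e\<^sup>2 * \<bar>prim (dom \<rho>) x - prim (dom \<rho>) y\<bar>"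
      by (rule T_modulus[OF EL_integrable[OF rho f] dom_integrable[OF rho]])
        (use EL_bound in \<open>auto simp: dom_def\<close>)
  qed
qed

lemma adm_compact:
  assumes d: "integrable unit_leb d" and g: "\<And>n. g n \<in> A"
    and md: "\<And>n x y. \<lbrakk>x \<in> {0..1}; y \<in> {0..1}\<rbrakk> \<Longrightarrow> \<bar>g n x - g n y\<bar> \<le> C * \<bar>prim d x - prim d y\<bar>"
  obtains k f where "strict_mono (k :: nat \<Rightarrow> nat)" "f \<in> A" "\<And>x. x \<in> {0..1} \<Longrightarrow> (\<lambda>n. g (k n) x) \<longlonglongrightarrow> f x"
proof -
  have b: "norm (g n x) \<le> 1 / e" if "x \<in> {0..1}" for n x
    using AD(2,5)[OF g that] by simp
  show ?thesis
  proof (rule Arzela_Ascoli_modulus[where F=g and C=C and M="1 / e", OF d])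
    fix f k assume "strict_mono (k :: nat \<Rightarrow> nat)"
      and lim: "\<And>x. x \<in> {0..1} \<Longrightarrow> (\<lambda>n. g (k n) x) \<longlonglongrightarrow> f x"
    thus ?thesis using that \<phi>_tendsto(1)[where fn="\<lambda>n. g (k n)", OF g lim] by blast
  qed (use b md in auto)
qed

lemma linear_bound:
  assumes "integrable unit_leb \<rho>" "f \<in> A"
  shows "\<bar>LINT x|unit_leb. \<rho> x * \<phi> f x\<bar> \<le> (\<bar>p\<bar> + m) * (LINT x|unit_leb. \<bar>\<rho> x\<bar>)"
proof -
  have "\<bar>LINT x|unit_leb. \<rho> x * \<phi> f x\<bar> \<le> (LINT x|unit_leb. \<bar>\<rho> x * \<phi> f x\<bar>)" by (rule integral_abs_bound)
  also have "\<dots> \<le> (LINT x|unit_leb. (\<bar>p\<bar> + m) * \<bar>\<rho> x\<bar>)"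
  proof (rule integral_AE_mono)
    show "AE x in unit_leb. \<bar>\<rho> x * \<phi> f x\<bar> \<le> (\<bar>p\<bar> + m) * \<bar>\<rho> x\<bar>"
    proof (rule AE_I2)
      fix x show "\<bar>\<rho> x * \<phi> f x\<bar> \<le> (\<bar>p\<bar> + m) * \<bar>\<rho> x\<bar>"
        using mult_right_mono[OF \<phi>_bound[OF assms(2), of x], of "\<bar>\<rho> x\<bar>"] by (simp add: abs_mult mult.commute)
    qed
  qed (use \<rho>\<phi>_integrable[OF assms] assms in auto)
  finally show ?thesis by simp
qed

lemma J_bdd_above:
  assumes rho: "integrable unit_leb \<rho>"
  shows "bdd_above (J \<rho> ` A)"
proof -
  obtain B where B: "0 \<le> B" "\<And>a. 0 \<le> a \<Longrightarrow> a \<le> 1 \<Longrightarrow> \<bar>s_fun a\<bar> \<le> B" using s_bound by blast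
  define K where "K = \<bar>p\<bar> + m"
  show ?thesis
  proof (rule bdd_aboveI2)
    fix f assume f: "f \<in> A"
    have "- B \<le> (LINT x|unit_leb. s_fun (e * f x))"
    proof -
      have "(LINT x|unit_leb. - B) \<le> (LINT x|unit_leb. s_fun (e * f x))"
      proof (rule integral_AE_mono)
        show "AE x in unit_leb. - B \<le> s_fun (e * f x)"
        proof (rule AE_I2)
          fix x assume "x \<in> space unit_leb"
          thus "- B \<le> s_fun (e * f x)" using B(2)[of "e * f x"] AD(2,3)[OF f, of x] e_pos by simp
        qed
      qed (use s_integrable[OF f] in auto)
      thus ?thesis by simp
    qed
    moreover have "- K \<le> (LINT x|unit_leb. \<phi> f x)"
      using linear_bound[of "\<lambda>_. 1" f] f by (simp add: K_def)
    moreover have "(LINT x|unit_leb. ln (1 + exp (\<phi> f x))) \<le> K + 1"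
    proof -
      have "(LINT x|unit_leb. ln (1 + exp (\<phi> f x))) \<le> (LINT x|unit_leb. K + 1)"
      proof (rule integral_AE_mono)
        show "AE x in unit_leb. ln (1 + exp (\<phi> f x)) \<le> K + 1"
        proof (rule AE_I2)
          fix x show "ln (1 + exp (\<phi> f x)) \<le> K + 1"
            using exp_mono_bound[of "\<phi> f x"] \<phi>_bound[OF f, of x] unfolding K_def by linarith
        qed
      qed (use lnexp_integrable[OF f] in auto)
      thus ?thesis by simp
    qed
    ultimately show "J \<rho> f \<le> K * (LINT x|unit_leb. \<bar>\<rho> x\<bar>) + B + K + (K + 1)"
      using linear_bound[OF rho f] unfolding J_def entropy_split[OF f] K_def[symmetric] by linarith
  qed
qed

definition V :: "(real \<Rightarrow> real) \<Rightarrow> real" where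
  "V \<rho> = (SUP f\<in>A. J \<rho> f)"

lemma J_le_V: "integrable unit_leb \<rho> \<Longrightarrow> f \<in> A \<Longrightarrow> J \<rho> f \<le> V \<rho>"
  unfolding V_def by (rule cSUP_upper[OF _ J_bdd_above])

text \<open>Maximisers of \<open>J \<rho>\<close>, normalised on null sets by the Euler-Lagrange equation.\<close>

definition maximiser :: "(real \<Rightarrow> real) \<Rightarrow> (real \<Rightarrow> real) \<Rightarrow> bool" where
  "maximiser \<rho> f \<longleftrightarrow> f \<in> A \<and> J \<rho> f = V \<rho> \<and> (\<exists>l. \<forall>x. f x = T (EL \<rho> f) l x)"

text \<open>A maximiser cannot be improved, so the equality case of \<open>J_improve\<close>
  identifies it almost everywhere with \<open>g = T (EL \<rho> f) l\<close>. The profile is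
  unchanged, hence so is \<open>EL\<close>, and \<open>g\<close> satisfies its own fixed point
  equation everywhere.\<close>

lemma normalise_maximiser:
  assumes rho: "integrable unit_leb \<rho>" and f: "f \<in> A" and max: "V \<rho> \<le> J \<rho> f"
  obtains g where "maximiser \<rho> g" "\<And>x. \<phi> g x = \<phi> f x"
proof -
  obtain l where l: "T (EL \<rho> f) l \<in> A" using T_adm_exists[OF EL_integrable[OF rho f]] by blast
  define g where "g = T (EL \<rho> f) l"
  have g: "g \<in> A" using l by (simp add: g_def)
  have Jg: "J \<rho> g = V \<rho>" "J \<rho> f = V \<rho>"
    using J_improve(1)[OF rho f l] max J_le_V[OF rho g] J_le_V[OF rho f] by (auto simp: g_def)
  have "AE x in unit_leb. f x = g x"
    using J_improve(2)[OF rho f l] Jg by (simp add: g_def)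
  hence \<phi>: "\<phi> g x = \<phi> f x" for x
    unfolding \<Phi>_def using prim_cong_AE[OF AD(6)[OF f] AD(6)[OF g]] by simp
  hence "EL \<rho> g = EL \<rho> f" by (auto simp: EL_def fun_eq_iff)
  hence "maximiser \<rho> g" unfolding maximiser_def using g Jg by (auto simp: g_def)
  thus ?thesis using \<phi> by (rule that)
qed

lemma maximiserD:
  assumes "maximiser \<rho> f" "integrable unit_leb \<rho>"
  shows "f \<in> A" "J \<rho> f = V \<rho>" "continuous_on S f"
    "\<bar>f x - f y\<bar> \<le> 1 / e\<^sup>2 * \<bar>prim (dom \<rho>) x - prim (dom \<rho>) y\<bar>"
proof -
  show f: "f \<in> A" and "J \<rho> f = V \<rho>" using assms by (auto simp: maximiser_def)
  obtain l where l: "f = T (EL \<rho> f) l" using assms unfolding maximiser_def by auto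
  note i = EL_integrable[OF assms(2) f]
  show "continuous_on S f" by (subst l) (rule T_continuous[OF i])
  show "\<bar>f x - f y\<bar> \<le> 1 / e\<^sup>2 * \<bar>prim (dom \<rho>) x - prim (dom \<rho>) y\<bar>"
    by (subst (1 2) l, rule T_modulus[OF i dom_integrable[OF assms(2)]]) (use EL_bound in \<open>auto simp: dom_def\<close>)
qed

lemma maximiser_exists:
  assumes rho: "integrable unit_leb \<rho>"
  obtains f where "maximiser \<rho> f"
proof -
  obtain l where "T (\<lambda>_. 0) l \<in> A" using T_adm_exists[of "\<lambda>_. 0"] by auto
  hence ne: "J \<rho> ` A \<noteq> {}" by blast
  have "\<exists>f\<in>A. V \<rho> - 1 / real (Suc n) < J \<rho> f" for n
    using less_cSUP_iff[of A "J \<rho>" "V \<rho> - 1 / real (Suc n)"] ne J_bdd_above[OF rho] unfolding V_def by auto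
  hence "\<exists>g\<in>A. V \<rho> - 1 / real (Suc n) < J \<rho> g \<and>
      (\<forall>x y. \<bar>g x - g y\<bar> \<le> 1 / e\<^sup>2 * \<bar>prim (dom \<rho>) x - prim (dom \<rho>) y\<bar>)" for n
    using J_improve_modulus[OF rho] by (metis less_le_trans)
  then obtain g where g: "\<And>n. g n \<in> A" "\<And>n. V \<rho> - 1 / real (Suc n) < J \<rho> (g n)"
    and md: "\<And>n x y. \<bar>g n x - g n y\<bar> \<le> 1 / e\<^sup>2 * \<bar>prim (dom \<rho>) x - prim (dom \<rho>) y\<bar>" by metis
  obtain k f where k: "strict_mono k" and f: "f \<in> A"
    and lim: "\<And>x. x \<in> {0..1} \<Longrightarrow> (\<lambda>n. g (k n) x) \<longlonglongrightarrow> f x"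
    by (rule adm_compact[where g=g, OF dom_integrable[OF rho] g(1) md]) (rule that; simp)
  have Jlim: "(\<lambda>n. J \<rho> (g (k n))) \<longlonglongrightarrow> J \<rho> f"
    by (rule J_tendsto[where fn="\<lambda>n. g (k n)", OF g(1) lim rho])
  have inv0: "(\<lambda>n. 1 / real (Suc (k n))) \<longlonglongrightarrow> 0"
    using LIMSEQ_subseq_LIMSEQ[OF LIMSEQ_Suc[OF lim_1_over_n] k] by (simp add: comp_def)
  have Vlim: "(\<lambda>n. V \<rho> - 1 / real (Suc (k n))) \<longlonglongrightarrow> V \<rho> - 0"
    by (rule tendsto_diff[OF tendsto_const inv0])
  have "V \<rho> - 0 \<le> J \<rho> f"
    by (rule LIMSEQ_le[OF Vlim Jlim]) (use g(2) less_imp_le in blast)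
  hence "V \<rho> \<le> J \<rho> f" by simp
  from normalise_maximiser[OF rho f this] show ?thesis using that by blast
qed

lemma J_add:
  assumes "integrable unit_leb \<rho>" "integrable unit_leb y" "f \<in> A"
  shows "J (\<lambda>x. \<rho> x + c * y x) f = J \<rho> f + c * (LINT x|unit_leb. y x * \<phi> f x)"
proof -
  have "(LINT x|unit_leb. (\<rho> x + c * y x) * \<phi> f x) = (LINT x|unit_leb. \<rho> x * \<phi> f x + c * (y x * \<phi> f x))"
    by (simp add: algebra_simps)
  also have "\<dots> = (LINT x|unit_leb. \<rho> x * \<phi> f x) + c * (LINT x|unit_leb. y x * \<phi> f x)"
    using \<rho>\<phi>_integrable assms by simp
  finally show ?thesis by (simp add: J_def)
qed

text \<open>
  Danskin's argument: \<open>f\<close> is a limit of maximisers for \<open>\<rho> + y / n\<close>.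
\<close>

lemma Danskin:
  assumes rho: "integrable unit_leb \<rho>" and y: "integrable unit_leb y"
    and slope: "\<And>n. V \<rho> + l / real (Suc n) \<le> V (\<lambda>x. \<rho> x + 1 / real (Suc n) * y x)"
  obtains f where "maximiser \<rho> f" "l \<le> (LINT x|unit_leb. y x * \<phi> f x)"
proof -
  define rn where "rn = (\<lambda>n x. \<rho> x + 1 / real (Suc n) * y x)"
  have rni: "integrable unit_leb (rn n)" for n unfolding rn_def using rho y by simp
  have "\<exists>f. maximiser (rn n) f" for n using maximiser_exists[OF rni] by blast
  then obtain g where g: "\<And>n. maximiser (rn n) (g n)" by metis
  have gA: "g n \<in> A" for n using maximiserD(1)[OF g rni] .
  \<comment> \<open>One dominating function for all the perturbed data, since the factors
    \<open>1 / real (Suc n)\<close> are at most 1.\<close>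
  define d where "d = (\<lambda>x. dom \<rho> x + \<bar>y x\<bar>)"
  have di: "integrable unit_leb d" unfolding d_def using dom_integrable[OF rho] y by simp
  have md: "\<bar>g n a - g n b\<bar> \<le> 1 / e\<^sup>2 * \<bar>prim d a - prim d b\<bar>" for n a b
  proof -
    have "\<bar>prim (dom (rn n)) a - prim (dom (rn n)) b\<bar> \<le> \<bar>prim d a - prim d b\<bar>"
    proof (rule prim_increment_le'[OF dom_integrable[OF rni] di], rule AE_I2)
      fix t
      have "\<bar>1 / real (Suc n) * y t\<bar> \<le> 1 * \<bar>y t\<bar>"
        unfolding abs_mult by (intro mult_right_mono) auto
      thus "\<bar>dom (rn n) t\<bar> \<le> d t" unfolding dom_def d_def rn_def by linarith
    qed
    hence "1 / e\<^sup>2 * \<bar>prim (dom (rn n)) a - prim (dom (rn n)) b\<bar> \<le> 1 / e\<^sup>2 * \<bar>prim d a - prim d b\<bar>"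
      by (intro mult_left_mono) auto
    thus ?thesis using maximiserD(4)[OF g rni, of n a b] by linarith
  qed
  have V: "V (rn n) = J \<rho> (g n) + 1 / real (Suc n) * (LINT x|unit_leb. y x * \<phi> (g n) x)" for n
    using maximiserD(2)[OF g rni, of n] J_add[OF rho y gA] unfolding rn_def by metis
  have slope': "V \<rho> + l / real (Suc n) \<le> V (rn n)" for n
    unfolding rn_def by (rule slope)
  define Y where "Y = (\<bar>p\<bar> + m) * (LINT x|unit_leb. \<bar>y x\<bar>)"
  \<comment> \<open>The perturbed value is \<open>J \<rho> (g n)\<close> plus the scaled pairing,
    and \<open>J \<rho> (g n)\<close> is at most \<open>V \<rho>\<close>; comparing with the slope
    assumption leaves the pairing.\<close>
  have low: "l \<le> (LINT x|unit_leb. y x * \<phi> (g n) x)" for n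
  proof -
    have "l / real (Suc n) \<le> 1 / real (Suc n) * (LINT x|unit_leb. y x * \<phi> (g n) x)"
      using slope'[of n] V[of n] J_le_V[OF rho gA, of n] by linarith
    thus ?thesis by (simp add: divide_le_cancel)
  qed
  \<comment> \<open>The pairings are bounded by \<open>Y\<close>, so the \<open>g n\<close> are
    maximising for the unperturbed \<open>\<rho>\<close> up to an error of order
    \<open>1 / n\<close>.\<close>
  have Jlow: "V \<rho> + (l - Y) * (1 / real (Suc n)) \<le> J \<rho> (g n)" for n
  proof -
    have "1 / real (Suc n) * (LINT x|unit_leb. y x * \<phi> (g n) x) \<le> 1 / real (Suc n) * Y"
      using linear_bound[OF y gA, of n] unfolding Y_def by (intro mult_left_mono) auto
    moreover have "(l - Y) * (1 / real (Suc n)) = l / real (Suc n) - 1 / real (Suc n) * Y"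
      by (simp add: left_diff_distrib diff_divide_distrib)
    ultimately show ?thesis using slope'[of n] V[of n] by linarith
  qed
  obtain k f where k: "strict_mono k" and f: "f \<in> A"
    and lim: "\<And>x. x \<in> {0..1} \<Longrightarrow> (\<lambda>n. g (k n) x) \<longlonglongrightarrow> f x"
    by (rule adm_compact[where g=g, OF di gA md]) (rule that; simp)
  have Jlim: "(\<lambda>n. J \<rho> (g (k n))) \<longlonglongrightarrow> J \<rho> f"
    by (rule J_tendsto[where fn="\<lambda>n. g (k n)", OF gA lim rho])
  have inv0: "(\<lambda>n. 1 / real (Suc (k n))) \<longlonglongrightarrow> 0"
    using LIMSEQ_subseq_LIMSEQ[OF LIMSEQ_Suc[OF lim_1_over_n] k] by (simp add: comp_def)
  have Vlim: "(\<lambda>n. V \<rho> + (l - Y) * (1 / real (Suc (k n)))) \<longlonglongrightarrow> V \<rho> + (l - Y) * 0"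
    by (rule tendsto_add[OF tendsto_const tendsto_mult_left[OF inv0]])
  have "V \<rho> + (l - Y) * 0 \<le> J \<rho> f"
    by (rule LIMSEQ_le[OF Vlim Jlim]) (use Jlow in blast)
  hence "V \<rho> \<le> J \<rho> f" by simp
  from normalise_maximiser[OF rho f this] obtain h where h: "maximiser \<rho> h" "\<And>x. \<phi> h x = \<phi> f x" by blast
  have "l \<le> (LINT x|unit_leb. y x * \<phi> f x)"
    by (rule LIMSEQ_le_const[OF linear_tendsto[where fn="\<lambda>n. g (k n)", OF gA lim y]]) (use low in auto)
  thus ?thesis using that[OF h(1)] h(2) by simp
qed

section \<open>The Euler-Lagrange equation and the Hamiltonian at maximisers\<close>

definition \<beta> :: "(real \<Rightarrow> real) \<Rightarrow> real \<Rightarrow> real" where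
  "\<beta> f x = f x * (1 - e * f x) / e"

text \<open>\<open>\<alpha>\<close> and \<open>\<beta>\<close> are the coefficients of the
  Euler-Lagrange equation in the form \<open>f' = \<alpha> f - \<beta> f * \<rho>\<close>; both are
  continuous although \<open>\<rho>\<close> is not.\<close>

definition \<alpha> :: "(real \<Rightarrow> real) \<Rightarrow> real \<Rightarrow> real" where
  "\<alpha> f x = \<beta> f x * (1 - lg (\<phi> f x))"

lemma \<beta>_cont: "continuous_on S f \<Longrightarrow> continuous_on S (\<beta> f)"
  unfolding \<beta>_def[abs_def] using e_pos by (intro continuous_intros) auto

lemma \<alpha>_cont: "f \<in> A \<Longrightarrow> continuous_on S f \<Longrightarrow> continuous_on S (\<alpha> f)"
  unfolding \<alpha>_def[abs_def]
  by (intro continuous_intros \<beta>_cont continuous_on_compose2[OF lg_continuous[of UNIV] \<phi>_cont]) auto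

text \<open>The fixed point equation says \<open>e * f = lg (P x)\<close> with \<open>P\<close> a
  constant plus a primitive. The chain rule for primitives then applies, and
  \<open>lg' = lg * (1 - lg)\<close> turns into \<open>e * f * (1 - e * f)\<close>.\<close>

lemma maximiser_derivative:
  assumes n: "maximiser \<rho> f" and rho: "integrable unit_leb \<rho>" and x: "x \<in> {0..1}"
  shows "f x = f 0 + prim (\<lambda>t. \<alpha> f t - \<beta> f t * \<rho> t) x"
proof -
  obtain l where l: "\<And>x. f x = T (EL \<rho> f) l x" using n unfolding maximiser_def by blast
  have f: "f \<in> A" by (rule maximiserD[OF n rho])
  define q where "q = EL \<rho> f"
  have qi: "integrable unit_leb q" unfolding q_def by (rule EL_integrable[OF rho f])
  define u where "u = (\<lambda>t. (- 1 / e) * q t)"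
  have ui: "integrable unit_leb u" unfolding u_def using qi by simp
  define P where "P = (\<lambda>x. (prim q 1 + l) / e + prim u x)"
  have Pq: "P x = (prim q 1 - prim q x + l) / e" for x
    unfolding P_def u_def prim_cmult using e_pos by (simp add: field_simps)
  have ef: "lg (P x) = e * f x" for x
    unfolding Pq q_def l[of x] T_def using e_pos by simp
  have "lg (P x) = lg (P 0) + prim (\<lambda>t. lg (P t) * (1 - lg (P t)) * u t) x"
    by (rule prim_chain_rule[OF ui _ lg_derivative lg_derivative_lipschitz x]) (simp add: P_def)
  also have "prim (\<lambda>t. lg (P t) * (1 - lg (P t)) * u t) x = prim (\<lambda>t. e * (\<alpha> f t - \<beta> f t * \<rho> t)) x"
    unfolding ef by (rule prim_cong) (use e_pos in \<open>simp add: \<alpha>_def \<beta>_def u_def q_def EL_def field_simps\<close>)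
  finally show ?thesis unfolding ef prim_cmult using e_pos by (simp add: distrib_left[symmetric])
qed

text \<open>\<open>Ham \<rho> f z\<close> is the Hamiltonian at \<open>(\<rho>, \<phi> f)\<close>, where \<open>f = \<phi>\<^sub>x\<close> and \<open>z = f'\<close>.\<close>

definition Ham :: "(real \<Rightarrow> real) \<Rightarrow> (real \<Rightarrow> real) \<Rightarrow> (real \<Rightarrow> real) \<Rightarrow> real" where
  "Ham \<rho> f z = - e * (LINT x|unit_leb. f x * (\<sigma> (\<rho> x) * f x)) - e * (LINT x|unit_leb. \<rho> x * z x)
     + (LINT x|unit_leb. \<sigma> (\<rho> x) * f x) - lg (p + m) * (1 - e * f 1) + lg p * (1 - e * f 0)"

lemma \<sigma>_AE_bound:
  assumes "AE x in unit_leb. 0 \<le> \<rho> x \<and> \<rho> x \<le> 1"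
  shows "AE x in unit_leb. \<bar>\<sigma> (\<rho> x)\<bar> \<le> 1"
  using assms
proof eventually_elim
  case (elim x)
  hence "\<rho> x * (1 - \<rho> x) \<le> 1 * 1" by (intro mult_mono) auto
  thus ?case using elim by (simp add: \<sigma>_def)
qed

lemma Ham_integrable:
  assumes f: "f \<in> A" and z: "integrable unit_leb z" and rho: "integrable unit_leb \<rho>"
    and r01: "AE x in unit_leb. 0 \<le> \<rho> x \<and> \<rho> x \<le> 1"
  shows "integrable unit_leb (\<lambda>x. f x * (\<sigma> (\<rho> x) * f x))" "integrable unit_leb (\<lambda>x. \<sigma> (\<rho> x) * f x)"
    "integrable unit_leb (\<lambda>x. \<rho> x * z x)"
proof -
  have rm [measurable]: "\<rho> \<in> borel_measurable unit_leb" using rho by simp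
  note sm = \<sigma>_AE_bound[OF r01]
  have s_meas [measurable]: "(\<lambda>x. \<sigma> (\<rho> x)) \<in> borel_measurable unit_leb" unfolding \<sigma>_def by measurable
  have fi: "integrable unit_leb f" by (rule AD(6)[OF f])
  have "AE x in unit_leb. \<bar>f x\<bar> \<le> 1 / e" by (rule AE_I2) (use AD(2,5)[OF f] in auto)
  from integrable_mult_bounded(1)[OF fi AD(1)[OF f] this] have ffi: "integrable unit_leb (\<lambda>x. f x * f x)" .
  show "integrable unit_leb (\<lambda>x. f x * (\<sigma> (\<rho> x) * f x))"
    using integrable_mult_bounded(1)[OF ffi s_meas sm] by (simp add: mult.commute mult.left_commute)
  show "integrable unit_leb (\<lambda>x. \<sigma> (\<rho> x) * f x)" by (rule integrable_mult_bounded(2)[OF fi s_meas sm])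
  show "integrable unit_leb (\<lambda>x. \<rho> x * z x)"
    by (rule integrable_mult_bounded(2)[OF z rm, of 1]) (use r01 in \<open>auto elim: eventually_mono\<close>)
qed

text \<open>With \<open>r = lg (\<phi> f)\<close> the integrand is the derivative of
  \<open>r * (1 - e * f)\<close>. Its boundary values are exactly the terms that \<open>Ham\<close>
  subtracts and adds at the ends.\<close>

lemma Ham_maximiser:
  assumes n: "maximiser \<rho> f" and rho: "integrable unit_leb \<rho>" and r01: "AE x in unit_leb. 0 \<le> \<rho> x \<and> \<rho> x \<le> 1"
  shows "Ham \<rho> f (\<lambda>t. \<alpha> f t - \<beta> f t * \<rho> t) = 0"
proof -
  have f: "f \<in> A" and fc: "continuous_on {0..1} f" by (rule maximiserD[OF n rho])+
  define z where "z = (\<lambda>t. \<alpha> f t - \<beta> f t * \<rho> t)"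
  define r where "r = (\<lambda>x. lg (\<phi> f x))"
  define r' where "r' = (\<lambda>x. lg (\<phi> f x) * (1 - lg (\<phi> f x)) * f x)"
  have bc: "continuous_on {0..1} (\<beta> f)" and ac: "continuous_on {0..1} (\<alpha> f)"
    by (rule \<beta>_cont[OF fc], rule \<alpha>_cont[OF f fc])
  have zi: "integrable unit_leb z" unfolding z_def
    by (intro Bochner_Integration.integrable_diff integrable_unit_leb_continuous[OF ac] integrable_mult_continuous(2)[OF rho bc])
  have rc: "continuous_on {0..1} r" unfolding r_def
    by (rule continuous_on_compose2[OF lg_continuous[of UNIV] \<phi>_cont[OF f]]) auto
  have r'c: "continuous_on {0..1} r'" unfolding r'_def
    by (intro continuous_intros continuous_on_compose2[OF lg_continuous[of UNIV] \<phi>_cont[OF f]] fc) auto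
  have r'i: "integrable unit_leb r'" by (rule integrable_unit_leb_continuous[OF r'c])
  have dr: "(r has_real_derivative r' x) (at x within {0..1})" if "x \<in> {0..1}" for x
  proof -
    have "(\<phi> f has_real_derivative f x) (at x within {0..1})"
      unfolding \<Phi>_def[abs_def] using prim_has_derivative[OF fc that] by (auto intro!: derivative_eq_intros)
    from DERIV_chain2[OF lg_derivative this] show ?thesis by (simp add: r_def r'_def)
  qed
  have pr: "prim r' x = r x - r 0" if "x \<in> {0..1}" for x by (rule prim_FTC[OF dr r'c that])
  have pz: "prim z x = f x - f 0" if "x \<in> {0..1}" for x
    using maximiser_derivative[OF n rho that] unfolding z_def by simp
  have r0: "r 0 = lg p" and r1: "r 1 = lg (p + m)"
    using AD(4)[OF f] by (auto simp: r_def \<Phi>_def prim_1)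
  have zri: "integrable unit_leb (\<lambda>x. z x * r x)" by (rule integrable_mult_continuous(1)[OF zi rc])
  have fri: "integrable unit_leb (\<lambda>x. f x * r' x)" by (rule integrable_mult_continuous(2)[OF r'i fc])
  \<comment> \<open>The product rule for \<open>f * r\<close>, where \<open>f\<close> and
    \<open>r\<close> are, up to constants, the primitives of \<open>z\<close> and
    \<open>r'\<close>.\<close>
  have parts: "(LINT x|unit_leb. z x * r x) + (LINT x|unit_leb. f x * r' x) = f 1 * r 1 - f 0 * r 0"
  proof -
    have "(LINT x|unit_leb. z x * prim r' x) = (LINT x|unit_leb. z x * r x - r 0 * z x)"
      by (rule Bochner_Integration.integral_cong) (auto simp: pr algebra_simps)
    also have "\<dots> = (LINT x|unit_leb. z x * r x) - r 0 * prim z 1" using zri zi by (simp add: prim_1[of 1 z])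
    finally have 1: "(LINT x|unit_leb. z x * prim r' x) = (LINT x|unit_leb. z x * r x) - r 0 * (f 1 - f 0)" using pz[of 1] by simp
    have "(LINT x|unit_leb. prim z x * r' x) = (LINT x|unit_leb. f x * r' x - f 0 * r' x)"
      by (rule Bochner_Integration.integral_cong) (auto simp: pz algebra_simps)
    also have "\<dots> = (LINT x|unit_leb. f x * r' x) - f 0 * prim r' 1" using fri r'i by (simp add: prim_1[of 1 r'])
    finally have 2: "(LINT x|unit_leb. prim z x * r' x) = (LINT x|unit_leb. f x * r' x) - f 0 * (r 1 - r 0)" using pr[of 1] by simp
    show ?thesis using prim_by_parts[OF zi r'i] pr[of 1] pz[of 1] unfolding 1 2 by (simp add: algebra_simps)
  qed
  note i1 = Ham_integrable(1)[OF f zi rho r01] and i2 = Ham_integrable(2)[OF f zi rho r01]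
    and i3 = Ham_integrable(3)[OF f zi rho r01]
  \<comment> \<open>Inserting the Euler-Lagrange equation for \<open>z\<close>, both sides become
    \<open>f x * (1 - e * f x) * r x * \<rho> x\<close>.\<close>
  have pt: "- e * (f x * (\<sigma> (\<rho> x) * f x)) - e * (\<rho> x * z x) + \<sigma> (\<rho> x) * f x = r' x - e * (f x * r' x) - e * (z x * r x)" for x
  proof -
    have eb: "e * \<beta> f x = f x * (1 - e * f x)" using e_pos by (simp add: \<beta>_def)
    have ez: "e * z x = f x * (1 - e * f x) * (1 - r x - \<rho> x)"
      unfolding z_def \<alpha>_def r_def eb[symmetric] by (simp add: algebra_simps)
    have eqs: "r' x = r x * (1 - r x) * f x" "e * (\<rho> x * z x) = \<rho> x * (e * z x)" "e * (z x * r x) = r x * (e * z x)"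
      by (simp_all add: r_def r'_def)
    show ?thesis unfolding eqs ez \<sigma>_def by (simp add: algebra_simps)
  qed
  have "- e * (LINT x|unit_leb. f x * (\<sigma> (\<rho> x) * f x)) - e * (LINT x|unit_leb. \<rho> x * z x) + (LINT x|unit_leb. \<sigma> (\<rho> x) * f x)
     = (LINT x|unit_leb. - e * (f x * (\<sigma> (\<rho> x) * f x)) - e * (\<rho> x * z x) + \<sigma> (\<rho> x) * f x)"
    using i1 i2 i3 by simp
  also have "\<dots> = (LINT x|unit_leb. r' x) - e * (LINT x|unit_leb. f x * r' x) - e * (LINT x|unit_leb. z x * r x)"
    unfolding pt using r'i fri zri by simp
  also have "\<dots> = (r 1 - r 0) - e * (f 1 * r 1 - f 0 * r 0)"
    using pr[of 1] by (simp add: prim_1 parts[symmetric] distrib_left)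
  finally show ?thesis unfolding Ham_def z_def[symmetric] r0 r1 by (simp add: algebra_simps)
qed

end

section \<open>Relaxed maximisers\<close>

lemma modulus_continuous:
  assumes d: "integrable unit_leb d"
    and md: "\<And>x y. x \<in> {0..1} \<Longrightarrow> y \<in> {0..1} \<Longrightarrow> \<bar>f x - f y\<bar> \<le> C * \<bar>prim d x - prim d y\<bar>"
  shows "continuous_on {0..1} f"
proof (rule continuous_on_sequentiallyI)
  fix u :: "nat \<Rightarrow> real" and a assume u: "\<forall>n. u n \<in> {0..1}" "a \<in> {0..1}" "u \<longlonglongrightarrow> a"
  have "(\<lambda>n. prim d (u n)) \<longlonglongrightarrow> prim d a"
    using continuous_on_tendsto_compose[OF prim_continuous[OF d, of UNIV] u(3)] by simp
  hence "(\<lambda>n. C * \<bar>prim d (u n) - prim d a\<bar>) \<longlonglongrightarrow> C * \<bar>prim d a - prim d a\<bar>" by (intro tendsto_intros)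
  hence lim: "(\<lambda>n. C * \<bar>prim d (u n) - prim d a\<bar>) \<longlonglongrightarrow> 0" by simp
  have "(\<lambda>n. f (u n) - f a) \<longlonglongrightarrow> 0"
    by (rule Lim_null_comparison[OF _ lim]) (use md u in \<open>auto intro!: always_eventually\<close>)
  thus "(\<lambda>n. f (u n)) \<longlonglongrightarrow> f a" by (simp add: LIM_zero_iff)
qed

context profile_data
begin

text \<open>The constants are \<open>1 / e^2\<close> for \<open>f\<close>, \<open>1 / e^3\<close>
  for \<open>\<beta> f\<close>, and \<open>2 / e^3\<close> for the product
  \<open>\<alpha> f\<close>; the sum is a single constant that serves all three.\<close>

abbreviation "modulus \<rho> x y \<equiv> (1 / e^2 + 2 / e^3) * \<bar>prim (dom \<rho>) x - prim (dom \<rho>) y\<bar>"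

text \<open>
  A relaxation of the set of (normalised) maximisers that is convex and compact, stated through
  the coefficients of \<open>f' = a - b \<rho>\<close> since these, unlike \<open>f'\<close>, are equicontinuous. The last
  clause is stable under convex combinations because \<open>Ham \<rho>\<close> is concave when \<open>0 \<le> \<rho> \<le> 1\<close>.
\<close>

definition relaxed :: "(real \<Rightarrow> real) \<Rightarrow> (real \<Rightarrow> real) \<Rightarrow> (real \<Rightarrow> real) \<Rightarrow> (real \<Rightarrow> real) \<Rightarrow> bool" where
  "relaxed \<rho> f a b \<longleftrightarrow> f \<in> A \<and>
     (\<forall>x\<in>{0..1}. \<bar>a x\<bar> \<le> 1 / e^2 \<and> \<bar>b x\<bar> \<le> 1 / e^2) \<and>
     (\<forall>x\<in>{0..1}. \<forall>y\<in>{0..1}.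
        \<bar>f x - f y\<bar> \<le> modulus \<rho> x y \<and>
        \<bar>a x - a y\<bar> \<le> modulus \<rho> x y \<and>
        \<bar>b x - b y\<bar> \<le> modulus \<rho> x y) \<and>
     (\<forall>x\<in>{0..1}. f x = f 0 + prim (\<lambda>t. a t - b t * \<rho> t) x) \<and>
     ((AE x in unit_leb. 0 \<le> \<rho> x \<and> \<rho> x \<le> 1) \<longrightarrow> 0 \<le> Ham \<rho> f (\<lambda>t. a t - b t * \<rho> t))"

lemma relaxedD:
  assumes "relaxed \<rho> f a b"
  shows "f \<in> A" "x \<in> {0..1} \<Longrightarrow> \<bar>a x\<bar> \<le> 1 / e^2" "x \<in> {0..1} \<Longrightarrow> \<bar>b x\<bar> \<le> 1 / e^2"
    "x \<in> {0..1} \<Longrightarrow> y \<in> {0..1} \<Longrightarrow> \<bar>f x - f y\<bar> \<le> modulus \<rho> x y"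
    "x \<in> {0..1} \<Longrightarrow> y \<in> {0..1} \<Longrightarrow> \<bar>a x - a y\<bar> \<le> modulus \<rho> x y"
    "x \<in> {0..1} \<Longrightarrow> y \<in> {0..1} \<Longrightarrow> \<bar>b x - b y\<bar> \<le> modulus \<rho> x y"
    "x \<in> {0..1} \<Longrightarrow> f x = f 0 + prim (\<lambda>t. a t - b t * \<rho> t) x"
    "AE x in unit_leb. 0 \<le> \<rho> x \<and> \<rho> x \<le> 1 \<Longrightarrow> 0 \<le> Ham \<rho> f (\<lambda>t. a t - b t * \<rho> t)"
  using assms unfolding relaxed_def by blast+

lemma relaxed_cont:
  assumes g: "relaxed \<rho> f a b" and rho: "integrable unit_leb \<rho>"
  shows "continuous_on {0..1} f" "continuous_on {0..1} a" "continuous_on {0..1} b"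
    "integrable unit_leb (\<lambda>t. a t - b t * \<rho> t)"
proof -
  show "continuous_on {0..1} f" and a: "continuous_on {0..1} a" and b: "continuous_on {0..1} b"
    by (rule modulus_continuous[OF dom_integrable[OF rho]], rule relaxedD[OF g], assumption+)+
  show "integrable unit_leb (\<lambda>t. a t - b t * \<rho> t)"
    by (intro Bochner_Integration.integrable_diff integrable_unit_leb_continuous[OF a] integrable_mult_continuous(2)[OF rho b])
qed

lemma maximiser_relaxed:
  assumes n: "maximiser \<rho> f" and rho: "integrable unit_leb \<rho>"
  shows "relaxed \<rho> f (\<alpha> f) (\<beta> f)"
proof -
  note N = maximiserD[OF n rho]
  note f = N(1)
  define D where "D = (\<lambda>x y. \<bar>prim (dom \<rho>) x - prim (dom \<rho>) y\<bar>)"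
  have D0: "0 \<le> D x y" for x y by (simp add: D_def)
  have s01: "0 \<le> 1 - lg (\<phi> f x)" "1 - lg (\<phi> f x) \<le> 1" for x
    using lg_pos[of "\<phi> f x"] lg_less_1[of "\<phi> f x"] by auto
  have b01: "0 \<le> \<beta> f x" "\<beta> f x \<le> 1 / e^2" if "x \<in> {0..1}" for x
  proof -
    have "f x * (1 - e * f x) \<le> (1 / e) * 1"
      using AD(2,3,5)[OF f that] e_pos by (intro mult_mono) auto
    hence "f x * (1 - e * f x) / e \<le> (1 / e) * 1 / e" using e_pos by (intro divide_right_mono) auto
    thus "\<beta> f x \<le> 1 / e^2" by (simp add: \<beta>_def power2_eq_square)
    show "0 \<le> \<beta> f x" unfolding \<beta>_def using AD(2,3)[OF f that] e_pos by simp
  qed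
  have a01: "0 \<le> \<alpha> f x" "\<alpha> f x \<le> 1 / e^2" if "x \<in> {0..1}" for x
  proof -
    show "0 \<le> \<alpha> f x" unfolding \<alpha>_def using b01(1)[OF that] s01 by simp
    have "\<alpha> f x \<le> \<beta> f x * 1" unfolding \<alpha>_def using b01(1)[OF that] s01 by (intro mult_left_mono) auto
    thus "\<alpha> f x \<le> 1 / e^2" using b01(2)[OF that] by simp
  qed
  have mf: "\<bar>f x - f y\<bar> \<le> 1 / e^2 * D x y" for x y using N(4)[of x y] by (simp add: D_def)
  have mb: "\<bar>\<beta> f x - \<beta> f y\<bar> \<le> 1 / e^3 * D x y" if xy: "x \<in> {0..1}" "y \<in> {0..1}" for x y
  proof -
    have "\<beta> f x - \<beta> f y = (f x - f y) * (1 - e * (f x + f y)) / e"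
      unfolding \<beta>_def diff_divide_distrib[symmetric] by (simp add: algebra_simps)
    moreover have "\<bar>1 - e * (f x + f y)\<bar> \<le> 1"
    proof -
      have "0 \<le> e * f x" "0 \<le> e * f y" using AD(2)[OF f xy(1)] AD(2)[OF f xy(2)] e_pos by auto
      thus ?thesis using AD(3)[OF f xy(1)] AD(3)[OF f xy(2)] unfolding abs_le_iff distrib_left by linarith
    qed
    ultimately have "\<bar>\<beta> f x - \<beta> f y\<bar> \<le> \<bar>f x - f y\<bar> * 1 / e"
      using e_pos by (simp add: abs_mult divide_right_mono mult_left_le)
    also have "\<dots> \<le> (1 / e^2 * D x y) * 1 / e"
      using mf[of x y] e_pos by (intro divide_right_mono mult_right_mono) auto
    finally show ?thesis by (simp add: power2_eq_square power3_eq_cube)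
  qed
  have m\<phi>: "\<bar>\<phi> f x - \<phi> f y\<bar> \<le> 1 / e * D x y" for x y
  proof -
    have "\<bar>prim f x - prim f y\<bar> \<le> \<bar>prim (\<lambda>t. 1 / e * dom \<rho> t) x - prim (\<lambda>t. 1 / e * dom \<rho> t) y\<bar>"
    proof (rule prim_increment_le'[OF AD(6)[OF f]])
      show "AE t in unit_leb. \<bar>f t\<bar> \<le> 1 / e * dom \<rho> t"
      proof (rule AE_I2)
        fix t assume "t \<in> space unit_leb"
        hence "\<bar>f t\<bar> \<le> 1 / e * 1" using AD(2,5)[OF f, of t] by simp
        also have "\<dots> \<le> 1 / e * dom \<rho> t" using e_pos by (intro mult_left_mono) (auto simp: dom_def)
        finally show "\<bar>f t\<bar> \<le> 1 / e * dom \<rho> t" .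
      qed
    qed (use dom_integrable[OF rho] in simp)
    also have "\<dots> = 1 / e * D x y"
      unfolding prim_cmult D_def using e_pos by (simp add: right_diff_distrib[symmetric] diff_divide_distrib[symmetric])
    finally show ?thesis by (simp add: \<Phi>_def)
  qed
  have ma: "\<bar>\<alpha> f x - \<alpha> f y\<bar> \<le> 2 / e^3 * D x y" if xy: "x \<in> {0..1}" "y \<in> {0..1}" for x y
  proof -
    have "\<alpha> f x - \<alpha> f y = (\<beta> f x - \<beta> f y) * (1 - lg (\<phi> f x)) + \<beta> f y * (lg (\<phi> f y) - lg (\<phi> f x))"
      unfolding \<alpha>_def by (simp add: algebra_simps)
    hence "\<bar>\<alpha> f x - \<alpha> f y\<bar> \<le> \<bar>\<beta> f x - \<beta> f y\<bar> * \<bar>1 - lg (\<phi> f x)\<bar> + \<bar>\<beta> f y\<bar> * \<bar>lg (\<phi> f y) - lg (\<phi> f x)\<bar>"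
      unfolding abs_mult[symmetric] by linarith
    also have "\<dots> \<le> (1 / e^3 * D x y) * 1 + (1 / e^2) * (1 / e * D x y)"
    proof (intro add_mono mult_mono)
      have "\<bar>lg (\<phi> f y) - lg (\<phi> f x)\<bar> \<le> \<bar>\<phi> f x - \<phi> f y\<bar>" using lg_lipschitz[of "\<phi> f y" "\<phi> f x"] by linarith
      thus "\<bar>lg (\<phi> f y) - lg (\<phi> f x)\<bar> \<le> 1 / e * D x y" using m\<phi>[of x y] by linarith
    qed (use mb[OF xy] s01[of x] b01[OF xy(2)] D0 e_pos in auto)
    also have "\<dots> = 2 / e^3 * D x y" by (simp add: power2_eq_square power3_eq_cube)
    finally show ?thesis .
  qed
  define C where "C = 1 / e^2 + 2 / e^3"
  have up: "c * D x y \<le> C * D x y" if "c \<le> C" for c x y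
    by (intro mult_right_mono that D0)
  have C: "1 / e^2 \<le> C" "1 / e^3 \<le> C" "2 / e^3 \<le> C"
  proof -
    have "0 \<le> 1 / e^3" "0 \<le> 1 / e^2" "2 / e^3 = 2 * (1 / e^3)" using e_pos by auto
    thus "1 / e^2 \<le> C" "1 / e^3 \<le> C" "2 / e^3 \<le> C" unfolding C_def by linarith+
  qed
  show ?thesis unfolding relaxed_def C_def[symmetric]
  proof (intro conjI ballI impI)
    fix x y :: real assume xy: "x \<in> {0..1}" "y \<in> {0..1}"
    show "\<bar>f x - f y\<bar> \<le> C * \<bar>prim (dom \<rho>) x - prim (dom \<rho>) y\<bar>"
      using order_trans[OF mf up[OF C(1)]] unfolding D_def .
    show "\<bar>\<alpha> f x - \<alpha> f y\<bar> \<le> C * \<bar>prim (dom \<rho>) x - prim (dom \<rho>) y\<bar>"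
      using order_trans[OF ma[OF xy] up[OF C(3)]] unfolding D_def .
    show "\<bar>\<beta> f x - \<beta> f y\<bar> \<le> C * \<bar>prim (dom \<rho>) x - prim (dom \<rho>) y\<bar>"
      using order_trans[OF mb[OF xy] up[OF C(2)]] unfolding D_def .
  next
    fix x :: real assume x: "x \<in> {0..1}"
    show "\<bar>\<alpha> f x\<bar> \<le> 1 / e^2" "\<bar>\<beta> f x\<bar> \<le> 1 / e^2"
      using a01[OF x] b01[OF x] by (simp_all only: abs_of_nonneg)
    show "f x = f 0 + prim (\<lambda>t. \<alpha> f t - \<beta> f t * \<rho> t) x" by (rule maximiser_derivative[OF n rho x])
  next
    assume "AE x in unit_leb. 0 \<le> \<rho> x \<and> \<rho> x \<le> 1"
    from Ham_maximiser[OF n rho this] show "0 \<le> Ham \<rho> f (\<lambda>t. \<alpha> f t - \<beta> f t * \<rho> t)" by simp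
  qed (rule f)
qed

lemma adm_convex:
  assumes f: "f \<in> A" and g: "g \<in> A" and st: "0 \<le> s" "0 \<le> t" "s + t = (1::real)"
  shows "(\<lambda>x. s * f x + t * g x) \<in> A" "\<phi> (\<lambda>x. s * f x + t * g x) x = s * \<phi> f x + t * \<phi> g x"
proof -
  have i: "integrable unit_leb (\<lambda>x. s * f x)" "integrable unit_leb (\<lambda>x. t * g x)"
    using AD(6)[OF f] AD(6)[OF g] by auto
  note [measurable] = AD(1)[OF f] AD(1)[OF g]
  have "0 \<le> s * f x + t * g x" "e * (s * f x + t * g x) \<le> 1" if x: "x \<in> {0..1}" for x
  proof -
    show "0 \<le> s * f x + t * g x" using AD(2)[OF f x] AD(2)[OF g x] st by simp
    have "s * (e * f x) + t * (e * g x) \<le> s * 1 + t * 1"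
      using AD(3)[OF f x] AD(3)[OF g x] st by (intro add_mono mult_left_mono) auto
    thus "e * (s * f x + t * g x) \<le> 1" using st by (simp add: algebra_simps)
  qed
  moreover have "(LINT x|unit_leb. s * f x + t * g x) = m"
  proof -
    have "(LINT x|unit_leb. s * f x + t * g x) = (s + t) * m"
      using i AD(4)[OF f] AD(4)[OF g] by (simp add: distrib_right)
    thus ?thesis using st by simp
  qed
  ultimately show "(\<lambda>x. s * f x + t * g x) \<in> A" unfolding adm_def by simp
  have "p = s * p + t * p" using st by (simp add: distrib_right[symmetric])
  thus "\<phi> (\<lambda>x. s * f x + t * g x) x = s * \<phi> f x + t * \<phi> g x"
    unfolding \<Phi>_def prim_add[OF i] prim_cmult by (simp add: distrib_left)
qed

text \<open>Only the quadratic term fails to be affine in the pair of \<open>f\<close> and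
  \<open>z\<close>, and its weight \<open>\<sigma> (\<rho> x)\<close> is nonnegative when
  \<open>0 \<le> \<rho> \<le> 1\<close>.\<close>

lemma Ham_concave:
  assumes f: "f \<in> A" "g \<in> A" and z: "integrable unit_leb z" "integrable unit_leb w"
    and rho: "integrable unit_leb \<rho>" and r01: "AE x in unit_leb. 0 \<le> \<rho> x \<and> \<rho> x \<le> 1"
    and st: "0 \<le> s" "0 \<le> t" "s + t = (1::real)"
  shows "s * Ham \<rho> f z + t * Ham \<rho> g w \<le> Ham \<rho> (\<lambda>x. s * f x + t * g x) (\<lambda>x. s * z x + t * w x)"
proof -
  define h where "h = (\<lambda>x. s * f x + t * g x)"
  have h: "h \<in> A" unfolding h_def by (rule adm_convex(1)[OF f st])
  note F = Ham_integrable[OF f(1) z(1) rho r01] and G = Ham_integrable[OF f(2) z(2) rho r01]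
  note hi = Ham_integrable(1)[OF h z(1) rho r01]
  have "(LINT x|unit_leb. h x * (\<sigma> (\<rho> x) * h x)) \<le> (LINT x|unit_leb. s * (f x * (\<sigma> (\<rho> x) * f x)) + t * (g x * (\<sigma> (\<rho> x) * g x)))"
  proof (rule integral_AE_mono[OF hi])
    show "AE x in unit_leb. h x * (\<sigma> (\<rho> x) * h x) \<le> s * (f x * (\<sigma> (\<rho> x) * f x)) + t * (g x * (\<sigma> (\<rho> x) * g x))"
      using r01
    proof eventually_elim
      case (elim x)
      hence s0: "0 \<le> \<sigma> (\<rho> x)" by (simp add: \<sigma>_def)
      \<comment> \<open>The variance identity for a two-point mixture.\<close>
      have "s * (f x)\<^sup>2 + t * (g x)\<^sup>2 - (h x)\<^sup>2 = s * t * (f x - g x)\<^sup>2"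
      proof -
        have t: "t = 1 - s" using st by simp
        show ?thesis unfolding h_def t by (simp add: power2_eq_square algebra_simps)
      qed
      hence "(h x)\<^sup>2 \<le> s * (f x)\<^sup>2 + t * (g x)\<^sup>2" using st by (smt (verit) mult_nonneg_nonneg zero_le_power2)
      from mult_left_mono[OF this s0] show ?case by (simp add: power2_eq_square algebra_simps)
    qed
  qed (use F G in simp)
  also have "\<dots> = s * (LINT x|unit_leb. f x * (\<sigma> (\<rho> x) * f x)) + t * (LINT x|unit_leb. g x * (\<sigma> (\<rho> x) * g x))"
    using F G by simp
  finally have "e * (LINT x|unit_leb. h x * (\<sigma> (\<rho> x) * h x)) \<le>
      e * (s * (LINT x|unit_leb. f x * (\<sigma> (\<rho> x) * f x)) + t * (LINT x|unit_leb. g x * (\<sigma> (\<rho> x) * g x)))"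
    using e_pos by (intro mult_left_mono) auto
  moreover have "(LINT x|unit_leb. \<rho> x * (s * z x + t * w x)) = s * (LINT x|unit_leb. \<rho> x * z x) + t * (LINT x|unit_leb. \<rho> x * w x)"
  proof -
    have "(LINT x|unit_leb. \<rho> x * (s * z x + t * w x)) = (LINT x|unit_leb. s * (\<rho> x * z x) + t * (\<rho> x * w x))"
      by (simp add: algebra_simps)
    thus ?thesis using F G by simp
  qed
  moreover have "(LINT x|unit_leb. \<sigma> (\<rho> x) * h x) = s * (LINT x|unit_leb. \<sigma> (\<rho> x) * f x) + t * (LINT x|unit_leb. \<sigma> (\<rho> x) * g x)"
  proof -
    have "(LINT x|unit_leb. \<sigma> (\<rho> x) * h x) = (LINT x|unit_leb. s * (\<sigma> (\<rho> x) * f x) + t * (\<sigma> (\<rho> x) * g x))"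
      unfolding h_def by (simp add: algebra_simps)
    thus ?thesis using F G by simp
  qed
  moreover have "lg (p + m) = s * lg (p + m) + t * lg (p + m)" "lg p = s * lg p + t * lg p"
    using st by (simp_all add: distrib_right[symmetric])
  ultimately show ?thesis unfolding Ham_def h_def[symmetric]
    by (simp add: h_def algebra_simps)
qed

lemma relaxed_convex:
  assumes g: "relaxed \<rho> f a b" and g': "relaxed \<rho> f' a' b'" and rho: "integrable unit_leb \<rho>"
    and st: "0 \<le> s" "0 \<le> t" "s + t = (1::real)"
  shows "relaxed \<rho> (\<lambda>x. s * f x + t * f' x) (\<lambda>x. s * a x + t * a' x) (\<lambda>x. s * b x + t * b' x)"
proof -
  note G = relaxedD[OF g] and G' = relaxedD[OF g']
  define z where "z = (\<lambda>t. a t - b t * \<rho> t)"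
  define z' where "z' = (\<lambda>t. a' t - b' t * \<rho> t)"
  have zi: "integrable unit_leb z" "integrable unit_leb z'" unfolding z_def z'_def
    by (rule relaxed_cont(4)[OF g rho], rule relaxed_cont(4)[OF g' rho])
  have zz: "(\<lambda>x. (s * a x + t * a' x) - (s * b x + t * b' x) * \<rho> x) = (\<lambda>x. s * z x + t * z' x)"
    unfolding z_def z'_def by (auto simp: algebra_simps)
  have comb: "\<bar>s * u + t * v\<bar> \<le> c" if "\<bar>u\<bar> \<le> c" "\<bar>v\<bar> \<le> c" for u v c
  proof -
    have "\<bar>s * u + t * v\<bar> \<le> s * \<bar>u\<bar> + t * \<bar>v\<bar>"
      using abs_triangle_ineq[of "s * u" "t * v"] st by (simp add: abs_mult)
    also have "\<dots> \<le> s * c + t * c" using that st by (intro add_mono mult_left_mono) auto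
    also have "\<dots> = c" using st by (simp add: distrib_right[symmetric])
    finally show ?thesis .
  qed
  have comb2: "\<bar>(s * u + t * v) - (s * u' + t * v')\<bar> \<le> c" if "\<bar>u - u'\<bar> \<le> c" "\<bar>v - v'\<bar> \<le> c" for u v u' v' c
    using comb[OF that] by (simp add: algebra_simps)
  show ?thesis unfolding relaxed_def zz
  proof (intro conjI ballI impI)
    show "(\<lambda>x. s * f x + t * f' x) \<in> A" by (rule adm_convex(1)[OF G(1) G'(1) st])
    fix x :: real assume x: "x \<in> {0..1}"
    show "\<bar>s * a x + t * a' x\<bar> \<le> 1 / e^2" "\<bar>s * b x + t * b' x\<bar> \<le> 1 / e^2"
      using comb G(2,3)[OF x] G'(2,3)[OF x] by auto
    have pr: "prim (\<lambda>x. s * z x + t * z' x) x = s * prim z x + t * prim z' x"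
      using prim_add[of "\<lambda>x. s * z x" "\<lambda>x. t * z' x"] zi by (simp add: prim_cmult)
    show "s * f x + t * f' x = s * f 0 + t * f' 0 + prim (\<lambda>x. s * z x + t * z' x) x"
    proof -
      have "s * f x = s * f 0 + s * prim z x" "t * f' x = t * f' 0 + t * prim z' x"
        using G(7)[OF x] G'(7)[OF x] unfolding z_def z'_def by (metis distrib_left)+
      thus ?thesis unfolding pr by simp
    qed
  next
    fix x y :: real assume xy: "x \<in> {0..1}" "y \<in> {0..1}"
    show "\<bar>(s * f x + t * f' x) - (s * f y + t * f' y)\<bar> \<le> modulus \<rho> x y"
      "\<bar>(s * a x + t * a' x) - (s * a y + t * a' y)\<bar> \<le> modulus \<rho> x y"
      "\<bar>(s * b x + t * b' x) - (s * b y + t * b' y)\<bar> \<le> modulus \<rho> x y"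
      by (intro comb2 G(4-6)[OF xy] G'(4-6)[OF xy])+
  next
    assume r01: "AE x in unit_leb. 0 \<le> \<rho> x \<and> \<rho> x \<le> 1"
    have "0 \<le> s * Ham \<rho> f z + t * Ham \<rho> f' z'"
      using G(8)[OF r01] G'(8)[OF r01] st unfolding z_def z'_def by simp
    thus "0 \<le> Ham \<rho> (\<lambda>x. s * f x + t * f' x) (\<lambda>x. s * z x + t * z' x)"
      using Ham_concave[OF G(1) G'(1) zi rho r01 st] by linarith
  qed
qed

text \<open>Convergence of the coefficients gives pointwise convergence of
  \<open>a - b * \<rho>\<close> under the bound \<open>1 / e^2 * dom \<rho>\<close>, so the integral
  conditions pass to the limit. The end point values of \<open>f\<close> in \<open>Ham\<close>
  converge because convergence is assumed at every point.\<close>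

lemma relaxed_closed:
  assumes g: "\<And>n. relaxed \<rho> (fn n) (an n) (bn n)" and rho: "integrable unit_leb \<rho>"
    and lf: "\<And>x. x \<in> {0..1} \<Longrightarrow> (\<lambda>n. fn n x) \<longlonglongrightarrow> f x"
    and la: "\<And>x. x \<in> {0..1} \<Longrightarrow> (\<lambda>n. an n x) \<longlonglongrightarrow> a x"
    and lb: "\<And>x. x \<in> {0..1} \<Longrightarrow> (\<lambda>n. bn n x) \<longlonglongrightarrow> b x"
  shows "relaxed \<rho> f a b"
proof -
  note G = relaxedD[OF g]
  define zn where "zn = (\<lambda>n t. an n t - bn n t * \<rho> t)"
  define z where "z = (\<lambda>t. a t - b t * \<rho> t)"
  have zni: "integrable unit_leb (zn n)" for n unfolding zn_def by (rule relaxed_cont(4)[OF g rho])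
  have f: "f \<in> A" by (rule \<phi>_tendsto(1)[OF G(1) lf])
  have lz: "(\<lambda>n. zn n x) \<longlonglongrightarrow> z x" if "x \<in> {0..1}" for x
    unfolding zn_def z_def by (intro tendsto_intros la lb that)
  have [measurable]: "zn n \<in> borel_measurable unit_leb" "\<rho> \<in> borel_measurable unit_leb" for n
    using zni rho by auto
  have zm [measurable]: "z \<in> borel_measurable unit_leb"
    by (rule borel_measurable_LIMSEQ_real[where u=zn]) (use lz in auto)
  have zb: "\<bar>zn n x\<bar> \<le> 1 / e^2 * dom \<rho> x" if x: "x \<in> {0..1}" for n x
  proof -
    have "\<bar>bn n x * \<rho> x\<bar> \<le> 1 / e^2 * \<bar>\<rho> x\<bar>" unfolding abs_mult by (intro mult_right_mono G x) auto
    thus ?thesis unfolding zn_def dom_def distrib_left using G(2)[OF x, of n] by linarith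
  qed
  have le_lim: "\<bar>u - v\<bar> \<le> c" if "un \<longlonglongrightarrow> u" "vn \<longlonglongrightarrow> v" "\<And>n. \<bar>un n - vn n\<bar> \<le> c" for un vn :: "nat \<Rightarrow> real" and u v c
    by (rule LIMSEQ_le_const2[OF tendsto_rabs[OF tendsto_diff[OF that(1,2)]]]) (use that(3) in auto)
  show ?thesis unfolding relaxed_def z_def[symmetric]
  proof (intro conjI ballI impI f)
    fix x :: real assume x: "x \<in> {0..1}"
    show "\<bar>a x\<bar> \<le> 1 / e^2" by (rule LIMSEQ_le_const2[OF tendsto_rabs[OF la[OF x]]]) (use G(2)[OF x] in auto)
    show "\<bar>b x\<bar> \<le> 1 / e^2" by (rule LIMSEQ_le_const2[OF tendsto_rabs[OF lb[OF x]]]) (use G(3)[OF x] in auto)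
    have "(\<lambda>n. prim (zn n) x) \<longlonglongrightarrow> prim z x"
      unfolding prim_def
    proof (rule integral_dominated_convergence[where w="\<lambda>t. 1 / e^2 * dom \<rho> t"])
      show "AE t in unit_leb. (\<lambda>n. indicator {..x} t * zn n t) \<longlonglongrightarrow> indicator {..x} t * z t"
        using lz by (intro AE_I2 tendsto_intros) auto
      show "AE t in unit_leb. norm (indicator {..x} t * zn n t) \<le> 1 / e^2 * dom \<rho> t" for n
      proof (rule AE_I2)
        fix t assume "t \<in> space unit_leb"
        thus "norm (indicator {..x} t * zn n t) \<le> 1 / e^2 * dom \<rho> t"
          using zb[of t n] by (auto simp: indicator_def dom_def)
      qed
    qed (use dom_integrable[OF rho] in auto)
    hence "(\<lambda>n. fn n 0 + prim (zn n) x) \<longlonglongrightarrow> f 0 + prim z x" by (intro tendsto_intros lf) auto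
    moreover have "(\<lambda>n. fn n 0 + prim (zn n) x) = (\<lambda>n. fn n x)" unfolding zn_def G(7)[OF x] ..
    ultimately show "f x = f 0 + prim z x" using LIMSEQ_unique[OF lf[OF x]] by simp
  next
    fix x y :: real assume xy: "x \<in> {0..1}" "y \<in> {0..1}"
    show "\<bar>f x - f y\<bar> \<le> modulus \<rho> x y"
      by (rule le_lim[OF lf[OF xy(1)] lf[OF xy(2)] G(4)[OF xy]])
    show "\<bar>a x - a y\<bar> \<le> modulus \<rho> x y"
      by (rule le_lim[OF la[OF xy(1)] la[OF xy(2)] G(5)[OF xy]])
    show "\<bar>b x - b y\<bar> \<le> modulus \<rho> x y"
      by (rule le_lim[OF lb[OF xy(1)] lb[OF xy(2)] G(6)[OF xy]])
  next
    assume r01: "AE x in unit_leb. 0 \<le> \<rho> x \<and> \<rho> x \<le> 1"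
    note [measurable] = AD(1)[OF f] AD(1)[OF G(1)]
    have [measurable]: "(\<lambda>x. \<sigma> (\<rho> x)) \<in> borel_measurable unit_leb" unfolding \<sigma>_def by measurable
    have s1: "AE x in unit_leb. \<bar>\<sigma> (\<rho> x)\<bar> \<le> 1" by (rule \<sigma>_AE_bound[OF r01])
    have fb: "\<bar>fn n x\<bar> \<le> 1 / e" if "x \<in> {0..1}" for n x using AD(2,5)[OF G(1) that, of n] by simp
    have "(\<lambda>n. LINT x|unit_leb. fn n x * (\<sigma> (\<rho> x) * fn n x)) \<longlonglongrightarrow> (LINT x|unit_leb. f x * (\<sigma> (\<rho> x) * f x))"
    proof (rule integral_dominated_convergence[where w="\<lambda>t. 1 / e * (1 * (1 / e))"])
      show "AE x in unit_leb. (\<lambda>n. fn n x * (\<sigma> (\<rho> x) * fn n x)) \<longlonglongrightarrow> f x * (\<sigma> (\<rho> x) * f x)"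
        using lf by (intro AE_I2 tendsto_intros) auto
      show "AE x in unit_leb. norm (fn n x * (\<sigma> (\<rho> x) * fn n x)) \<le> 1 / e * (1 * (1 / e))" for n
        using s1 AE_space
      proof eventually_elim
        case (elim x)
        thus ?case unfolding real_norm_def abs_mult using fb[of x n] e_pos by (intro mult_mono) auto
      qed
    qed auto
    moreover have "(\<lambda>n. LINT x|unit_leb. \<sigma> (\<rho> x) * fn n x) \<longlonglongrightarrow> (LINT x|unit_leb. \<sigma> (\<rho> x) * f x)"
    proof (rule integral_dominated_convergence[where w="\<lambda>t. 1 * (1 / e)"])
      show "AE x in unit_leb. (\<lambda>n. \<sigma> (\<rho> x) * fn n x) \<longlonglongrightarrow> \<sigma> (\<rho> x) * f x"
        using lf by (intro AE_I2 tendsto_intros) auto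
      show "AE x in unit_leb. norm (\<sigma> (\<rho> x) * fn n x) \<le> 1 * (1 / e)" for n
        using s1 AE_space
      proof eventually_elim
        case (elim x)
        thus ?case unfolding real_norm_def abs_mult using fb[of x n] e_pos by (intro mult_mono) auto
      qed
    qed auto
    moreover have "(\<lambda>n. LINT x|unit_leb. \<rho> x * zn n x) \<longlonglongrightarrow> (LINT x|unit_leb. \<rho> x * z x)"
    proof (rule integral_dominated_convergence[where w="\<lambda>t. 1 * (1 / e^2 * dom \<rho> t)"])
      show "AE x in unit_leb. (\<lambda>n. \<rho> x * zn n x) \<longlonglongrightarrow> \<rho> x * z x"
        using lz by (intro AE_I2 tendsto_intros) auto
      show "AE x in unit_leb. norm (\<rho> x * zn n x) \<le> 1 * (1 / e^2 * dom \<rho> x)" for n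
        using r01 AE_space
      proof eventually_elim
        case (elim x)
        thus ?case unfolding real_norm_def abs_mult using zb[of x n] by (intro mult_mono) auto
      qed
    qed (use dom_integrable[OF rho] in auto)
    ultimately have "(\<lambda>n. Ham \<rho> (fn n) (zn n)) \<longlonglongrightarrow> Ham \<rho> f z"
      unfolding Ham_def by (intro tendsto_intros lf) auto
    thus "0 \<le> Ham \<rho> f z" by (rule LIMSEQ_le_const) (use G(8)[OF r01] in \<open>auto simp: zn_def\<close>)
  qed
qed

text \<open>Arzela-Ascoli is applied to the triple of functions, so one subsequence serves the
  density and both coefficients.\<close>

lemma relaxed_compact:
  assumes g: "\<And>n. relaxed \<rho> (fn n) (an n) (bn n)" and rho: "integrable unit_leb \<rho>"
  obtains k f a b where "strict_mono (k :: nat \<Rightarrow> nat)" "relaxed \<rho> f a b"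
    "\<And>x. x \<in> {0..1} \<Longrightarrow> (\<lambda>n. fn (k n) x) \<longlonglongrightarrow> f x"
proof -
  note G = relaxedD[OF g]
  define F where "F = (\<lambda>n x. (fn n x, an n x, bn n x))"
  define C where "C = 1 / e^2 + 2 / e^3"
  have n3: "norm (u, v, w) \<le> \<bar>u\<bar> + \<bar>v\<bar> + \<bar>w\<bar>" for u v w :: real
    using norm_Pair_le[of u "(v, w)"] norm_Pair_le[of v w] by simp
  show ?thesis
  proof (rule Arzela_Ascoli_modulus[where F=F and M="1 / e + 1 / e^2 + 1 / e^2" and C="C + C + C", OF dom_integrable[OF rho]])
    show "norm (F n x) \<le> 1 / e + 1 / e^2 + 1 / e^2" if x: "x \<in> {0..1}" for n x
    proof -
      have "\<bar>fn n x\<bar> \<le> 1 / e" using AD(2,5)[OF G(1) x, of n] by simp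
      thus ?thesis unfolding F_def using n3[of "fn n x" "an n x" "bn n x"] G(2,3)[OF x, of n] by linarith
    qed
    show "norm (F n x - F n y) \<le> (C + C + C) * \<bar>prim (dom \<rho>) x - prim (dom \<rho>) y\<bar>" if xy: "x \<in> {0..1}" "y \<in> {0..1}" for n x y
      using n3[of "fn n x - fn n y" "an n x - an n y" "bn n x - bn n y"] G(4-6)[OF xy, of n]
      unfolding F_def diff_Pair distrib_right C_def by linarith
    fix h and k :: "nat \<Rightarrow> nat"
    assume k: "strict_mono k" and lim: "\<And>x. x \<in> {0..1} \<Longrightarrow> (\<lambda>n. F (k n) x) \<longlonglongrightarrow> h x"
    have l1: "(\<lambda>n. fn (k n) x) \<longlonglongrightarrow> fst (h x)" if "x \<in> {0..1}" for x
      using tendsto_fst[OF lim[OF that]] by (simp add: F_def)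
    have l2: "(\<lambda>n. an (k n) x) \<longlonglongrightarrow> fst (snd (h x))" if "x \<in> {0..1}" for x
      using tendsto_fst[OF tendsto_snd[OF lim[OF that]]] by (simp add: F_def)
    have l3: "(\<lambda>n. bn (k n) x) \<longlonglongrightarrow> snd (snd (h x))" if "x \<in> {0..1}" for x
      using tendsto_snd[OF tendsto_snd[OF lim[OF that]]] by (simp add: F_def)
    show ?thesis
      by (rule that[OF k relaxed_closed[where fn="\<lambda>n. fn (k n)" and an="\<lambda>n. an (k n)" and bn="\<lambda>n. bn (k n)", OF g rho l1 l2 l3] l1])
  qed
qed

section \<open>Subgradients\<close>

definition P :: "L1 \<Rightarrow> (real \<Rightarrow> real) \<Rightarrow> real" where
  "P u f = (LINT x|unit_leb. rep_L1 u x * \<phi> f x)"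

lemma P_eq_pairing: "f \<in> A \<Longrightarrow> P u f = pairing u (abs_L1 (\<phi> f))"
  unfolding P_def by (simp add: pairing_abs_L1 \<phi>_integrable)

lemma abs_L1_\<phi>_bounded:
  assumes "f \<in> A"
  shows "AE x in unit_leb. \<bar>rep_L1 (abs_L1 (\<phi> f)) x\<bar> \<le> \<bar>p\<bar> + m"
  using rep_abs_L1[OF \<phi>_integrable[OF assms]] by eventually_elim (use \<phi>_bound[OF assms] in simp)

lemma P_bounded_linear: "f \<in> A \<Longrightarrow> bounded_linear (\<lambda>u. P u f)"
  using bounded_linear_pairing[OF abs_L1_\<phi>_bounded] P_eq_pairing by (simp add: fun_eq_iff)

lemma P_le_norm: "f \<in> A \<Longrightarrow> \<bar>P u f\<bar> \<le> (\<bar>p\<bar> + m) * norm u"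
  using linear_bound[OF rep_L1_integrable] by (simp add: P_def norm_L1_eq)

lemma P_convex:
  assumes "f \<in> A" "g \<in> A" "0 \<le> s" "0 \<le> t" "s + t = (1::real)"
  shows "P u (\<lambda>x. s * f x + t * g x) = s * P u f + t * P u g"
proof -
  have "P u (\<lambda>x. s * f x + t * g x) = (LINT x|unit_leb. s * (rep_L1 u x * \<phi> f x) + t * (rep_L1 u x * \<phi> g x))"
    unfolding P_def adm_convex(2)[OF assms] by (simp add: algebra_simps)
  thus ?thesis unfolding P_def using \<rho>\<phi>_integrable[OF rep_L1_integrable] assms by simp
qed

text \<open>
  Frank-Wolfe argument: if the squared defect \<open>N\<close> had a positive infimum over the convex
  class \<open>relaxed\<close>, moving from a near-minimiser towards the maximiser that the hypothesis provides for
  the direction of the defect would decrease \<open>N\<close> below it.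
\<close>

lemma Frank_Wolfe:
  assumes rho: "integrable unit_leb \<rho>" and l: "bounded_linear l" and I: "finite I"
    and dom: "\<And>u. \<exists>f. maximiser \<rho> f \<and> l u \<le> P u f" and \<delta>: "0 < \<delta>"
  shows "\<exists>f a b. relaxed \<rho> f a b \<and> (\<forall>u\<in>I. \<bar>P u f - l u\<bar> < \<delta>)"
proof -
  interpret l: bounded_linear l by (rule l)
  define G where "G = {f. \<exists>a b. relaxed \<rho> f a b}"
  define N where "N = (\<lambda>f. \<Sum>u\<in>I. (P u f - l u)\<^sup>2)"
  define B where "B = (\<Sum>u\<in>I. ((\<bar>p\<bar> + m) * norm u + \<bar>l u\<bar>)\<^sup>2)"
  define m0 where "m0 = (INF f\<in>G. N f)"
  have GA: "f \<in> A" if "f \<in> G" for f using that relaxedD(1) unfolding G_def by blast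
  have maximiserG: "f \<in> G" if "maximiser \<rho> f" for f using maximiser_relaxed[OF that rho] unfolding G_def by blast
  have N0: "0 \<le> N f" for f unfolding N_def by (intro sum_nonneg) simp
  have B0: "0 \<le> B" unfolding B_def by (intro sum_nonneg) simp
  have NB: "N f \<le> B" if "f \<in> A" for f
    unfolding N_def B_def
  proof (intro sum_mono)
    fix u
    have "\<bar>P u f - l u\<bar> \<le> (\<bar>p\<bar> + m) * norm u + \<bar>l u\<bar>" using P_le_norm[OF that, of u] by linarith
    thus "(P u f - l u)\<^sup>2 \<le> ((\<bar>p\<bar> + m) * norm u + \<bar>l u\<bar>)\<^sup>2" using power_mono[OF _ abs_ge_zero, of _ _ 2] by force
  qed
  have bdd: "bdd_below (N ` G)" by (rule bdd_belowI2[where m=0]) (rule N0)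
  have ne: "G \<noteq> {}" using dom maximiserG by blast
  \<comment> \<open>Move from \<open>c\<close> a fraction \<open>t\<close> towards a suitable
    maximiser and expand the square: the cross term is nonpositive and the last term is at most
    \<open>B\<close>.\<close>
  have step: "m0 \<le> (1 - t)\<^sup>2 * N c + t\<^sup>2 * B" if c: "c \<in> G" and t: "0 \<le> t" "t \<le> 1" for c t
  proof -
    define d where "d = (\<lambda>u. P u c - l u)"
    note cA = GA[OF c]
    \<comment> \<open>The direction is minus the combination of the test elements weighted by the
      defects, half the negative gradient of \<open>N\<close>; domination there is precisely the
      sign of the cross term.\<close>
    obtain f where f: "maximiser \<rho> f" and le: "l (- (\<Sum>u\<in>I. d u *\<^sub>R u)) \<le> P (- (\<Sum>u\<in>I. d u *\<^sub>R u)) f"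
      using dom by blast
    have fG: "f \<in> G" and fA: "f \<in> A" using maximiserG[OF f] GA by auto
    interpret P: bounded_linear "\<lambda>u. P u f" by (rule P_bounded_linear[OF fA])
    have neg: "(\<Sum>u\<in>I. d u * (P u f - l u)) \<le> 0"
      using le by (simp add: l.neg l.sum l.scaleR P.neg P.sum P.scaleR right_diff_distrib sum_subtractf)
    define h where "h = (\<lambda>x. (1 - t) * c x + t * f x)"
    have hG: "h \<in> G"
    proof -
      obtain a b a' b' where "relaxed \<rho> c a b" "relaxed \<rho> f a' b'" using c fG unfolding G_def by blast
      from relaxed_convex[OF this rho, of "1 - t" t] t show ?thesis unfolding G_def h_def by auto
    qed
    have Ph: "P u h - l u = (1 - t) * d u + t * (P u f - l u)" for u
      unfolding h_def d_def using t by (subst P_convex[OF cA fA]) (auto simp: algebra_simps)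
    have "N h = (\<Sum>u\<in>I. (1 - t)\<^sup>2 * (d u)\<^sup>2 + (2 * (1 - t) * t) * (d u * (P u f - l u)) + t\<^sup>2 * (P u f - l u)\<^sup>2)"
      unfolding N_def Ph by (intro sum.cong refl) (simp add: power2_eq_square algebra_simps)
    also have "\<dots> = (1 - t)\<^sup>2 * N c + (2 * (1 - t) * t) * (\<Sum>u\<in>I. d u * (P u f - l u)) + t\<^sup>2 * N f"
      unfolding N_def d_def by (simp add: sum.distrib sum_distrib_left)
    also have "\<dots> \<le> (1 - t)\<^sup>2 * N c + 0 + t\<^sup>2 * B"
      using neg t NB[OF fA] by (intro add_mono mult_left_mono order_refl mult_nonneg_nonpos) auto
    finally have "N h \<le> (1 - t)\<^sup>2 * N c + t\<^sup>2 * B" by simp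
    moreover have "m0 \<le> N h" unfolding m0_def by (rule cINF_lower[OF bdd hG])
    ultimately show ?thesis by linarith
  qed
  \<comment> \<open>The infimum need not be attained, so \<open>N c\<close> is replaced by
    \<open>m0\<close> through near-minimisers \<open>c\<close>.\<close>
  have m0_le: "m0 \<le> (1 - t)\<^sup>2 * m0 + t\<^sup>2 * B" if t: "0 \<le> t" "t \<le> 1" for t
  proof (rule field_le_epsilon)
    fix \<eta> :: real assume "0 < \<eta>"
    then obtain c where c: "c \<in> G" "N c < m0 + \<eta>"
      using cINF_less_iff[OF ne bdd, of "m0 + \<eta>"] unfolding m0_def by auto
    have "(1 - t)\<^sup>2 * N c \<le> (1 - t)\<^sup>2 * (m0 + \<eta>)" using c by (intro mult_left_mono) auto
    moreover have "(1 - t)\<^sup>2 * \<eta> \<le> 1 * \<eta>" using t \<open>0 < \<eta>\<close> by (intro mult_right_mono power_le_one) auto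
    ultimately show "m0 \<le> (1 - t)\<^sup>2 * m0 + t\<^sup>2 * B + \<eta>"
      using step[OF c(1) t] by (simp add: distrib_left)
  qed
  have "m0 \<le> 0"
  proof (rule ccontr)
    assume "\<not> m0 \<le> 0"
    hence m0: "0 < m0" by simp
    \<comment> \<open>The minimiser of \<open>(1 - t)\<^sup>2 * m0 + t\<^sup>2 * B\<close>, whose
      minimum \<open>m0 * B / (m0 + B)\<close> is below a positive \<open>m0\<close>.\<close>
    define t where "t = m0 / (m0 + B)"
    have t: "0 < t" "t \<le> 1" using m0 B0 unfolding t_def by auto
    have "t * ((2 - t) * m0) \<le> t * (t * B)"
      using m0_le[of t] t by (simp add: power2_eq_square algebra_simps)
    hence "(2 - t) * m0 \<le> t * B" using t by simp
    moreover have "t * (m0 + B) = m0" using m0 B0 by (simp add: t_def)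
    hence "t * B = m0 - t * m0" by (simp add: distrib_left)
    ultimately have "m0 \<le> 0" by (simp add: algebra_simps)
    thus False using m0 by simp
  qed
  hence "m0 < \<delta>\<^sup>2" using \<delta> by (smt (verit) zero_less_power)
  then obtain f where f: "f \<in> G" "N f < \<delta>\<^sup>2"
    using cINF_less_iff[OF ne bdd, of "\<delta>\<^sup>2"] unfolding m0_def by auto
  have "\<bar>P u f - l u\<bar> < \<delta>" if "u \<in> I" for u
  proof -
    have "(P u f - l u)\<^sup>2 \<le> N f" unfolding N_def
      by (rule member_le_sum[OF that]) (use I in auto)
    hence "\<bar>P u f - l u\<bar>\<^sup>2 < \<delta>\<^sup>2" using f(2) by simp
    thus ?thesis using \<delta> by (intro power_less_imp_less_base[of _ 2 \<delta>]) auto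
  qed
  thus ?thesis using f(1) unfolding G_def by blast
qed

text \<open>
  Since pairings with the indicators of \<open>{..q}\<close>, \<open>q\<close> rational, determine \<open>\<phi> f\<close>, the limit of the
  finite-dimensional approximations made for \<open>u\<close> and all of these does not depend on \<open>u\<close>.
\<close>

lemma representation:
  assumes rho: "integrable unit_leb \<rho>" and l: "bounded_linear l"
    and dom: "\<And>u. \<exists>f. maximiser \<rho> f \<and> l u \<le> P u f"
  obtains f a b where "relaxed \<rho> f a b" "\<And>u. l u = P u f"
proof -
  define y where "y = (\<lambda>k::nat. abs_L1 (indicator {..real_of_rat (from_nat k)}))"
  have ind: "integrable unit_leb (indicator {..x} :: real \<Rightarrow> real)" for x :: real
    by (rule integrable_unit_leb_bounded[where B=1]) (auto simp: indicator_def)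
  have Py: "P (y k) f = prim (\<phi> f) (real_of_rat (from_nat k))" if "f \<in> A" for k f
    unfolding P_def prim_def
  proof (rule integral_cong_AE)
    note [measurable] = \<phi>_meas[OF that] rep_L1_measurable
    show "AE x in unit_leb. rep_L1 (y k) x * \<phi> f x = indicator {..real_of_rat (from_nat k)} x * \<phi> f x"
      using rep_abs_L1[OF ind[of "real_of_rat (from_nat k)"]] unfolding y_def by eventually_elim simp
    show "(\<lambda>x. rep_L1 (y k) x * \<phi> f x) \<in> borel_measurable unit_leb"
      "(\<lambda>x. indicator {..real_of_rat (from_nat k)} x * \<phi> f x) \<in> borel_measurable unit_leb" by auto
  qed
  have ex: "\<exists>f a b. relaxed \<rho> f a b \<and> P u f = l u \<and> (\<forall>k. P (y k) f = l (y k))" for u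
  proof -
    \<comment> \<open>The direction \<open>u\<close> is matched together with more and more of the
      countable family, with tolerance tending to 0.\<close>
    have "\<exists>f a b. relaxed \<rho> f a b \<and> (\<forall>v\<in>insert u (y ` {..n}). \<bar>P v f - l v\<bar> < 1 / real (Suc n))" for n
      by (rule Frank_Wolfe[OF rho l _ dom]) auto
    then obtain fn an bn where G: "\<And>n. relaxed \<rho> (fn n) (an n) (bn n)"
      and ap: "\<And>n v. v \<in> insert u (y ` {..n}) \<Longrightarrow> \<bar>P v (fn n) - l v\<bar> < 1 / real (Suc n)" by metis
    show ?thesis
    proof (rule relaxed_compact[OF G rho])
      fix k f a b assume k: "strict_mono (k :: nat \<Rightarrow> nat)" and g: "relaxed \<rho> f a b"
        and lim: "\<And>x. x \<in> {0..1} \<Longrightarrow> (\<lambda>n. fn (k n) x) \<longlonglongrightarrow> f x"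
      have inv0: "(\<lambda>n. 1 / real (Suc (k n))) \<longlonglongrightarrow> 0"
        using LIMSEQ_subseq_LIMSEQ[OF LIMSEQ_Suc[OF lim_1_over_n] k] by (simp add: comp_def)
      \<comment> \<open>Any \<open>v\<close> that belongs to the tested set from some index on is
        matched exactly by the limit.\<close>
      have eq: "P v f = l v" if ev: "\<And>n. N \<le> n \<Longrightarrow> v \<in> insert u (y ` {..n})" for v N
      proof -
        have "(\<lambda>n. P v (fn (k n))) \<longlonglongrightarrow> P v f"
          unfolding P_def by (rule linear_tendsto[where fn="\<lambda>n. fn (k n)", OF relaxedD(1)[OF G] lim rep_L1_integrable])
        moreover have "(\<lambda>n. P v (fn (k n)) - l v) \<longlonglongrightarrow> 0"
        proof (rule Lim_null_comparison[OF _ inv0])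
          show "\<forall>\<^sub>F n in sequentially. norm (P v (fn (k n)) - l v) \<le> 1 / real (Suc (k n))"
            using eventually_ge_at_top[of N]
          proof eventually_elim
            case (elim n)
            hence "N \<le> k n" using seq_suble[OF k, of n] by linarith
            from ap[OF ev[OF this]] show ?case by simp
          qed
        qed
        hence "(\<lambda>n. P v (fn (k n))) \<longlonglongrightarrow> l v" by (simp add: LIM_zero_iff)
        ultimately show ?thesis by (rule LIMSEQ_unique)
      qed
      have "P u f = l u" by (rule eq[of 0]) simp
      moreover have "P (y j) f = l (y j)" for j by (rule eq[of j]) simp
      ultimately show ?thesis using g by blast
    qed
  qed
  \<comment> \<open>The choice \<open>u = 0\<close> retains only the countable family. Any profile
    obtained for another \<open>u\<close> has the same primitive at all rationals, hence the same
    profile almost everywhere.\<close>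
  obtain f a b where f: "relaxed \<rho> f a b" and fy: "\<And>k. P (y k) f = l (y k)" using ex[of 0] by blast
  have "l u = P u f" for u
  proof -
    obtain g a' b' where g: "relaxed \<rho> g a' b'" and gu: "P u g = l u" and gy: "\<And>k. P (y k) g = l (y k)"
      using ex[of u] by blast
    note fA = relaxedD(1)[OF f] and gA = relaxedD(1)[OF g]
    define h where "h = (\<lambda>x. \<phi> f x - \<phi> g x)"
    have hi: "integrable unit_leb h" unfolding h_def using \<phi>_integrable[OF fA] \<phi>_integrable[OF gA] by simp
    have ph: "prim h x = prim (\<phi> f) x - prim (\<phi> g) x" for x
      unfolding h_def by (rule prim_diff[OF \<phi>_integrable[OF fA] \<phi>_integrable[OF gA]])
    have rat: "prim h (real_of_rat q) = 0" for q
    proof -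
      obtain k :: nat where "q = from_nat k" using surj_from_nat by (metis surj_def)
      thus ?thesis using Py[OF fA, of k] Py[OF gA, of k] fy[of k] gy[of k] ph by simp
    qed
    have "prim h x = 0" for x
    proof (rule ccontr)
      assume "prim h x \<noteq> 0"
      moreover have "isCont (prim h) x"
        using prim_continuous[OF hi, of UNIV] by (simp add: continuous_on_eq_continuous_at)
      ultimately obtain s where s: "s > 0" "\<And>z. \<bar>z - x\<bar> < s \<Longrightarrow> \<bar>prim h z - prim h x\<bar> < \<bar>prim h x\<bar>"
        unfolding continuous_at_eps_delta dist_real_def by (meson zero_less_abs_iff)
      obtain q where "x < real_of_rat q" "real_of_rat q < x + s"
        using of_rat_dense[of x "x + s"] s(1) by auto
      thus False using s(2)[of "real_of_rat q"] rat[of q] by simp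
    qed
    hence "AE x in unit_leb. h x = 0" by (intro AE_zero_if_prim_zero[OF hi]) auto
    hence ae: "AE x in unit_leb. rep_L1 u x * \<phi> g x = rep_L1 u x * \<phi> f x"
      by eventually_elim (simp add: h_def)
    have "P u g = P u f" unfolding P_def
      by (rule integral_cong_AE[OF _ _ ae]) (use \<phi>_meas[OF fA] \<phi>_meas[OF gA] rep_L1_measurable in auto)
    thus ?thesis using gu by simp
  qed
  with f show ?thesis by (rule that)
qed

section \<open>The Legendre transform as a function on \<open>L1\<close>\<close>

lemma V_cong_AE:
  assumes "integrable unit_leb \<rho>" "integrable unit_leb \<rho>'" "AE x in unit_leb. \<rho> x = \<rho>' x"
  shows "V \<rho> = V \<rho>'"
  unfolding V_def
proof (rule SUP_cong[OF refl])
  fix f assume f: "f \<in> A"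
  have "(LINT x|unit_leb. \<rho> x * \<phi> f x) = (LINT x|unit_leb. \<rho>' x * \<phi> f x)"
    by (rule integral_cong_AE) (use assms \<phi>_meas[OF f] in \<open>auto elim: eventually_mono\<close>)
  thus "J \<rho> f = J \<rho>' f" by (simp add: J_def)
qed

lemma J_rep_L1: "J (rep_L1 u) f = P u f - entropy e p f"
  by (simp add: J_def P_def)

definition Vh :: "L1 \<Rightarrow> real" where
  "Vh u = V (rep_L1 u)"

text \<open>\<open>Vh\<close> is a supremum of affine functions of its argument, and the one
  belonging to a maximiser at \<open>u\<close> touches it there.\<close>

lemma Vh_subgradient:
  assumes "maximiser (rep_L1 u) f"
  shows "Vh u + P (v - u) f \<le> Vh v"
proof -
  note n = maximiserD[OF assms rep_L1_integrable]
  interpret P: bounded_linear "\<lambda>u. P u f" by (rule P_bounded_linear[OF n(1)])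
  show ?thesis
    using J_le_V[OF rep_L1_integrable n(1), of v] n(2) unfolding Vh_def J_rep_L1 by (simp add: P.diff)
qed

lemma Vh_attained: obtains f where "maximiser (rep_L1 u) f" "Vh u = P u f - entropy e p f"
proof -
  obtain f where f: "maximiser (rep_L1 u) f" using maximiser_exists[OF rep_L1_integrable] .
  moreover have "Vh u = P u f - entropy e p f"
    using maximiserD(2)[OF f rep_L1_integrable] unfolding Vh_def J_rep_L1 by simp
  ultimately show ?thesis by (rule that)
qed

text \<open>Classes with finite \<open>Lambda\<close> are exactly the profiles of admissible
  densities, so the two suprema run over the same values; the supremum is attained at a
  maximiser.\<close>

lemma Lambda_hat_eq: "Lambda_hat e p (p + m) u = ereal (Vh u)"
  unfolding Lambda_hat_def
proof (rule Sup_eqI)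
  fix y assume "y \<in> {ereal (pairing u f) - Lambda e p (p + m) f |f. Lambda e p (p + m) f < \<infinity>}"
  then obtain \<psi> where \<psi>: "y = ereal (pairing u \<psi>) - Lambda e p (p + m) \<psi>" "Lambda e p (p + m) \<psi> < \<infinity>" by blast
  obtain f where f: "f \<in> A" "\<psi> = abs_L1 (\<phi> f)"
    using Lambda_finite[OF e_pos _ \<psi>(2)] m_pos by auto
  have "y = ereal (J (rep_L1 u) f)"
    unfolding \<psi>(1) f(2) J_rep_L1 P_eq_pairing[OF f(1)] using Lambda_adm[OF e_pos, of f "p + m" p] f(1) by simp
  thus "y \<le> ereal (Vh u)" using J_le_V[OF rep_L1_integrable f(1)] by (simp add: Vh_def)
next
  fix y assume y: "\<And>z. z \<in> {ereal (pairing u f) - Lambda e p (p + m) f |f. Lambda e p (p + m) f < \<infinity>} \<Longrightarrow> z \<le> y"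
  obtain f where f: "maximiser (rep_L1 u) f" "Vh u = P u f - entropy e p f" by (rule Vh_attained)
  have fA: "f \<in> A" by (rule maximiserD(1)[OF f(1) rep_L1_integrable])
  have L: "Lambda e p (p + m) (abs_L1 (\<phi> f)) = ereal (entropy e p f)"
    using Lambda_adm[OF e_pos, of f "p + m" p] fA by simp
  have "ereal (pairing u (abs_L1 (\<phi> f))) - Lambda e p (p + m) (abs_L1 (\<phi> f)) \<le> y"
    by (rule y, rule CollectI, rule exI[of _ "abs_L1 (\<phi> f)"]) (simp add: L)
  thus "ereal (Vh u) \<le> y" unfolding L f(2) P_eq_pairing[OF fA] by simp
qed

lemma Vh_convex: "convex_on UNIV Vh"
proof (rule convex_onI)
  fix t :: real and u v :: L1 assume t: "0 < t" "t < 1"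
  obtain f where f: "maximiser (rep_L1 ((1 - t) *\<^sub>R u + t *\<^sub>R v)) f"
    "Vh ((1 - t) *\<^sub>R u + t *\<^sub>R v) = P ((1 - t) *\<^sub>R u + t *\<^sub>R v) f - entropy e p f" by (rule Vh_attained)
  have fA: "f \<in> A" by (rule maximiserD(1)[OF f(1) rep_L1_integrable])
  interpret P: bounded_linear "\<lambda>u. P u f" by (rule P_bounded_linear[OF fA])
  have "Vh ((1 - t) *\<^sub>R u + t *\<^sub>R v) = (1 - t) * J (rep_L1 u) f + t * J (rep_L1 v) f"
  proof -
    have "P ((1 - t) *\<^sub>R u + t *\<^sub>R v) f = (1 - t) * P u f + t * P v f"
      by (simp only: P.add P.scaleR real_scaleR_def)
    thus ?thesis unfolding f(2) J_rep_L1 by (simp add: algebra_simps)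
  qed
  also have "\<dots> \<le> (1 - t) * Vh u + t * Vh v"
    unfolding Vh_def using t by (intro add_mono mult_left_mono J_le_V rep_L1_integrable fA) auto
  finally show "Vh ((1 - t) *\<^sub>R u + t *\<^sub>R v) \<le> (1 - t) * Vh u + t * Vh v" .
qed simp

text \<open>The constant is the uniform bound on profiles, so it bounds the norm of every
  subgradient that comes from a maximiser.\<close>

lemma Vh_lipschitz: "(\<bar>p\<bar> + m)-lipschitz_on S Vh"
proof (rule lipschitz_onI)
  have le: "Vh u - Vh v \<le> (\<bar>p\<bar> + m) * norm (u - v)" for u v
  proof -
    obtain f where f: "maximiser (rep_L1 u) f" "Vh u = P u f - entropy e p f" by (rule Vh_attained)
    have fA: "f \<in> A" by (rule maximiserD(1)[OF f(1) rep_L1_integrable])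
    show ?thesis using Vh_subgradient[OF f(1), of v] P_le_norm[OF fA, of "v - u"] by (simp add: norm_minus_commute)
  qed
  fix u v show "dist (Vh u) (Vh v) \<le> (\<bar>p\<bar> + m) * dist u v"
    using le[of u v] le[of v u] by (simp add: dist_real_def dist_norm norm_minus_commute abs_le_iff)
qed (use m_pos in simp)

text \<open>The subgradient inequality at \<open>u + v / (n + 1)\<close> is the slope condition of
  \<open>Danskin\<close>. So in each direction \<open>l\<close> is dominated by some maximiser, as
  \<open>representation\<close> requires.\<close>

lemma subgradient_representation:
  assumes l: "bounded_linear l" and sub: "\<And>v. Vh u + l v \<le> Vh (u + v)"
  obtains f a b where "relaxed (rep_L1 u) f a b" "\<And>v. l v = P v f"
proof (rule representation[OF rep_L1_integrable l])
  interpret l: bounded_linear l by (rule l)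
  fix v
  have "V (rep_L1 u) + l v / real (Suc n) \<le> V (\<lambda>x. rep_L1 u x + 1 / real (Suc n) * rep_L1 v x)" for n
  proof -
    have "V (\<lambda>x. rep_L1 u x + 1 / real (Suc n) * rep_L1 v x) = Vh (u + (1 / real (Suc n)) *\<^sub>R v)"
      unfolding Vh_def
    proof (rule V_cong_AE)
      show "AE x in unit_leb. rep_L1 u x + 1 / real (Suc n) * rep_L1 v x = rep_L1 (u + (1 / real (Suc n)) *\<^sub>R v) x"
        using rep_L1_plus[of u "(1 / real (Suc n)) *\<^sub>R v"] rep_L1_scaleR[of "1 / real (Suc n)" v]
        by eventually_elim simp
    qed (intro rep_L1_integrable Bochner_Integration.integrable_add integrable_mult_right)+
    thus ?thesis using sub[of "(1 / real (Suc n)) *\<^sub>R v"] by (simp add: Vh_def l.scaleR)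
  qed
  from Danskin[OF rep_L1_integrable rep_L1_integrable this] show "\<exists>f. maximiser (rep_L1 u) f \<and> l v \<le> P v f"
    unfolding P_def by blast
qed (rule that)

text \<open>The first and second weak derivatives of the profile are \<open>f\<close> and
  \<open>a - b * \<rho>\<close>. The end point terms are well defined because \<open>f\<close> is
  continuous and therefore agrees with its \<open>cont_rep\<close> on the unit interval.\<close>

lemma relaxed_W_bc:
  assumes g: "relaxed (rep_L1 u) f a b"
  defines "w \<equiv> abs_L1 (\<phi> f)"
  shows "w \<in> W_bc p (p + m)"
    and "AE x in unit_leb. 0 \<le> rep_L1 u x \<and> rep_L1 u x \<le> 1 \<Longrightarrow>
      H_hat e (lg p) (lg (p + m)) u w = Ham (rep_L1 u) f (\<lambda>t. a t - b t * rep_L1 u t)"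
proof -
  define z where "z = (\<lambda>t. a t - b t * rep_L1 u t)"
  note c = relaxed_cont[OF g rep_L1_integrable]
  note G = relaxedD[OF g]
  have zi: "integrable unit_leb z" unfolding z_def by (rule c)
  have fi: "integrable unit_leb f" by (rule AD(6)[OF G(1)])
  have w1: "has_weak_deriv w (abs_L1 f)" unfolding w_def
    by (rule has_weak_deriv_prim[OF fi, of _ p]) (simp add: \<Phi>_def)
  have w2: "has_weak_deriv (abs_L1 f) (abs_L1 z)"
    by (rule has_weak_deriv_prim[OF zi G(7)[folded z_def]])
  have "cont_rep w 0 = p" "cont_rep w 1 = p + m"
    unfolding w_def using AD(4)[OF G(1)] by (simp_all add: cont_rep_abs_L1[OF \<phi>_cont[OF G(1)]] \<Phi>_def prim_1)
  thus "w \<in> W_bc p (p + m)" unfolding W_bc_def W21_def using w1 w2 by blast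
  assume r01: "AE x in unit_leb. 0 \<le> rep_L1 u x \<and> rep_L1 u x \<le> 1"
  note [measurable] = rep_L1_measurable AD(1)[OF G(1)] borel_measurable_integrable[OF zi]
  have [measurable]: "(\<lambda>x. \<sigma> (rep_L1 u x)) \<in> borel_measurable unit_leb" unfolding \<sigma>_def by measurable
  note ae = rep_abs_L1[OF fi]
  have "(LINT x|unit_leb. rep_L1 (abs_L1 f) x * (\<sigma> (rep_L1 u x) * rep_L1 (abs_L1 f) x)) = (LINT x|unit_leb. f x * (\<sigma> (rep_L1 u x) * f x))"
    by (rule integral_cong_AE) (use ae in \<open>auto elim: eventually_mono\<close>)
  moreover have "(LINT x|unit_leb. \<sigma> (rep_L1 u x) * rep_L1 (abs_L1 f) x) = (LINT x|unit_leb. \<sigma> (rep_L1 u x) * f x)"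
    by (rule integral_cong_AE) (use ae in \<open>auto elim: eventually_mono\<close>)
  ultimately show "H_hat e (lg p) (lg (p + m)) u w = Ham (rep_L1 u) f (\<lambda>t. a t - b t * rep_L1 u t)"
    unfolding H_hat_def Ham_def Let_def weak_deriv_eq[OF w1] weak_deriv_eq[OF w2] z_def[symmetric]
    by (simp add: cont_rep_abs_L1[OF c(1)] pairing_abs_L1[OF zi])
qed

lemma P_eq_dual: "f \<in> A \<Longrightarrow> blinfun_apply (dual_L1 (abs_L1 (\<phi> f))) u = P u f"
  using dual_L1_apply[OF abs_L1_\<phi>_bounded] P_eq_pairing by simp

end

text \<open>Along each ray a supergradient is at least as large as a subgradient; two linear maps
  ordered in this way for \<open>z\<close> and \<open>- z\<close> coincide.\<close>

lemma superdiff_F_subgradient: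
  fixes g :: "'a::real_normed_vector \<Rightarrow> real"
  assumes l: "l \<in> superdiff_F g x" and k: "bounded_linear k" and sub: "\<And>y. g x + k (y - x) \<le> g y"
  shows "blinfun_apply l z = k z"
proof -
  interpret k: bounded_linear k by (rule k)
  have le: "k z \<le> blinfun_apply l z" for z
  proof (cases "z = 0")
    case False
    show ?thesis
    proof (rule field_le_epsilon)
      fix \<eta> :: real assume eta: "0 < \<eta>"
      have "\<forall>\<^sub>F y in at x. ereal ((g y - g x - blinfun_apply l (y - x)) / norm (y - x)) < ereal (\<eta> / norm z)"
      proof -
        have "0 < ereal (\<eta> / norm z)" using eta False by simp
        thus ?thesis using l unfolding superdiff_F_def Limsup_le_iff by blast
      qed
      then obtain d where d: "d > 0" "\<And>y. y \<noteq> x \<Longrightarrow> dist y x < d \<Longrightarrow>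
          (g y - g x - blinfun_apply l (y - x)) / norm (y - x) < \<eta> / norm z"
        unfolding eventually_at by auto
      \<comment> \<open>The half keeps the displaced point strictly inside the ball of radius
        \<open>d\<close>.\<close>
      define h where "h = d / (2 * norm z)"
      have h: "0 < h" using d False by (simp add: h_def)
      have "dist (x + h *\<^sub>R z) x < d" using d False h by (simp add: dist_norm h_def)
      hence "(g (x + h *\<^sub>R z) - g x - h * blinfun_apply l z) / (h * norm z) < \<eta> / norm z"
        using d(2)[of "x + h *\<^sub>R z"] h False by (simp add: blinfun.scaleR_right)
      hence "g (x + h *\<^sub>R z) - g x - h * blinfun_apply l z < h * \<eta>"
        using h False by (subst (asm) pos_divide_less_eq) (auto simp: mult.commute)
      moreover have "g x + h * k z \<le> g (x + h *\<^sub>R z)" using sub[of "x + h *\<^sub>R z"] by (simp add: k.scaleR)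
      ultimately have "h * k z \<le> h * (blinfun_apply l z + \<eta>)" by (simp add: distrib_left)
      thus "k z \<le> blinfun_apply l z + \<eta>" using h by simp
    qed
  qed (simp add: k.zero blinfun.zero_right)
  show ?thesis using le[of z] le[of "- z"] by (simp add: k.neg blinfun.minus_right)
qed

text \<open>The local inequality is used at a small step \<open>h\<close> along \<open>z\<close>;
  convexity bounds the value there by the chord to \<open>x + z\<close>, and division by
  \<open>h\<close> yields the global inequality.\<close>

lemma subdiff_F_convex:
  fixes g :: "'a::real_normed_vector \<Rightarrow> real"
  assumes l: "l \<in> subdiff_F g x" and g: "convex_on UNIV g"
  shows "g x + blinfun_apply l z \<le> g (x + z)"
proof (cases "z = 0")
  case False
  show ?thesis
  proof (rule field_le_epsilon)
    fix \<eta> :: real assume eta: "0 < \<eta>"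
    have "\<forall>\<^sub>F y in at x. ereal (- \<eta> / norm z) < ereal ((g y - g x - blinfun_apply l (y - x)) / norm (y - x))"
    proof -
      have "ereal (- \<eta> / norm z) < 0" using eta False by simp
      thus ?thesis using l unfolding subdiff_F_def le_Liminf_iff by blast
    qed
    then obtain d where d: "d > 0" "\<And>y. y \<noteq> x \<Longrightarrow> dist y x < d \<Longrightarrow>
        - \<eta> / norm z < (g y - g x - blinfun_apply l (y - x)) / norm (y - x)"
      unfolding eventually_at by auto
    \<comment> \<open>The minimum with 1 keeps the point on the segment from \<open>x\<close> to
      \<open>x + z\<close>, where convexity applies.\<close>
    define h where "h = min 1 (d / (2 * norm z))"
    have h: "0 < h" "h \<le> 1" using d False by (auto simp: h_def)
    have "h * norm z \<le> d / (2 * norm z) * norm z" by (intro mult_right_mono) (auto simp: h_def)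
    hence "dist (x + h *\<^sub>R z) x < d" using d False h by (simp add: dist_norm)
    hence "- \<eta> / norm z < (g (x + h *\<^sub>R z) - g x - h * blinfun_apply l z) / (h * norm z)"
      using d(2)[of "x + h *\<^sub>R z"] h False by (simp add: blinfun.scaleR_right)
    hence "- (h * \<eta>) < g (x + h *\<^sub>R z) - g x - h * blinfun_apply l z"
      using h False by (simp add: field_simps)
    moreover have "g (x + h *\<^sub>R z) \<le> (1 - h) * g x + h * g (x + z)"
    proof -
      have "g ((1 - h) *\<^sub>R x + h *\<^sub>R (x + z)) \<le> (1 - h) * g x + h * g (x + z)"
        by (rule convex_onD[OF g]) (use h in auto)
      thus ?thesis by (simp add: algebra_simps)
    qed
    ultimately have "h * (g x + blinfun_apply l z) \<le> h * (g (x + z) + \<eta>)" by (simp add: algebra_simps)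
    thus "g x + blinfun_apply l z \<le> g (x + z) + \<eta>" using h by simp
  qed
qed (simp add: blinfun.zero_right)

theorem theorem7p3:
  fixes \<rho>0 \<rho>1 \<phi>0 \<phi>1 \<epsilon> :: real and \<Lambda>h :: "L1 \<Rightarrow> real"
  assumes "0 < \<rho>0" and "\<rho>0 < \<rho>1" and "\<rho>1 < 1"
    and "\<phi>0 = ln (\<rho>0 / (1 - \<rho>0))" and "\<phi>1 = ln (\<rho>1 / (1 - \<rho>1))"
    and "0 < \<epsilon>" and "\<epsilon> < 1 / (\<phi>1 - \<phi>0)"
    and "\<Lambda>h = (\<lambda>\<rho>. real_of_ereal (Lambda_hat \<epsilon> \<phi>0 \<phi>1 \<rho>))"
  shows "(\<forall>\<rho>. Lambda_hat \<epsilon> \<phi>0 \<phi>1 \<rho> = ereal (\<Lambda>h \<rho>)) \<and>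
    convex_on UNIV \<Lambda>h \<and>
    continuous_on UNIV \<Lambda>h \<and>
    (\<forall>\<rho>. \<exists>r>0. \<exists>L. L-lipschitz_on (ball \<rho> r) \<Lambda>h) \<and>
    (\<forall>\<rho>. superdiff_F \<Lambda>h \<rho> \<subseteq> dual_L1 ` W_bc \<phi>0 \<phi>1 \<and>
          subdiff_F \<Lambda>h \<rho> \<subseteq> dual_L1 ` W_bc \<phi>0 \<phi>1) \<and>
    (\<forall>\<rho>\<in>M_hat.
       (\<forall>w\<in>W_bc \<phi>0 \<phi>1. dual_L1 w \<in> superdiff_F \<Lambda>h \<rho> \<longrightarrow> H_hat \<epsilon> \<rho>0 \<rho>1 \<rho> w \<le> 0) \<and>
       (\<forall>w\<in>W_bc \<phi>0 \<phi>1. dual_L1 w \<in> subdiff_F \<Lambda>h \<rho> \<longrightarrow> H_hat \<epsilon> \<rho>0 \<rho>1 \<rho> w \<ge> 0))"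
proof -
  define m where "m = \<phi>1 - \<phi>0"
  have "ln (\<rho>0 / (1 - \<rho>0)) < ln (\<rho>1 / (1 - \<rho>1))"
    using assms(1-3) by (subst ln_less_cancel_iff) (auto simp: field_simps)
  hence m: "0 < m" using assms(4,5) by (simp add: m_def)
  have em: "\<epsilon> * m < 1" using assms(7) m unfolding m_def by (simp add: field_simps)
  interpret profile_data \<epsilon> \<phi>0 m by unfold_locales (use assms(6) m em in auto)
  have p1: "\<phi>0 + m = \<phi>1" by (simp add: m_def)
  have lg: "lg \<phi>0 = \<rho>0" "lg \<phi>1 = \<rho>1" unfolding assms(4,5) using assms(1-3) by (auto intro: lg_logit)
  have L: "Lambda_hat \<epsilon> \<phi>0 \<phi>1 \<rho> = ereal (Vh \<rho>)" for \<rho> using Lambda_hat_eq[of \<rho>] by (simp add: p1)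
  have Lh: "\<Lambda>h = Vh" unfolding assms(8) L by simp
  \<comment> \<open>Any one maximiser gives a subgradient, and a supergradient must equal it; so the
    choice of the maximiser is immaterial.\<close>
  have super: "\<exists>f. maximiser (rep_L1 \<rho>) f \<and> l = dual_L1 (abs_L1 (\<phi> f))" if "l \<in> superdiff_F Vh \<rho>" for l \<rho>
  proof -
    obtain f where f: "maximiser (rep_L1 \<rho>) f" using maximiser_exists[OF rep_L1_integrable] .
    have fA: "f \<in> A" by (rule maximiserD(1)[OF f rep_L1_integrable])
    have "l = dual_L1 (abs_L1 (\<phi> f))"
    proof (rule blinfun_eqI)
      fix u
      show "blinfun_apply l u = blinfun_apply (dual_L1 (abs_L1 (\<phi> f))) u"
        unfolding P_eq_dual[OF fA]
        by (rule superdiff_F_subgradient[OF that P_bounded_linear[OF fA] Vh_subgradient[OF f]])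
    qed
    thus ?thesis using f by blast
  qed
  have sub: "\<exists>f a b. relaxed (rep_L1 \<rho>) f a b \<and> l = dual_L1 (abs_L1 (\<phi> f))" if l: "l \<in> subdiff_F Vh \<rho>" for l \<rho>
  proof -
    obtain f a b where g: "relaxed (rep_L1 \<rho>) f a b" and eq: "\<And>v. blinfun_apply l v = P v f"
      using subgradient_representation[OF blinfun.bounded_linear_right[of l] subdiff_F_convex[OF l Vh_convex]] by blast
    have "l = dual_L1 (abs_L1 (\<phi> f))"
      by (rule blinfun_eqI) (simp add: P_eq_dual[OF relaxedD(1)[OF g]] eq)
    thus ?thesis using g by blast
  qed
  \<comment> \<open>The Hamiltonian was computed for a constructed profile; injectivity of
    \<open>dual_L1\<close> on \<open>W21\<close> shows that the given \<open>w\<close> is that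
    profile.\<close>
  have W21: "w = abs_L1 (\<phi> f)" if "relaxed (rep_L1 \<rho>) f a b" "w \<in> W_bc \<phi>0 \<phi>1" "dual_L1 w = dual_L1 (abs_L1 (\<phi> f))" for \<rho> f a b w
    by (rule dual_L1_inj_W21) (use relaxed_W_bc(1)[OF that(1)] that(2,3) in \<open>auto simp: W_bc_def\<close>)
  show ?thesis unfolding Lh
  proof (intro conjI allI ballI impI)
    show "Lambda_hat \<epsilon> \<phi>0 \<phi>1 \<rho> = ereal (Vh \<rho>)" for \<rho> by (rule L)
    show "convex_on UNIV Vh" by (rule Vh_convex)
    show "continuous_on UNIV Vh" by (rule lipschitz_on_continuous_on[OF Vh_lipschitz])
    show "\<exists>r>0. \<exists>L. L-lipschitz_on (ball \<rho> r) Vh" for \<rho>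
      using Vh_lipschitz zero_less_one by blast
    show "superdiff_F Vh \<rho> \<subseteq> dual_L1 ` W_bc \<phi>0 \<phi>1" for \<rho>
    proof
      fix l assume "l \<in> superdiff_F Vh \<rho>"
      then obtain f where f: "maximiser (rep_L1 \<rho>) f" "l = dual_L1 (abs_L1 (\<phi> f))" using super by blast
      show "l \<in> dual_L1 ` W_bc \<phi>0 \<phi>1"
        using relaxed_W_bc(1)[OF maximiser_relaxed[OF f(1) rep_L1_integrable]] f(2) by (simp add: p1)
    qed
    show "subdiff_F Vh \<rho> \<subseteq> dual_L1 ` W_bc \<phi>0 \<phi>1" for \<rho>
    proof
      fix l assume "l \<in> subdiff_F Vh \<rho>"
      then obtain f a b where f: "relaxed (rep_L1 \<rho>) f a b" "l = dual_L1 (abs_L1 (\<phi> f))" using sub by blast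
      show "l \<in> dual_L1 ` W_bc \<phi>0 \<phi>1" using relaxed_W_bc(1)[OF f(1)] f(2) by (simp add: p1)
    qed
    fix \<rho> w assume "\<rho> \<in> M_hat" and w: "w \<in> W_bc \<phi>0 \<phi>1"
    hence r01: "AE x in unit_leb. 0 \<le> rep_L1 \<rho> x \<and> rep_L1 \<rho> x \<le> 1" by (simp add: M_hat_def)
    show "H_hat \<epsilon> \<rho>0 \<rho>1 \<rho> w \<le> 0" if l: "dual_L1 w \<in> superdiff_F Vh \<rho>"
    proof -
      obtain f where f: "maximiser (rep_L1 \<rho>) f" "dual_L1 w = dual_L1 (abs_L1 (\<phi> f))" using super[OF l] by blast
      note g = maximiser_relaxed[OF f(1) rep_L1_integrable]
      show ?thesis
        unfolding W21[OF g w f(2)] using relaxed_W_bc(2)[OF g r01] Ham_maximiser[OF f(1) rep_L1_integrable r01]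
        by (simp add: p1 lg)
    qed
    show "0 \<le> H_hat \<epsilon> \<rho>0 \<rho>1 \<rho> w" if l: "dual_L1 w \<in> subdiff_F Vh \<rho>"
    proof -
      obtain f a b where f: "relaxed (rep_L1 \<rho>) f a b" "dual_L1 w = dual_L1 (abs_L1 (\<phi> f))" using sub[OF l] by blast
      show ?thesis
        unfolding W21[OF f(1) w f(2)] using relaxed_W_bc(2)[OF f(1) r01] relaxedD(8)[OF f(1) r01]
        by (simp add: p1 lg)
    qed
  qed
qed

end
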